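(* Assume $2\mu\bar c>\sigma^2 r$. There exists a pair $(v,u)$ of functions on $\mathcal{Q}$ that satisfies $$v(x,c)=g(x)+\int_c^{\bar c}u(x,s)\,ds,\quad (x,c)\in\mathcal{Q},$$ and such that $v$ is a solution to the HJB equation (H) and $u$ is a solution to the variational inequality (U), in the senses specified in the context. Furthermore, for each constant $\alpha\in(0,1)$ there is a constant $K>0$ such that for all $(x,c)\in\mathcal{Q}$: $$0\le v\le \frac{\bar c}{r},\qquad 0\le v_x\le K,\qquad 0\le -v_c\le K,$$ $$v_x(y,c)\le\max\{v_x(x,c),1\}\quad\text{for all } y \text{ with } 0\le x\le y,$$ $$|u(\cdot,c)|_{C^{1+\alpha}(\mathbb{R}^+)}\le K,\qquad |u_c(\cdot,c)|\le K.$$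
   Context: Fix constants $\mu>0$, $\sigma>0$, $r>0$, $\bar c\in[0,\mu]$ with $2\mu\bar c>\sigma^2r$. Write $\mathbb{R}^+=[0,\infty)$, $\mathcal{Q}=\mathbb{R}^+\times[0,\bar c]$. Let $g(x)=\frac{\bar c}{r}(1-e^{-\gamma x})$ with $\gamma=\frac{(\mu-\bar c)+\sqrt{(\mu-\bar c)^2+2\sigma^2 r}}{\sigma^2}$, and for $c\in[0,\bar c]$ let $$\mathcal{L}_c v=\tfrac12\sigma^2 v_{xx}+(\mu-c)v_x-rv.$$ $W^{2,p}_{\rm loc}(\mathbb{R}^+)$ denotes functions belonging to the Sobolev space $W^{2,p}((0,L))$ for every $L>0$. (H) The HJB equation is $\min\{-\mathcal{L}_cv-c,\,-v_c\}=0$ on $\mathcal{Q}$, with $v(0,c)=0$ for $c\in[0,\bar c]$ and $v(x,\bar c)=g(x)$ for $x\in\mathbb{R}^+$. A function $v:\mathcal{Q}\to\mathbb{R}$ is a solution to (H) if: (1) $v,v_x,v_c$ are continuous and bounded in $\mathcal{Q}$, $v_c\le0$ in $\mathcal{Q}$, and $v(\cdot,c)\in W^{2,p}_{\rm loc}(\mathbb{R}^+)$ for each $c\in[0,\bar c]$ and each $p>1$; (2) $v(0,c)=0$ for all $c\in[0,\bar c]$ and $v(x,\bar c)=g(x)$ for all $x\in\mathbb{R}^+$; (3) for each $c\in[0,\bar c]$, $-\mathcal{L}_cv(\cdot,c)-c\ge0$ a.e. in $\mathbb{R}^+$; (4) if $v_c(x,c)<0$, then $-\mathcal{L}_cv(y,c)-c=0$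 for all $y\in[0,x]$ (in the classical sense). (U) The variational inequality is $\min\{-\mathcal{L}_cu-g'(x)-\int_c^{\bar c}u_x(x,s)\,ds+1,\ u\}=0$ on $\mathcal{Q}$, with $u(0,c)=0$ for $c\in[0,\bar c]$. A function $u:\mathcal{Q}\to\mathbb{R}^+$ is a solution to (U) if: (1) $u$ and $u_x$ are continuous and bounded in $\mathcal{Q}$, and $u(\cdot,c)\in W^{2,p}_{\rm loc}(\mathbb{R}^+)$ for each $c\in[0,\bar c]$ and each $p>1$; and $u(0,c)=0$ for all $c\in[0,\bar c]$; (2) for each $c\in[0,\bar c]$, $-\mathcal{L}_cu-g'(x)-\int_c^{\bar c}u_x(x,s)\,ds+1\ge0$ a.e. in $\mathbb{R}^+$; (3) if $u(x,c)>0$ for some $(x,c)\in\mathcal{Q}$, then $-\mathcal{L}_cu(y,c)-g'(y)-\int_c^{\bar c}u_x(y,s)\,ds+1=0$ for all $y\in[0,x]$. *)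

theory Defs
  imports "HOL-Analysis.Analysis"
begin

section \<open>Sobolev and Hoelder spaces on subsets of the real line\<close>

definition test_fun :: "real set \<Rightarrow> (real \<Rightarrow> real) \<Rightarrow> bool" where
  "test_fun S \<phi> \<longleftrightarrow>
     (\<forall>n x. (deriv ^^ n) \<phi> field_differentiable (at x)) \<and>
     compact (closure {x. \<phi> x \<noteq> 0}) \<and> closure {x. \<phi> x \<noteq> 0} \<subseteq> S"

definition locally_integrable_on :: "real set \<Rightarrow> (real \<Rightarrow> real) \<Rightarrow> bool" where
  "locally_integrable_on S f \<longleftrightarrow> (\<forall>C. compact C \<and> C \<subseteq> S \<longrightarrow> integrable (lebesgue_on C) f)"

definition has_weak_deriv :: "nat \<Rightarrow> real set \<Rightarrow> (real \<Rightarrow> real) \<Rightarrow> (real \<Rightarrow> real) \<Rightarrow> bool" where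
  "has_weak_deriv k S f w \<longleftrightarrow>
     locally_integrable_on S f \<and> locally_integrable_on S w \<and>
     (\<forall>\<phi>. test_fun S \<phi> \<longrightarrow>
        integral\<^sup>L (lebesgue_on S) (\<lambda>x. f x * (deriv ^^ k) \<phi> x) =
        (- 1) ^ k * integral\<^sup>L (lebesgue_on S) (\<lambda>x. w x * \<phi> x))"

definition in_Lp :: "real \<Rightarrow> real set \<Rightarrow> (real \<Rightarrow> real) \<Rightarrow> bool" where
  "in_Lp p S f \<longleftrightarrow>
     f \<in> borel_measurable (lebesgue_on S) \<and> integrable (lebesgue_on S) (\<lambda>x. \<bar>f x\<bar> powr p)"

definition in_Sobolev :: "nat \<Rightarrow> real \<Rightarrow> real set \<Rightarrow> (real \<Rightarrow> real) \<Rightarrow> bool" where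
  "in_Sobolev k p S f \<longleftrightarrow>
     in_Lp p S f \<and> (\<forall>j\<in>{1..k}. \<exists>w. has_weak_deriv j S f w \<and> in_Lp p S w)"

definition in_W2p_loc :: "real \<Rightarrow> (real \<Rightarrow> real) \<Rightarrow> bool" where
  "in_W2p_loc p f \<longleftrightarrow> (\<forall>L>0. in_Sobolev 2 p {0<..<L} f)"

text \<open>The \<open>C\<^sup>1\<^sup>+\<^sup>\<alpha>\<close> norm takes the value \<open>\<infinity>\<close> on functions outside the space. Derivatives are
  relative to \<open>S\<close>, hence one-sided at boundary points.\<close>

definition C1_Hoelder_norm :: "real \<Rightarrow> real set \<Rightarrow> (real \<Rightarrow> real) \<Rightarrow> ennreal" where
  "C1_Hoelder_norm \<alpha> S f =
     (if f differentiable_on S then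
        (let f' = (\<lambda>x. vector_derivative f (at x within S)) in
           (SUP x\<in>S. ennreal \<bar>f x\<bar>) + (SUP x\<in>S. ennreal \<bar>f' x\<bar>) +
           (SUP x\<in>S. SUP y\<in>S - {x}. ennreal (\<bar>f' x - f' y\<bar> / \<bar>x - y\<bar> powr \<alpha>)))
      else \<infinity>)"


section \<open>The two problems\<close>

definition Qdom :: "real \<Rightarrow> (real \<times> real) set" where
  "Qdom cbar = {0..} \<times> {0..cbar}"

definition cont_bdd_on_Q :: "real \<Rightarrow> (real \<Rightarrow> real \<Rightarrow> real) \<Rightarrow> bool" where
  "cont_bdd_on_Q cbar f \<longleftrightarrow>
     continuous_on (Qdom cbar) (\<lambda>(x, c). f x c) \<and> bounded ((\<lambda>(x, c). f x c) ` Qdom cbar)"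

text \<open>First partial derivatives, relative to the domain. Their values are meaningful only where
  the derivative exists, so every use is accompanied by \<open>x_differentiable\<close> or \<open>c_differentiable\<close>.\<close>

definition Dx :: "(real \<Rightarrow> real \<Rightarrow> real) \<Rightarrow> real \<Rightarrow> real \<Rightarrow> real" where
  "Dx f x c = vector_derivative (\<lambda>y. f y c) (at x within {0..})"

definition Dc :: "real \<Rightarrow> (real \<Rightarrow> real \<Rightarrow> real) \<Rightarrow> real \<Rightarrow> real \<Rightarrow> real" where
  "Dc cbar f x c = vector_derivative (\<lambda>s. f x s) (at c within {0..cbar})"

definition x_differentiable :: "real \<Rightarrow> (real \<Rightarrow> real \<Rightarrow> real) \<Rightarrow> bool" where
  "x_differentiable cbar f \<longleftrightarrow> (\<forall>c\<in>{0..cbar}. (\<lambda>y. f y c) differentiable_on {0..})"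

definition c_differentiable :: "real \<Rightarrow> (real \<Rightarrow> real \<Rightarrow> real) \<Rightarrow> bool" where
  "c_differentiable cbar f \<longleftrightarrow> (\<forall>x\<ge>0. (\<lambda>s. f x s) differentiable_on {0..cbar})"

definition gam :: "real \<Rightarrow> real \<Rightarrow> real \<Rightarrow> real \<Rightarrow> real" where
  "gam \<mu> \<sigma> r cbar = ((\<mu> - cbar) + sqrt ((\<mu> - cbar)\<^sup>2 + 2 * \<sigma>\<^sup>2 * r)) / \<sigma>\<^sup>2"

definition gfun :: "real \<Rightarrow> real \<Rightarrow> real \<Rightarrow> real \<Rightarrow> real \<Rightarrow> real" where
  "gfun \<mu> \<sigma> r cbar x = cbar / r * (1 - exp (- gam \<mu> \<sigma> r cbar * x))"

text \<open>\<open>Lop \<mu> \<sigma> r c f w x\<close> is the value at \<open>(x, c)\<close> of the operator \<open>\<L>\<^sub>c f\<close>, where \<open>w\<close> is the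
  value of the second \<open>x\<close>-derivative of \<open>f\<close> at that point; it is passed separately because it is
  a weak derivative in the inequalities below and a classical one in the equations.\<close>

definition Lop :: "real \<Rightarrow> real \<Rightarrow> real \<Rightarrow> real \<Rightarrow> (real \<Rightarrow> real \<Rightarrow> real) \<Rightarrow> real \<Rightarrow> real \<Rightarrow> real" where
  "Lop \<mu> \<sigma> r c f w x = 1 / 2 * \<sigma>\<^sup>2 * w + (\<mu> - c) * Dx f x c - r * f x c"

definition HJB_solution ::
  "real \<Rightarrow> real \<Rightarrow> real \<Rightarrow> real \<Rightarrow> (real \<Rightarrow> real \<Rightarrow> real) \<Rightarrow> bool" where
  "HJB_solution \<mu> \<sigma> r cbar v \<longleftrightarrow>
     x_differentiable cbar v \<and> c_differentiable cbar v \<and>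
     cont_bdd_on_Q cbar v \<and> cont_bdd_on_Q cbar (Dx v) \<and> cont_bdd_on_Q cbar (Dc cbar v) \<and>
     (\<forall>(x, c)\<in>Qdom cbar. Dc cbar v x c \<le> 0) \<and>
     (\<forall>c\<in>{0..cbar}. \<forall>p>1. in_W2p_loc p (\<lambda>x. v x c)) \<and>
     (\<forall>c\<in>{0..cbar}. v 0 c = 0) \<and>
     (\<forall>x\<ge>0. v x cbar = gfun \<mu> \<sigma> r cbar x) \<and>
     (\<forall>c\<in>{0..cbar}. \<exists>w. has_weak_deriv 2 {0<..} (\<lambda>x. v x c) w \<and>
        (AE x in lebesgue_on {0<..}. - Lop \<mu> \<sigma> r c v (w x) x - c \<ge> 0)) \<and>
     (\<forall>(x, c)\<in>Qdom cbar. Dc cbar v x c < 0 \<longrightarrow>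
        (\<forall>y\<in>{0..x}. \<exists>w. ((\<lambda>z. Dx v z c) has_real_derivative w) (at y within {0..}) \<and>
           - Lop \<mu> \<sigma> r c v w y - c = 0))"

definition VI_solution ::
  "real \<Rightarrow> real \<Rightarrow> real \<Rightarrow> real \<Rightarrow> (real \<Rightarrow> real \<Rightarrow> real) \<Rightarrow> bool" where
  "VI_solution \<mu> \<sigma> r cbar u \<longleftrightarrow>
     (\<forall>(x, c)\<in>Qdom cbar. u x c \<ge> 0) \<and>
     x_differentiable cbar u \<and>
     cont_bdd_on_Q cbar u \<and> cont_bdd_on_Q cbar (Dx u) \<and>
     (\<forall>c\<in>{0..cbar}. \<forall>p>1. in_W2p_loc p (\<lambda>x. u x c)) \<and>
     (\<forall>c\<in>{0..cbar}. u 0 c = 0) \<and>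
     (\<forall>c\<in>{0..cbar}. \<exists>w. has_weak_deriv 2 {0<..} (\<lambda>x. u x c) w \<and>
        (AE x in lebesgue_on {0<..}.
           - Lop \<mu> \<sigma> r c u (w x) x - deriv (gfun \<mu> \<sigma> r cbar) x
             - integral {c..cbar} (\<lambda>s. Dx u x s) + 1 \<ge> 0)) \<and>
     (\<forall>(x, c)\<in>Qdom cbar. u x c > 0 \<longrightarrow>
        (\<forall>y\<in>{0..x}. \<exists>w. ((\<lambda>z. Dx u z c) has_real_derivative w) (at y within {0..}) \<and>
           - Lop \<mu> \<sigma> r c u w y - deriv (gfun \<mu> \<sigma> r cbar) y
             - integral {c..cbar} (\<lambda>s. Dx u y s) + 1 = 0))"

end

theory Submission
  imports Defs
begin

text \<open>
  Put \<open>f = v\<^sub>x - 1\<close>, let \<open>S\<^sub>c\<close> solve \<open>\<L>\<^sub>c S = 0\<close>, \<open>S(0) = 0\<close>, let \<open>\<kappa> = 2(\<mu> - c)/\<sigma>\<^sup>2\<close>, \<open>\<psi>\<^sub>c = exp(\<kappa>x) S\<^sub>c\<close>, and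
  let \<open>G(x,c)\<close> be the integral of \<open>\<psi>\<^sub>c f(\<cdot>,c)\<close> over \<open>[0,x]\<close>. As soon as \<open>G(\<cdot>,c)\<close> changes sign only once, at
  \<open>b(c)\<close> say, and \<open>f < 0\<close> beyond \<open>b(c)\<close>, the obstacle problem for \<open>u(\<cdot>,c)\<close> is solved by quadrature: \<open>u(x,c)\<close> is
  \<open>2 S\<^sub>c(x)/\<sigma>\<^sup>2\<close> times the integral of \<open>exp(\<kappa>z) G\<^sup>+/\<psi>\<^sub>c\<^sup>2\<close> over \<open>[x,B]\<close>. This formula makes sense for every
  \<open>f\<close> and is Lipschitz in \<open>f\<close>, uniformly up to the first derivative of \<open>u\<close>, so that \<open>\<partial>f/\<partial>c = - u\<^sub>x\<close> is an ordinary
  differential equation in a space of continuous functions, solvable by Picard iteration.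

  That \<open>G\<close> does change sign only once is shown by continuation from \<open>c = cbar\<close> downwards. Green's
  identity gives \<open>\<partial>G/\<partial>c > 0\<close> wherever \<open>G \<le> 0\<close>, so \<open>b\<close> is strictly increasing; consequently \<open>\<L>\<^sub>c v + c = 0\<close>
  to the left of \<open>b(c)\<close>, and the maximum principle for \<open>v\<^sub>x\<close> yields the sign structure of \<open>f\<close>. The only way
  to break down is \<open>v\<^sub>x = 1\<close> at \<open>b(c)\<close>; but then \<open>v\<^sub>x \<ge> 1\<close> on \<open>[0,b(c)]\<close>, contradicting \<open>G(b(c),c) = 0\<close>.
\<close>

section \<open>Analytic preliminaries\<close>

text \<open>The quadrature comes from reduction of order. With \<open>a = 2/\<sigma>^2\<close> and
  \<open>u = S \<phi>\<close>, the equation \<open>u'' + \<kappa> u' - a r u = - a f\<close> becomes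
  \<open>(psi^2 exp(- \<kappa> x) \<phi>')' = - a psi f\<close>, so
  \<open>\<phi>' = - a exp(\<kappa> x) G / psi^2\<close>. If the integral ends at \<open>b\<close>,
  then \<open>u(b) = 0\<close> is automatic and smooth fit \<open>u_x(b) = 0\<close> is exactly
  \<open>G(b,c) = 0\<close>. Replacing \<open>G\<close> by its positive part allows the known end
  \<open>B\<close> in place of the unknown \<open>b\<close>; this is why the formula needs no
  information about the free boundary. The condition \<open>2 \<mu> cbar > \<sigma>^2 r\<close>
  enters as \<open>g'(0) > 1\<close>. It makes \<open>f\<close> positive near \<open>x = 0\<close>
  uniformly in \<open>c\<close>, so the free boundary cannot collapse to 0. The obstacle to
  regularity is that \<open>u_xx\<close> jumps at the free boundary. Since \<open>b\<close> is
  strictly monotone, a fixed \<open>x\<close> is the boundary point of at most one level. The jump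
  disappears on integrating over the levels, \<open>v_xx\<close> is a classical derivative
  everywhere, and the maximum principle can be applied to \<open>v_x\<close>.\<close>

lemma has_real_derivative_at_closed_interval:
  fixes F \<phi> :: "real \<Rightarrow> real"
  assumes F: "continuous_on {a..b} F" and \<phi>: "continuous_on {a..b} \<phi>"
    and der: "\<And>x. a < x \<Longrightarrow> x < b \<Longrightarrow> (F has_real_derivative \<phi> x) (at x)"
    and x: "x \<in> {a..b}"
  shows "(F has_real_derivative \<phi> x) (at x within {a..b})"
proof -
  have eq: "F y = F a + integral {a..y} \<phi>" if y: "y \<in> {a..b}" for y
  proof -
    have "(\<phi> has_integral F y - F a) {a..y}"
    proof (rule fundamental_theorem_of_calculus_interior)
      show "continuous_on {a..y} F" by (rule continuous_on_subset[OF F]) (use y in auto)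
      show "(F has_vector_derivative \<phi> z) (at z)" if "z \<in> {a<..<y}" for z
        using der[of z] that y by (simp add: has_real_derivative_iff_has_vector_derivative)
    qed (use y in auto)
    from integral_unique[OF this] show ?thesis by simp
  qed
  have "((\<lambda>y. F a + integral {a..y} \<phi>) has_real_derivative \<phi> x) (at x within {a..b})"
    using integral_has_real_derivative[OF \<phi> x] by (auto intro!: derivative_eq_intros)
  then show ?thesis
    by (rule has_field_derivative_transform_within[OF _ zero_less_one x]) (metis eq)
qed

text \<open>Fixing the interval moves the dependence on the endpoints into the integrand. The same
  scaling later removes the singularity of \<open>G / psi^2\<close> at 0.\<close>

lemma integral_scale_unit:
  fixes h :: "real \<Rightarrow> real"
  assumes "continuous_on {a..b} h" "a \<le> b"
  shows "integral {a..b} h = (b - a) * integral {0..1} (\<lambda>t. h (a + (b - a) * t))"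
proof -
  let ?g = "\<lambda>t. a + (b - a) * t"
  have "?g ` {0..1} \<subseteq> {a..b}"
  proof safe
    fix t :: real assume "t \<in> {0..1}"
    then show "?g t \<in> {a..b}"
      using assms(2) mult_left_mono[of t 1 "b - a"] mult_nonneg_nonneg[of "b - a" t] by simp
  qed
  moreover have "continuous_on {0..1} ?g" by (intro continuous_intros)
  moreover have "(?g has_real_derivative b - a) (at t within {0..1})" for t
    by (auto intro!: derivative_eq_intros)
  ultimately have "((\<lambda>t. (b - a) *\<^sub>R h (?g t)) has_integral integral {?g 0..?g 1} h) {0..1}"
    using assms has_integral_substitution_strong[of "{}" 0 1 ?g a b h "\<lambda>_. b - a"] by simp
  from integral_unique[OF this] show ?thesis by simp
qed

section \<open>Jointly continuous functions of two variables\<close>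

abbreviation jcont :: "'a::topological_space set \<Rightarrow> 'b::topological_space set \<Rightarrow> ('a \<Rightarrow> 'b \<Rightarrow> real) \<Rightarrow> bool"
  where "jcont X Y f \<equiv> continuous_on (X \<times> Y) (\<lambda>p. f (fst p) (snd p))"

lemma jcont_compose:
  assumes "jcont X Y f" "continuous_on A g" "continuous_on A h" "g ` A \<subseteq> X" "h ` A \<subseteq> Y"
  shows "continuous_on A (\<lambda>w. f (g w) (h w))"
  using continuous_on_compose2[OF assms(1) continuous_on_Pair[OF assms(2,3)]] assms(4,5) by force

lemma jcont_swap: "jcont X Y f \<Longrightarrow> jcont Y X (\<lambda>y x. f x y)"
  by (rule jcont_compose[of X Y f "Y \<times> X" snd fst])
    (auto intro!: continuous_on_fst continuous_on_snd continuous_on_id)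

lemma jcont_slice1: "jcont X Y f \<Longrightarrow> x \<in> X \<Longrightarrow> continuous_on Y (f x)"
  using jcont_compose[of X Y f Y "\<lambda>_. x" "\<lambda>y. y"] by auto

lemma jcont_slice2: "jcont X Y f \<Longrightarrow> y \<in> Y \<Longrightarrow> continuous_on X (\<lambda>x. f x y)"
  using jcont_compose[of X Y f X "\<lambda>x. x" "\<lambda>_. y"] by auto

lemma jcont_bounded:
  assumes "jcont X Y f" "compact X" "compact Y"
  obtains M where "M > 0" "\<And>x y. x \<in> X \<Longrightarrow> y \<in> Y \<Longrightarrow> \<bar>f x y\<bar> \<le> M"
proof -
  have "bounded ((\<lambda>p. f (fst p) (snd p)) ` (X \<times> Y))"
    by (intro compact_imp_bounded compact_continuous_image compact_Times assms)
  then obtain M where "M > 0" "\<forall>z\<in>(\<lambda>p. f (fst p) (snd p)) ` (X \<times> Y). norm z \<le> M"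
    unfolding bounded_pos by blast
  then have "\<bar>f x y\<bar> \<le> M" if "x \<in> X" "y \<in> Y" for x y
    using that by (metis (no_types, lifting) SigmaI fst_conv image_eqI real_norm_def snd_conv)
  then show thesis using that \<open>M > 0\<close> by blast
qed

lemma continuous_on_integral_lower:
  fixes h :: "'a::topological_space \<Rightarrow> real \<Rightarrow> real"
  assumes h: "jcont X {c0..c1} h" and l: "continuous_on X l" "l ` X \<subseteq> {c0..c1}"
  shows "continuous_on X (\<lambda>x. integral {l x..c1} (h x))"
proof -
  have in_range: "l x + (c1 - l x) * t \<in> {c0..c1}" if "x \<in> X" "0 \<le> t" "t \<le> 1" for x t
  proof -
    have "c0 \<le> l x" "l x \<le> c1" using that l by auto
    moreover have "0 \<le> (c1 - l x) * t" "(c1 - l x) * t \<le> c1 - l x"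
      using that calculation mult_left_mono[of t 1 "c1 - l x"] by auto
    ultimately show ?thesis by auto
  qed
  have eq: "integral {l x..c1} (h x) = (c1 - l x) * integral {0..1} (\<lambda>t. h x (l x + (c1 - l x) * t))"
    if "x \<in> X" for x
    using that l by (intro integral_scale_unit continuous_on_subset[OF jcont_slice1[OF h]]) auto
  have "continuous_on (X \<times> cbox 0 1) (\<lambda>p. h (fst p) (l (fst p) + (c1 - l (fst p)) * snd p))"
    by (rule jcont_compose[OF h])
      (use in_range in \<open>auto intro!: continuous_intros continuous_on_compose2[OF l(1)]\<close>)
  then have "continuous_on X (\<lambda>x. integral (cbox 0 1) (\<lambda>t. h x (l x + (c1 - l x) * t)))"
    by (intro integral_continuous_on_param) (simp add: case_prod_unfold)
  then have "continuous_on X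
      (\<lambda>x. (c1 - l x) * integral {0..1} (\<lambda>t. h x (l x + (c1 - l x) * t)))"
    by (auto intro!: continuous_intros l)
  then show ?thesis by (simp add: eq cong: continuous_on_cong)
qed

text \<open>Here \<open>k\<close> may be discontinuous and the exceptional null set may depend on
  \<open>x0\<close>, as happens for positive parts and for \<open>u_x\<close> across the free
  boundary. The Lipschitz bound dominates the difference quotients, and integrability of
  \<open>k\<close> comes out of their convergence.\<close>

lemma integral_dominated_quotients:
  fixes K :: "real \<Rightarrow> real \<Rightarrow> real" and \<xi> :: "nat \<Rightarrow> real"
  assumes x0: "x0 \<in> X" and \<xi>: "\<And>n. \<xi> n \<in> X - {x0}" and lim: "\<xi> \<longlonglongrightarrow> x0"
    and int: "\<And>x. x \<in> X \<Longrightarrow> K x integrable_on {a..b}"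
    and N: "negligible N"
    and lip: "\<And>x s. x \<in> X \<Longrightarrow> s \<in> {a..b} - N \<Longrightarrow> \<bar>K x s - K x0 s\<bar> \<le> M * \<bar>x - x0\<bar>"
    and der: "\<And>s. s \<in> {a..b} - N \<Longrightarrow> ((\<lambda>x. K x s) has_real_derivative k s) (at x0 within X)"
  shows "k integrable_on {a..b}"
    and "(\<lambda>n. (integral {a..b} (K (\<xi> n)) - integral {a..b} (K x0)) / (\<xi> n - x0)) \<longlonglongrightarrow> integral {a..b} k"
proof -
  let ?S = "{a..b} - N"
  let ?h = "\<lambda>n s. (K (\<xi> n) s - K x0 s) / (\<xi> n - x0)"
  have sub: "integral {a..b} f = integral ?S f" for f :: "real \<Rightarrow> real"
    by (intro integral_spike_set negligible_subset[OF N]) auto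
  have subi: "f integrable_on ?S \<longleftrightarrow> f integrable_on {a..b}" for f :: "real \<Rightarrow> real"
    by (intro iffI; erule integrable_spike_set) (auto intro!: negligible_subset[OF N])
  have hi: "?h n integrable_on {a..b}" for n
    using \<xi> x0 by (intro integrable_on_divide integrable_diff int) auto
  have h1: "?h n integrable_on ?S" for n using hi by (simp only: subi)
  have h2: "(\<lambda>_. M) integrable_on ?S" by (simp only: subi integrable_const_ivl)
  have h3: "norm (?h n s) \<le> M" if "s \<in> ?S" for n s
    using lip[of "\<xi> n" s] \<xi>[of n] that by (simp add: abs_divide divide_le_eq)
  have h4: "\<forall>s\<in>?S. (\<lambda>n. ?h n s) \<longlonglongrightarrow> k s"
  proof
    fix s assume "s \<in> ?S"
    then have "((\<lambda>y. (K y s - K x0 s) / (y - x0)) \<longlongrightarrow> k s) (at x0 within X)"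
      using der by (simp add: has_field_derivative_iff)
    then show "(\<lambda>n. ?h n s) \<longlonglongrightarrow> k s"
      using \<xi> lim by (subst (asm) tendsto_at_iff_sequentially) (auto simp: o_def)
  qed
  have "k integrable_on ?S" "(\<lambda>n. integral ?S (?h n)) \<longlonglongrightarrow> integral ?S k"
    using dominated_convergence[of ?h ?S "\<lambda>_. M" k] h1 h2 h3 h4 by blast+
  moreover have "integral ?S (?h n) = (integral {a..b} (K (\<xi> n)) - integral {a..b} (K x0)) / (\<xi> n - x0)" for n
  proof -
    have "integral {a..b} (?h n) = (integral {a..b} (K (\<xi> n)) - integral {a..b} (K x0)) / (\<xi> n - x0)"
      using \<xi>[of n] x0 by (subst Henstock_Kurzweil_Integration.integral_divide) (simp add: integral_diff int)
    then show ?thesis using sub by metis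
  qed
  ultimately show "k integrable_on {a..b}"
    "(\<lambda>n. (integral {a..b} (K (\<xi> n)) - integral {a..b} (K x0)) / (\<xi> n - x0)) \<longlonglongrightarrow> integral {a..b} k"
    by (simp_all only: subi sub[of k])
qed

lemma has_real_derivative_integral_dominated:
  fixes K :: "real \<Rightarrow> real \<Rightarrow> real"
  assumes x0: "x0 \<in> X"
    and int: "\<And>x. x \<in> X \<Longrightarrow> K x integrable_on {a..b}"
    and N: "negligible N"
    and lip: "\<And>x s. x \<in> X \<Longrightarrow> s \<in> {a..b} - N \<Longrightarrow> \<bar>K x s - K x0 s\<bar> \<le> M * \<bar>x - x0\<bar>"
    and der: "\<And>s. s \<in> {a..b} - N \<Longrightarrow> ((\<lambda>x. K x s) has_real_derivative k s) (at x0 within X)"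
  shows "((\<lambda>x. integral {a..b} (K x)) has_real_derivative integral {a..b} k) (at x0 within X)"
    and "x0 islimpt X \<Longrightarrow> k integrable_on {a..b}"
proof -
  show "((\<lambda>x. integral {a..b} (K x)) has_real_derivative integral {a..b} k) (at x0 within X)"
    unfolding has_field_derivative_iff tendsto_at_iff_sequentially o_def
    using integral_dominated_quotients(2)[OF x0 _ _ int N lip der] by blast
  assume "x0 islimpt X"
  then obtain \<xi> where "\<And>n. \<xi> n \<in> X - {x0}" "\<xi> \<longlonglongrightarrow> x0"
    unfolding islimpt_sequential by blast
  from integral_dominated_quotients(1)[OF x0 this int N lip der] show "k integrable_on {a..b}" by blast
qed

text \<open>Zeros of \<open>h\<close> can only be crossed upwards. If \<open>h t \<ge> 0\<close>,
  there is a last nonnegative point \<open>s\<close> before \<open>c2\<close>; continuity gives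
  \<open>h s = 0\<close>, and the positive derivative there makes \<open>h\<close> positive just
  after \<open>s\<close>, which is absurd.\<close>

lemma neg_before_barrier:
  fixes h :: "real \<Rightarrow> real"
  assumes end_le: "h c2 \<le> 0" 
    and der: "\<And>t. t \<in> {c1..c2} \<Longrightarrow> h t \<le> 0 \<Longrightarrow> \<exists>d>0. (h has_real_derivative d) (at t within {c1..c2})"
    and cont: "continuous_on {c1..c2} h"
    and t: "c1 \<le> t" "t < c2"
  shows "h t < 0"
proof (rule ccontr)
  assume "\<not> h t < 0"
  then have ht: "0 \<le> h t" by simp
  obtain d0 where "d0 > 0" "(h has_real_derivative d0) (at c2 within {c1..c2})"
    using der[of c2] end_le t by auto
  then obtain \<delta> where \<delta>: "\<delta> > 0" "\<And>e. 0 < e \<Longrightarrow> c2 - e \<in> {c1..c2} \<Longrightarrow> e < \<delta> \<Longrightarrow> h (c2 - e) < h c2"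
    using has_real_derivative_pos_inc_left by metis
  \<comment> \<open>\<open>h\<close> increases strictly into \<open>c2\<close>, where it is
    nonpositive, so it is already negative between \<open>m\<close> and \<open>c2\<close>. Stopping
    at \<open>m\<close> keeps the set \<open>A\<close> of nonnegative points compact and away from
    \<open>c2\<close>.\<close>
  define m where "m = c2 - min \<delta> (c2 - t)"
  have m: "t \<le> m" "m < c2" using t \<delta>(1) by (auto simp: m_def)
  define A where "A = {t..m} \<inter> h -` {0..}"
  have "closed A" unfolding A_def
    using t m by (intro continuous_closed_preimage continuous_on_subset[OF cont]) auto
  then have "compact A"
    unfolding A_def by (metis compact_Icc compact_Int_closed inf.left_idem)
  moreover have "t \<in> A" using ht m unfolding A_def by auto
  ultimately obtain s where s: "s \<in> A" "\<And>s'. s' \<in> A \<Longrightarrow> s' \<le> s"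
    using compact_attains_sup[of A] by blast
  have "s < c2" using s m unfolding A_def by auto
  have neg: "h s' < 0" if "s < s'" "s' < c2" for s'
  proof (cases "s' \<le> m")
    case True
    then have "s' \<notin> A" using s(2)[of s'] that by auto
    then show ?thesis using s(1) that True unfolding A_def by auto
  next
    case False
    then show ?thesis using \<delta>(2)[of "c2 - s'"] that s(1) t m end_le unfolding A_def m_def by (auto simp: min_def split: if_splits)
  qed
  have "h s \<le> 0"
  proof (rule ccontr)
    assume "\<not> h s \<le> 0"
    moreover have "continuous_on {s..c2} h"
      using s t by (intro continuous_on_subset[OF cont]) (auto simp: A_def)
    ultimately have "\<forall>\<^sub>F y in at s within {s..c2}. h y > 0"
      using \<open>s < c2\<close> by (intro order_tendstoD(1)) (auto simp: continuous_on_def)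
    then obtain e where e: "e > 0" "\<And>y. y \<in> {s..c2} \<Longrightarrow> y \<noteq> s \<Longrightarrow> dist y s < e \<Longrightarrow> h y > 0"
      unfolding eventually_at by auto
    define y where "y = min ((s + c2) / 2) (s + e / 2)"
    have "s < y" "y < c2" "dist y s < e"
      using e(1) \<open>s < c2\<close> by (auto simp: y_def dist_real_def min_def field_simps)
    then show False using e(2)[of y] neg[of y] by auto
  qed
  moreover have "s \<in> {c1..c2}" using s(1) t m unfolding A_def by auto
  ultimately obtain d where "d > 0" "(h has_real_derivative d) (at s within {c1..c2})"
    using der[of s] by auto
  then obtain \<epsilon> where \<epsilon>: "\<epsilon> > 0" "\<And>e. 0 < e \<Longrightarrow> s + e \<in> {c1..c2} \<Longrightarrow> e < \<epsilon> \<Longrightarrow> h s < h (s + e)"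
    using has_real_derivative_pos_inc_right by metis
  define e where "e = min (\<epsilon> / 2) ((c2 - s) / 2)"
  have "0 < e" "e < \<epsilon>" "s + e < c2"
    using \<epsilon>(1) \<open>s < c2\<close> by (auto simp: e_def min_def field_simps)
  then have "h s < h (s + e)" using \<epsilon>(2)[of e] s t unfolding A_def by auto
  moreover have "h s \<ge> 0" using s unfolding A_def by auto
  ultimately show False using neg[of "s + e"] \<open>0 < e\<close> \<open>s + e < c2\<close> by auto
qed

text \<open>\<open>D\<close> may be nonlocal in \<open>x\<close>, but its Lipschitz bound compares
  \<open>f\<close> and \<open>g\<close> at the single level \<open>s\<close>. Iterated integration
  over the levels therefore produces factorials, and the iteration converges on all of
  \<open>[0,T]\<close> without a smallness condition. The data sit at \<open>c = T\<close> and the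
  equation is solved downwards.\<close>

lemma picard_lindelof_integral_equation:
  fixes D :: "(real \<Rightarrow> real \<Rightarrow> real) \<Rightarrow> real \<Rightarrow> real \<Rightarrow> real" and f0 :: "real \<Rightarrow> real"
  assumes X: "compact X" and f0: "continuous_on X f0" and "\<Lambda> \<ge> 0"
    and cont: "\<And>f. jcont X {0..T} f \<Longrightarrow> jcont X {0..T} (D f)"
    and lip: "\<And>f g s d x. jcont X {0..T} f \<Longrightarrow> jcont X {0..T} g \<Longrightarrow> s \<in> {0..T} \<Longrightarrow>
      (\<And>y. y \<in> X \<Longrightarrow> \<bar>f y s - g y s\<bar> \<le> d) \<Longrightarrow> x \<in> X \<Longrightarrow> \<bar>D f x s - D g x s\<bar> \<le> \<Lambda> * d"
  obtains f where "jcont X {0..T} f"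
    and "\<And>x c. x \<in> X \<Longrightarrow> c \<in> {0..T} \<Longrightarrow> f x c = f0 x + integral {c..T} (D f x)"
proof -
  define step where "step f = (\<lambda>x c. f0 x + integral {c..T} (D f x))" for f
  define F where "F n = (step ^^ n) (\<lambda>x c. f0 x)" for n
  have F_Suc: "F (Suc n) x c = f0 x + integral {c..T} (D (F n) x)" for n x c
    by (simp add: F_def step_def)
  have contF: "jcont X {0..T} (F n)" for n
  proof (induction n)
    case 0
    then show ?case by (auto simp: F_def intro!: continuous_on_compose2[OF f0] continuous_intros)
  next
    case (Suc n)
    have "continuous_on (X \<times> {0..T}) (\<lambda>p. integral {snd p..T} (D (F n) (fst p)))"
      by (rule continuous_on_integral_lower[where ?c0.0 = 0])
        (auto intro!: continuous_intros jcont_compose[OF cont[OF Suc]])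
    moreover have "continuous_on (X \<times> {0..T}) (\<lambda>p. f0 (fst p))"
      by (auto intro!: continuous_on_compose2[OF f0] continuous_intros)
    ultimately show ?case unfolding F_Suc by (rule continuous_on_add[rotated])
  qed
  have int: "D f x integrable_on {c..T}" if "jcont X {0..T} f" "x \<in> X" "c \<in> {0..T}" for f x c
    by (intro integrable_continuous_real continuous_on_subset[OF jcont_slice1[OF cont[OF that(1)] that(2)]])
      (use that in auto)
  have "jcont X {0..T} (\<lambda>x c. F 1 x c - F 0 x c)"
    using contF by (intro continuous_on_diff)
  from jcont_bounded[OF this X compact_Icc]
  obtain M where M: "M > 0" "\<And>x c. x \<in> X \<Longrightarrow> c \<in> {0..T} \<Longrightarrow> \<bar>F 1 x c - F 0 x c\<bar> \<le> M"
    by blast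
  have bound: "\<bar>F (Suc n) x c - F n x c\<bar> \<le> M * \<Lambda> ^ n * (T - c) ^ n / fact n"
    if "x \<in> X" "c \<in> {0..T}" for n x c
    using that
  proof (induction n arbitrary: x c)
    case 0
    then show ?case using M by simp
  next
    case (Suc n)
    define k where "k = M * \<Lambda> ^ Suc n / fact n"
    define P where "P s = - (k / (1 + real n) * (T - s) ^ Suc n)" for s
    have cancel: "- (k / m * (m * z * - 1)) = k * z" if "m \<noteq> 0" for m z :: real
      using that by simp
    have nz: "1 + real n \<noteq> 0" by linarith
    have "((\<lambda>s. k * (T - s) ^ n) has_integral P T - P c) {c..T}"
    proof (rule fundamental_theorem_of_calculus)
      have "(P has_real_derivative - (k / (1 + real n) * ((1 + real n) * (T - s) ^ n * - 1))) (at s within {c..T})" for s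
        unfolding P_def by (rule derivative_eq_intros refl)+ simp
      then show "(P has_vector_derivative k * (T - s) ^ n) (at s within {c..T})" for s
        unfolding cancel[OF nz] by (simp add: has_real_derivative_iff_has_vector_derivative)
    qed (use Suc.prems in auto)
    moreover have "k * (T - s) ^ n = \<Lambda> * (M * \<Lambda> ^ n * (T - s) ^ n / fact n)" for s
      by (simp add: k_def)
    moreover have "P T = 0" by (simp add: P_def)
    ultimately have hi: "((\<lambda>s. \<Lambda> * (M * \<Lambda> ^ n * (T - s) ^ n / fact n)) has_integral - P c) {c..T}"
      by simp
    have "F (Suc (Suc n)) x c - F (Suc n) x c
        = integral {c..T} (\<lambda>s. D (F (Suc n)) x s - D (F n) x s)"
      using Henstock_Kurzweil_Integration.integral_diff[OF int[OF contF[of "Suc n"] Suc.prems] int[OF contF[of n] Suc.prems]]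
        F_Suc[of "Suc n" x c] F_Suc[of n x c] by linarith
    also have "norm \<dots> \<le> integral {c..T} (\<lambda>s. \<Lambda> * (M * \<Lambda> ^ n * (T - s) ^ n / fact n))"
    proof (rule integral_norm_bound_integral)
      show "(\<lambda>s. D (F (Suc n)) x s - D (F n) x s) integrable_on {c..T}"
        using Suc.prems by (intro integrable_diff int contF)
      show "norm (D (F (Suc n)) x s - D (F n) x s) \<le> \<Lambda> * (M * \<Lambda> ^ n * (T - s) ^ n / fact n)"
        if "s \<in> {c..T}" for s
      proof -
        have s: "s \<in> {0..T}" using that Suc.prems by auto
        show ?thesis
          unfolding real_norm_def by (rule lip[OF contF contF s Suc.IH[OF _ s] Suc.prems(1)])
      qed
    qed (use hi in blast)
    also have "\<dots> = - P c" by (rule integral_unique[OF hi])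
    finally show ?case by (simp add: P_def k_def field_simps)
  qed
  define b where "b n = M * (\<Lambda> * T) ^ n / fact n" for n
  have "summable b"
    using summable_mult[OF summable_exp[of "\<Lambda> * T"], of M]
    unfolding b_def by (simp add: divide_inverse mult_ac)
  then have "uniform_limit (X \<times> {0..T}) (\<lambda>n p. \<Sum>i<n. F (Suc i) (fst p) (snd p) - F i (fst p) (snd p))
      (\<lambda>p. \<Sum>i. F (Suc i) (fst p) (snd p) - F i (fst p) (snd p)) sequentially"
  proof (rule Weierstrass_m_test[rotated])
    fix n p assume "p \<in> X \<times> {0..T}"
    then have p: "fst p \<in> X" "snd p \<in> {0..T}" by auto
    have "\<bar>F (Suc n) (fst p) (snd p) - F n (fst p) (snd p)\<bar> \<le> M * \<Lambda> ^ n * (T - snd p) ^ n / fact n"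
      by (rule bound[OF p])
    also have "\<dots> \<le> M * \<Lambda> ^ n * T ^ n / fact n"
      using p M \<open>\<Lambda> \<ge> 0\<close> by (intro divide_right_mono mult_left_mono power_mono) auto
    finally show "norm (F (Suc n) (fst p) (snd p) - F n (fst p) (snd p)) \<le> b n"
      by (simp add: b_def power_mult_distrib)
  qed
  moreover have telescope: "(\<Sum>i<n. F (Suc i) x c - F i x c) = F n x c - F 0 x c" for n x c
    by (rule sum_lessThan_telescope)
  moreover define f where "f x c = F 0 x c + (\<Sum>i. F (Suc i) x c - F i x c)" for x c
  ultimately have ul: "uniform_limit (X \<times> {0..T}) (\<lambda>n p. F n (fst p) (snd p)) (\<lambda>p. f (fst p) (snd p)) sequentially"
    unfolding uniform_limit_iff by (simp add: telescope dist_real_def f_def algebra_simps)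
  have contf: "jcont X {0..T} f"
    by (rule uniform_limit_theorem[OF always_eventually ul]) (use contF in auto)
  have "f x c = f0 x + integral {c..T} (D f x)" if x: "x \<in> X" and c: "c \<in> {0..T}" for x c
  proof -
    have lim: "(\<lambda>n. F n x c) \<longlonglongrightarrow> f x c"
      using tendsto_uniform_limitI[OF ul, of "(x, c)"] x c by simp
    have "(\<lambda>n. integral {c..T} (D (F n) x)) \<longlonglongrightarrow> integral {c..T} (D f x)"
    proof (rule LIMSEQ_I)
      fix e :: real assume "e > 0"
      \<comment> \<open>The last summand 1 keeps the denominator positive when
        \<open>\<Lambda> = 0\<close> and makes \<open>d * (\<Lambda> * (T + 1)) < e\<close>
        strict.\<close>
      define d where "d = e / (\<Lambda> * (T + 1) + 1)"
      have "0 \<le> \<Lambda> * (T + 1)" using c \<open>\<Lambda> \<ge> 0\<close> by auto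
      then have "d > 0" using \<open>e > 0\<close> by (simp add: d_def)
      then have "\<forall>\<^sub>F n in sequentially. \<forall>p\<in>X \<times> {0..T}. dist (F n (fst p) (snd p)) (f (fst p) (snd p)) < d"
        using ul unfolding uniform_limit_iff by blast
      then obtain n0 where n0: "\<And>n p. n \<ge> n0 \<Longrightarrow> p \<in> X \<times> {0..T} \<Longrightarrow> \<bar>F n (fst p) (snd p) - f (fst p) (snd p)\<bar> < d"
        unfolding eventually_sequentially dist_real_def by blast
      have "norm (integral {c..T} (D (F n) x) - integral {c..T} (D f x)) < e" if "n \<ge> n0" for n
      proof -
        have "integral {c..T} (D (F n) x) - integral {c..T} (D f x) = integral {c..T} (\<lambda>s. D (F n) x s - D f x s)"
          by (intro Henstock_Kurzweil_Integration.integral_diff[symmetric] int contF contf x c)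
        also have "norm \<dots> \<le> \<Lambda> * d * (T - c)"
        proof (rule integral_bound)
          show "continuous_on {c..T} (\<lambda>s. D (F n) x s - D f x s)"
            using c by (intro continuous_on_diff continuous_on_subset[OF jcont_slice1[OF cont x]] contF contf) auto
          show "norm (D (F n) x s - D f x s) \<le> \<Lambda> * d" if "s \<in> {c..T}" for s
          proof -
            have s: "s \<in> {0..T}" using that c by auto
            have "\<bar>F n y s - f y s\<bar> \<le> d" if "y \<in> X" for y
              using n0[OF \<open>n \<ge> n0\<close>, of "(y, s)"] that s by simp
            then show ?thesis unfolding real_norm_def by (rule lip[OF contF contf s _ x])
          qed
        qed (use c in auto)
        also have "\<dots> \<le> d * (\<Lambda> * (T + 1))"
          using c \<open>d > 0\<close> \<open>\<Lambda> \<ge> 0\<close> by (auto simp: mult.assoc mult.left_commute intro!: mult_left_mono)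
        also have "\<dots> < e"
          using \<open>e > 0\<close> \<open>0 \<le> \<Lambda> * (T + 1)\<close> by (simp add: d_def divide_less_eq algebra_simps)
        finally show ?thesis .
      qed
      then show "\<exists>n0. \<forall>n\<ge>n0. norm (integral {c..T} (D (F n) x) - integral {c..T} (D f x)) < e" by blast
    qed
    then have "(\<lambda>n. F (Suc n) x c) \<longlonglongrightarrow> f0 x + integral {c..T} (D f x)"
      unfolding F_Suc by (intro tendsto_intros)
    then show ?thesis using LIMSEQ_unique LIMSEQ_Suc[OF lim] by blast
  qed
  then show thesis using that contf by blast
qed

section \<open>A maximum principle\<close>

text \<open>The equation \<open>p'' + \<kappa> p' = \<rho> p\<close> as a first-order system. It
  will hold for \<open>p = v_x\<close> left of the free boundary, where it is the
  \<open>x\<close>-derivative of the equation for \<open>v\<close>.\<close>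

locale linear_ode =
  fixes \<kappa> \<rho> b :: real and p q :: "real \<Rightarrow> real"
  assumes rho: "\<rho> > 0"
    and p': "\<And>x. x \<in> {0..b} \<Longrightarrow> (p has_real_derivative q x) (at x within {0..b})"
    and q': "\<And>x. x \<in> {0..b} \<Longrightarrow> (q has_real_derivative \<rho> * p x - \<kappa> * q x) (at x within {0..b})"
begin

lemma q_exp: 
  assumes "x \<in> {0..b}"
  shows "((\<lambda>x. exp (\<kappa> * x) * q x) has_real_derivative \<rho> * exp (\<kappa> * x) * p x) (at x within {0..b})"
  by (rule derivative_eq_intros q' assms refl)+ (simp add: algebra_simps)

lemma cont_p: "continuous_on {0..b} p"
  by (rule DERIV_continuous_on[OF p'])

lemma p_mono:
  assumes "0 \<le> x" "x < y" "y \<le> b" "\<And>z. x < z \<Longrightarrow> z < y \<Longrightarrow> q z > 0"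
  shows "p x < p y"
proof (rule DERIV_pos_imp_increasing_open[OF assms(2)])
  show "\<exists>l. (p has_real_derivative l) (at z) \<and> 0 < l" if "x < z" "z < y" for z
    using p'[of z] at_within_Icc_at[of 0 z b] assms that by auto
  show "continuous_on {x..y} p"
    using assms by (intro continuous_on_subset[OF cont_p]) auto
qed

text \<open>At a positive interior maximum \<open>m\<close> one has \<open>q m = 0\<close>, while
  \<open>exp (\<kappa> x) q\<close> has positive derivative there. Hence \<open>q > 0\<close> and
  \<open>p\<close> increases just to the right of \<open>m\<close>.\<close>

lemma maximum_principle:
  assumes "0 \<le> x" "x \<le> y" "y \<le> z" "z \<le> b"
  shows "p y \<le> max (max (p x) (p z)) 0"
proof (rule ccontr)
  assume neg: "\<not> ?thesis"
  have "continuous_on {x..z} p"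
    using assms by (intro continuous_on_subset[OF cont_p]) auto
  then obtain m where m: "m \<in> {x..z}" "\<And>s. s \<in> {x..z} \<Longrightarrow> p s \<le> p m"
    using continuous_attains_sup[of "{x..z}" p] assms by auto
  then have "p m \<ge> p y" using assms by auto
  then have pm: "p m > 0" and "x < m" "m < z" using neg m(1) by (auto simp: order.order_iff_strict)
  then have "q m = 0"
    using p'[of m] at_within_Icc_at[of 0 m b] assms m
    by (intro DERIV_local_max[of p "q m" m "min (m - x) (z - m)"]) (auto simp: abs_if split: if_splits)
  moreover have "\<rho> * exp (\<kappa> * m) * p m > 0" using pm rho by simp
  ultimately obtain d where d: "d > 0" "\<And>h. 0 < h \<Longrightarrow> m + h \<in> {0..b} \<Longrightarrow> h < d \<Longrightarrow> 0 < exp (\<kappa> * (m + h)) * q (m + h)"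
    using has_real_derivative_pos_inc_right[OF q_exp[of m]] assms m(1) by force
  define s where "s = min (m + d / 2) z"
  have "p m < p s"
  proof (rule p_mono)
    show "q w > 0" if "m < w" "w < s" for w
      using d(2)[of "w - m"] that d(1) assms m(1) by (auto simp: s_def zero_less_mult_iff)
  qed (use d(1) assms m(1) \<open>m < z\<close> in \<open>auto simp: s_def\<close>)
  then show False using m(2)[of s] d(1) m(1) \<open>m < z\<close> by (auto simp: s_def)
qed

text \<open>Immediately left of \<open>y\<close> the slope is negative, so \<open>p\<close> exceeds
  \<open>p y\<close> at some \<open>s < y\<close>. A point \<open>x\<close> further left with
  \<open>p x < p y\<close> would give a positive interior maximum between \<open>x\<close> and
  \<open>y\<close>.\<close>

lemma ge_terminal:
  assumes y: "0 \<le> y" "y \<le> b" and py: "p y > 0" and qy: "q y \<le> 0" and x: "0 \<le> x" "x \<le> y"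
  shows "p x \<ge> p y"
proof (rule ccontr)
  assume "\<not> p y \<le> p x"
  then have "p x < p y" "x < y" using x by (auto simp: order.order_iff_strict)
  have "\<rho> * exp (\<kappa> * y) * p y > 0" using py rho by simp
  then obtain d where d: "d > 0" "\<And>h. 0 < h \<Longrightarrow> y - h \<in> {0..b} \<Longrightarrow> h < d \<Longrightarrow>
      exp (\<kappa> * (y - h)) * q (y - h) < exp (\<kappa> * y) * q y"
    using has_real_derivative_pos_inc_left[OF q_exp[of y]] y by auto
  define s where "s = max x (y - d / 2)"
  have s: "0 \<le> s" "x \<le> s" "s < y" "y - d < s" using d(1) x \<open>x < y\<close> by (auto simp: s_def)
  have neg: "q w < 0" if "s < w" "w < y" for w
  proof -
    have "exp (\<kappa> * w) * q w < exp (\<kappa> * y) * q y"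
      using d(2)[of "y - w"] that s y by auto
    also have "\<dots> \<le> 0" using qy by (simp add: mult_le_0_iff)
    finally show ?thesis by (simp add: mult_less_0_iff)
  qed
  have "p y < p s"
  proof (rule DERIV_neg_imp_decreasing_open[OF \<open>s < y\<close>])
    show "\<exists>l. (p has_real_derivative l) (at z) \<and> l < 0" if "s < z" "z < y" for z
      using p'[of z] at_within_Icc_at[of 0 z b] s y that neg by auto
    show "continuous_on {s..y} p"
      using s y by (intro continuous_on_subset[OF cont_p]) auto
  qed
  then show False
    using maximum_principle[of x s y] s x y \<open>p x < p y\<close> py by auto
qed

end

text \<open>Otherwise \<open>ge_terminal\<close> applies to \<open>- p\<close> at \<open>x\<close>
  and yields \<open>- p 0 \<ge> - p x > 0\<close>. This is the tool against negative minima of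
  \<open>v_x\<close>.\<close>

lemma (in linear_ode) slope_at_negative:
  assumes x: "0 \<le> x" "x \<le> b" and "p 0 > 0" "p x < 0"
  shows "q x < 0"
proof (rule ccontr)
  assume "\<not> q x < 0"
  interpret minus: linear_ode \<kappa> \<rho> b "\<lambda>x. - p x" "\<lambda>x. - q x"
    by unfold_locales (auto intro!: derivative_eq_intros p' q' rho simp: algebra_simps)
  show False using minus.ge_terminal[of x 0] x assms \<open>\<not> q x < 0\<close> by auto
qed

section \<open>Weak derivatives and Hoelder norms\<close>

text \<open>The support keeps a positive distance from 0, so integration by parts never meets the
  endpoint 0. All derivatives vanish off the closed support because its complement is open.\<close>

lemma test_fun_compact_support:
  assumes \<phi>: "test_fun S \<phi>" and S: "S \<subseteq> {0<..}"
  obtains \<alpha> \<beta> where "0 < \<alpha>" "\<alpha> < \<beta>" "\<And>k x. x \<in> {\<alpha><..<\<beta>} \<or> (deriv ^^ k) \<phi> x = 0"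
    "\<And>k x. x \<in> S \<or> (deriv ^^ k) \<phi> x = 0"
proof -
  define C where "C = closure {x. \<phi> x \<noteq> 0}"
  have C: "compact C" "C \<subseteq> S" using \<phi> by (auto simp: test_fun_def C_def)
  have zero: "x \<in> C \<or> (deriv ^^ k) \<phi> x = 0" for k x
  proof (induction k arbitrary: x)
    case 0
    have "x \<in> {x. \<phi> x \<noteq> 0} \<Longrightarrow> x \<in> C" unfolding C_def by (rule subsetD[OF closure_subset])
    then show ?case by (cases "\<phi> x = 0") simp_all
  next
    case (Suc k)
    show ?case
    proof (cases "x \<in> C")
      case False
      have "open (- C)" using C(1) by (simp add: compact_imp_closed open_Compl)
      moreover have "0 = (deriv ^^ k) \<phi> y" if "y \<in> - C" for y
        using Suc[of y] that by simp
      ultimately have "((deriv ^^ k) \<phi> has_field_derivative 0) (at x)"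
        using has_field_derivative_transform_within_open[OF DERIV_const[of 0]] False by blast
      then show ?thesis by (simp add: DERIV_imp_deriv)
    qed simp
  qed
  obtain \<alpha> \<beta> where "0 < \<alpha>" "\<alpha> < \<beta>" "C \<subseteq> {\<alpha><..<\<beta>}"
  proof (cases "C = {}")
    case True
    then show ?thesis using that[of 1 2] by auto
  next
    case False
    then obtain l h where l: "l \<in> C" "\<And>x. x \<in> C \<Longrightarrow> l \<le> x" and h: "h \<in> C" "\<And>x. x \<in> C \<Longrightarrow> x \<le> h"
      using compact_attains_inf[OF C(1)] compact_attains_sup[OF C(1)] by metis
    have "0 < l" using l(1) C S by auto
    moreover have "C \<subseteq> {l / 2<..<h + 1}" using l h \<open>0 < l\<close> by force
    moreover have "l \<le> h" using l h by auto
    ultimately show ?thesis by (intro that[of "l / 2" "h + 1"]) auto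
  qed
  then show thesis using that zero C(2) by (meson subsetD)
qed

lemma integral_lebesgue_on_supported:
  fixes h :: "real \<Rightarrow> real"
  assumes "S \<in> sets lebesgue" "I \<in> sets lebesgue" "\<And>x. x \<notin> S \<Longrightarrow> h x = 0" "\<And>x. x \<notin> I \<Longrightarrow> h x = 0"
  shows "integral\<^sup>L (lebesgue_on S) h = integral\<^sup>L (lebesgue_on I) h"
proof -
  have "(\<lambda>x. indicator S x *\<^sub>R h x) = (\<lambda>x. indicator I x *\<^sub>R h x)"
    using assms(3,4) by (auto simp: indicator_def fun_eq_iff)
  then show ?thesis using assms(1,2) by (simp only: integral_restrict_space Int_UNIV_right space_completion space_lborel space_borel)
qed

lemma integrable_lebesgue_on_bounded:
  fixes f :: "real \<Rightarrow> real"
  assumes "S \<in> lmeasurable" "f \<in> borel_measurable (lebesgue_on S)" "\<And>x. x \<in> S \<Longrightarrow> \<bar>f x\<bar> \<le> K"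
  shows "integrable (lebesgue_on S) f"
  by (rule finite_measure.integrable_const_bound[OF finite_measure_lebesgue_on[OF assms(1)] _ assms(2), of K])
    (use assms(3) in \<open>auto intro: AE_I2\<close>)

lemma locally_integrable_on_continuous:
  assumes "continuous_on S f"
  shows "locally_integrable_on S f"
  unfolding locally_integrable_on_def
proof safe
  fix C assume "compact C" "C \<subseteq> S"
  then have f: "continuous_on C f" using assms continuous_on_subset by blast
  then have "bounded (f ` C)" using \<open>compact C\<close> compact_continuous_image compact_imp_bounded by blast
  then obtain K where "\<And>x. x \<in> C \<Longrightarrow> \<bar>f x\<bar> \<le> K" by (auto simp: bounded_iff)
  then show "integrable (lebesgue_on C) f"
    using \<open>compact C\<close> f
    by (intro integrable_lebesgue_on_bounded[of C f K] lmeasurable_compact continuous_imp_measurable_on_sets_lebesgue)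
      (auto simp: fmeasurableD lmeasurable_compact)
qed

text \<open>\<open>w\<close> is arbitrary on the exceptional set \<open>N\<close>; Henstock--Kurzweil integrability of the derivative
  and boundedness spare any measurability argument.\<close>

locale piecewise_C2 =
  fixes F F1 w :: "real \<Rightarrow> real" and N :: "real set" and K :: real
  assumes N: "finite N"
    and F: "\<And>x. x > 0 \<Longrightarrow> (F has_real_derivative F1 x) (at x)"
    and F1_cont: "continuous_on {0<..} F1"
    and F1: "\<And>x. x > 0 \<Longrightarrow> x \<notin> N \<Longrightarrow> (F1 has_real_derivative w x) (at x)"
    and bounds: "\<And>x. x > 0 \<Longrightarrow> \<bar>F x\<bar> \<le> K" "\<And>x. x > 0 \<Longrightarrow> \<bar>F1 x\<bar> \<le> K" "\<And>x. x > 0 \<Longrightarrow> \<bar>w x\<bar> \<le> K"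
begin

lemma F_cont: "continuous_on {0<..} F"
  using F by (intro continuous_at_imp_continuous_on) (auto intro: DERIV_isCont)

lemma w_abs_integrable:
  assumes "0 < \<alpha>"
  shows "w absolutely_integrable_on {\<alpha>..\<beta>}"
proof (cases "\<alpha> \<le> \<beta>")
  case True
  have "(w has_integral F1 \<beta> - F1 \<alpha>) {\<alpha>..\<beta>}"
    using True assms F1
    by (intro fundamental_theorem_of_calculus_interior_strong[OF N] continuous_on_subset[OF F1_cont])
      (auto simp: has_real_derivative_iff_has_vector_derivative)
  then show ?thesis
    using assms bounds(3) by (intro absolutely_integrable_integrable_bound[where g = "\<lambda>_. K"])
      (auto simp: has_integral_integrable)
qed auto

text \<open>The half-line is exhausted by compact intervals on which \<open>w\<close> is absolutely
  integrable; \<open>w\<close> is the pointwise limit of its truncations.\<close>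

lemma w_measurable: "w \<in> borel_measurable (lebesgue_on {0<..})"
proof -
  define I where "I n = {1 / (real n + 1)..real n}" for n
  have "(\<lambda>x. if x \<in> {0<..} then w x else 0) \<in> borel_measurable lebesgue"
  proof (rule borel_measurable_LIMSEQ_real)
    show "(\<lambda>x. if x \<in> I n then w x else 0) \<in> borel_measurable lebesgue" for n
      using w_abs_integrable[of "1 / (real n + 1)" "real n"] unfolding I_def
      by (intro borel_measurable_if_I) (auto simp: absolutely_integrable_measurable)
    show "(\<lambda>n. if x \<in> I n then w x else 0) \<longlonglongrightarrow> (if x \<in> {0<..} then w x else 0)" for x
    proof (cases "0 < x")
      case True
      obtain n0 where n0: "real n0 > max x (1 / x)" using reals_Archimedean2 by blast
      have "x \<in> I n" if "n \<ge> n0" for n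
      proof -
        have n: "real n > x" "real n > 1 / x" using n0 that by (auto simp: max_def split: if_splits)
        then have "1 \<le> x * (real n + 1)" using True by (simp add: field_simps)
        then show ?thesis using n True by (auto simp: I_def divide_le_eq)
      qed
      then show ?thesis using True by (intro tendsto_eventually) (auto simp: eventually_sequentially)
    next
      case False
      have "x \<notin> I n" for n
      proof -
        have "0 < 1 / (real n + 1)" by simp
        then show ?thesis using False unfolding I_def by (meson atLeastAtMost_iff less_le_trans)
      qed
      then show ?thesis using False by auto
    qed
  qed
  then show ?thesis by (rule borel_measurable_if_D)
qed

lemma w_locally_integrable:
  assumes "S \<subseteq> {0<..}"
  shows "locally_integrable_on S w"
  unfolding locally_integrable_on_def
proof safe
  fix C assume C: "compact C" "C \<subseteq> S"
  then have "w \<in> borel_measurable (lebesgue_on C)"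
    using assms by (intro measurable_restrict_mono[OF w_measurable]) auto
  then show "integrable (lebesgue_on C) w"
    using C assms bounds(3) by (intro integrable_lebesgue_on_bounded[of C w K] lmeasurable_compact) auto
qed

text \<open>Kept general in \<open>H\<close> and \<open>h\<close> to serve both stages,
  \<open>F\<close> with \<open>F1\<close> and \<open>F1\<close> with \<open>w\<close>. Finitely many
  missing derivatives are harmless because \<open>H\<close> is continuous. Integrals over
  \<open>S\<close> reduce to a compact interval around the support, at whose ends the boundary terms
  vanish.\<close>

lemma by_parts:
  assumes \<phi>: "test_fun S \<phi>" and S: "S \<subseteq> {0<..}" "S \<in> sets lebesgue"
    and H: "\<And>x. x > 0 \<Longrightarrow> x \<notin> N \<Longrightarrow> (H has_real_derivative h x) (at x)"
    and H_cont: "continuous_on {0<..} H"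
    and h: "\<And>\<alpha> \<beta>. 0 < \<alpha> \<Longrightarrow> h absolutely_integrable_on {\<alpha>..\<beta>}"
  shows "integral\<^sup>L (lebesgue_on S) (\<lambda>x. H x * (deriv ^^ Suc k) \<phi> x) =
    - integral\<^sup>L (lebesgue_on S) (\<lambda>x. h x * (deriv ^^ k) \<phi> x)"
proof -
  obtain \<alpha> \<beta> where ab: "0 < \<alpha>" "\<alpha> < \<beta>" "\<And>k x. x \<in> {\<alpha><..<\<beta>} \<or> (deriv ^^ k) \<phi> x = 0"
    and supp: "\<And>k x. x \<in> S \<or> (deriv ^^ k) \<phi> x = 0"
    using test_fun_compact_support[OF \<phi> S(1)] by blast
  let ?I = "{\<alpha>..\<beta>}"
  let ?\<psi> = "(deriv ^^ k) \<phi>" and ?\<psi>' = "(deriv ^^ Suc k) \<phi>"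
  have der: "((deriv ^^ j) \<phi> has_real_derivative (deriv ^^ Suc j) \<phi> x) (at x)" for j x
    using \<phi> by (auto simp: test_fun_def field_differentiable_derivI)
  have cont: "continuous_on A ((deriv ^^ j) \<phi>)" for j A
    using der by (intro continuous_at_imp_continuous_on) (auto intro: DERIV_isCont)
  have ends: "?\<psi> \<alpha> = 0" "?\<psi> \<beta> = 0" using ab(3)[of \<alpha> k] ab(3)[of \<beta> k] by auto
  have contH: "continuous_on ?I H" using ab by (intro continuous_on_subset[OF H_cont]) auto
  have "((\<lambda>x. H x * ?\<psi>' x + h x * ?\<psi> x) has_integral H \<beta> * ?\<psi> \<beta> - H \<alpha> * ?\<psi> \<alpha>) ?I"
  proof (rule fundamental_theorem_of_calculus_interior_strong[OF N])
    show "((\<lambda>x. H x * ?\<psi> x) has_vector_derivative H x * ?\<psi>' x + h x * ?\<psi> x) (at x)"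
      if "x \<in> {\<alpha><..<\<beta>} - N" for x
      unfolding has_real_derivative_iff_has_vector_derivative[symmetric]
      using DERIV_mult[OF H der, of x k] that ab by (simp add: algebra_simps)
    show "continuous_on ?I (\<lambda>x. H x * ?\<psi> x)" by (intro continuous_on_mult contH cont)
  qed (use ab in auto)
  then have sum0: "integral ?I (\<lambda>x. H x * ?\<psi>' x + h x * ?\<psi> x) = 0"
    using ends by (simp add: integral_unique)
  have i1: "(\<lambda>x. H x * ?\<psi>' x) absolutely_integrable_on ?I"
    by (intro absolutely_integrable_continuous_real continuous_on_mult contH cont)
  have "(\<lambda>x. ?\<psi> x * h x) absolutely_integrable_on ?I"
  proof (rule absolutely_integrable_bounded_measurable_product_real)
    show "?\<psi> \<in> borel_measurable (lebesgue_on ?I)"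
      by (intro continuous_imp_measurable_on_sets_lebesgue cont) auto
    show "bounded (?\<psi> ` ?I)" by (intro compact_imp_bounded compact_continuous_image cont) auto
  qed (use h ab in auto)
  then have i2: "(\<lambda>x. h x * ?\<psi> x) absolutely_integrable_on ?I" by (simp add: mult.commute)
  have to_I: "integral\<^sup>L (lebesgue_on S) (\<lambda>x. g x * (deriv ^^ j) \<phi> x) = integral ?I (\<lambda>x. g x * (deriv ^^ j) \<phi> x)"
    if "(\<lambda>x. g x * (deriv ^^ j) \<phi> x) absolutely_integrable_on ?I" for g j
  proof -
    have "integral\<^sup>L (lebesgue_on S) (\<lambda>x. g x * (deriv ^^ j) \<phi> x) = integral\<^sup>L (lebesgue_on ?I) (\<lambda>x. g x * (deriv ^^ j) \<phi> x)"
    proof (rule integral_lebesgue_on_supported)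
      show "g x * (deriv ^^ j) \<phi> x = 0" if "x \<notin> S" for x
        using supp[of x j] that by simp
      show "g x * (deriv ^^ j) \<phi> x = 0" if "x \<notin> ?I" for x
        using ab(3)[of x j] that by auto
    qed (use S in auto)
    also have "\<dots> = integral ?I (\<lambda>x. g x * (deriv ^^ j) \<phi> x)"
      using that by (intro lebesgue_integral_eq_integral absolutely_integrable_imp_integrable) auto
    finally show ?thesis .
  qed
  have "integral ?I (\<lambda>x. H x * ?\<psi>' x) + integral ?I (\<lambda>x. h x * ?\<psi> x) = 0"
    using sum0 i1 i2 by (subst (asm) integral_add) (auto simp: set_lebesgue_integral_eq_integral(1))
  then show ?thesis using to_I[OF i1] to_I[OF i2] by simp
qed

lemma weak_deriv1:
  assumes S: "S \<subseteq> {0<..}" "S \<in> sets lebesgue"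
  shows "has_weak_deriv 1 S F F1"
  unfolding has_weak_deriv_def
proof (intro conjI allI impI)
  show "locally_integrable_on S F" "locally_integrable_on S F1"
    using S by (auto intro!: locally_integrable_on_continuous continuous_on_subset[OF F_cont]
        continuous_on_subset[OF F1_cont])
  fix \<phi> assume \<phi>: "test_fun S \<phi>"
  have "F1 absolutely_integrable_on {\<alpha>..\<beta>}" if "0 < \<alpha>" for \<alpha> \<beta>
    using that by (intro absolutely_integrable_continuous_real continuous_on_subset[OF F1_cont]) auto
  then show "integral\<^sup>L (lebesgue_on S) (\<lambda>x. F x * (deriv ^^ 1) \<phi> x) =
        (- 1) ^ 1 * integral\<^sup>L (lebesgue_on S) (\<lambda>x. F1 x * \<phi> x)"
    using by_parts[OF \<phi> S F F_cont, of 0] by simp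
qed

lemma weak_deriv2:
  assumes S: "S \<subseteq> {0<..}" "S \<in> sets lebesgue"
  shows "has_weak_deriv 2 S F w"
  unfolding has_weak_deriv_def
proof (intro conjI allI impI)
  show "locally_integrable_on S F"
    using S by (auto intro!: locally_integrable_on_continuous continuous_on_subset[OF F_cont])
  show "locally_integrable_on S w" by (rule w_locally_integrable[OF S(1)])
  fix \<phi> assume \<phi>: "test_fun S \<phi>"
  have "F1 absolutely_integrable_on {\<alpha>..\<beta>}" if "0 < \<alpha>" for \<alpha> \<beta>
    using that by (intro absolutely_integrable_continuous_real continuous_on_subset[OF F1_cont]) auto
  then show "integral\<^sup>L (lebesgue_on S) (\<lambda>x. F x * (deriv ^^ 2) \<phi> x) =
        (- 1) ^ 2 * integral\<^sup>L (lebesgue_on S) (\<lambda>x. w x * \<phi> x)"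
    using by_parts[OF \<phi> S F F_cont, of 1] by_parts[OF \<phi> S F1 F1_cont w_abs_integrable, of 0]
    by (simp add: numeral_2_eq_2)
qed

lemma in_Lp_bounded:
  assumes g: "g \<in> borel_measurable (lebesgue_on {0<..})" and bd: "\<And>x. x > 0 \<Longrightarrow> \<bar>g x\<bar> \<le> K" and "p > 1"
  shows "in_Lp p {0<..<L} g"
  unfolding in_Lp_def
proof
  show m: "g \<in> borel_measurable (lebesgue_on {0<..<L})"
    by (rule measurable_restrict_mono[OF g]) auto
  show "integrable (lebesgue_on {0<..<L}) (\<lambda>x. \<bar>g x\<bar> powr p)"
  proof (rule integrable_lebesgue_on_bounded)
    show "(\<lambda>x. \<bar>g x\<bar> powr p) \<in> borel_measurable (lebesgue_on {0<..<L})"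
      using m by measurable
    show "\<bar>\<bar>g x\<bar> powr p\<bar> \<le> \<bar>K\<bar> powr p" if "x \<in> {0<..<L}" for x
      using bd[of x] that \<open>p > 1\<close> by (auto intro: powr_mono2)
  qed auto
qed

lemma W2p_loc: "p > 1 \<Longrightarrow> in_W2p_loc p F"
  unfolding in_W2p_loc_def in_Sobolev_def
proof safe
  fix L :: real assume p: "p > 1"
  have m: "g \<in> borel_measurable (lebesgue_on {0<..})" if "continuous_on {0<..} g" for g :: "real \<Rightarrow> real"
    using that by (intro continuous_imp_measurable_on_sets_lebesgue) auto
  show "in_Lp p {0<..<L} F" by (rule in_Lp_bounded[OF m[OF F_cont] bounds(1) p])
  fix j :: nat assume "j \<in> {1..2}"
  then consider "j = 1" | "j = 2" by force
  then show "\<exists>w. has_weak_deriv j {0<..<L} F w \<and> in_Lp p {0<..<L} w"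
  proof cases
    case 1
    then show ?thesis
      using weak_deriv1[of "{0<..<L}"] in_Lp_bounded[OF m[OF F1_cont] bounds(2) p, of L] by fastforce
  next
    case 2
    then show ?thesis
      using weak_deriv2[of "{0<..<L}"] in_Lp_bounded[OF w_measurable bounds(3) p, of L] by fastforce
  qed
qed

end

text \<open>The Lipschitz bound controls the quotient for \<open>\<bar>x - y\<bar> \<le> 1\<close>,
  the bound \<open>2 B\<close> on the numerator controls it beyond. The resulting constant does not
  depend on \<alpha>.\<close>

lemma C1_Hoelder_norm_le:
  assumes f: "\<And>x. x \<in> S \<Longrightarrow> (f has_real_derivative f' x) (at x within S)"
    and nontriv: "\<And>x. x \<in> S \<Longrightarrow> at x within S \<noteq> bot" 
    and b: "\<And>x. x \<in> S \<Longrightarrow> \<bar>f x\<bar> \<le> A" "\<And>x. x \<in> S \<Longrightarrow> \<bar>f' x\<bar> \<le> B"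
    and lip: "\<And>x y. x \<in> S \<Longrightarrow> y \<in> S \<Longrightarrow> \<bar>f' x - f' y\<bar> \<le> C * \<bar>x - y\<bar>"
    and \<alpha>: "0 < \<alpha>" "\<alpha> < 1" and nonneg: "A \<ge> 0" "B \<ge> 0" "C \<ge> 0"
  shows "C1_Hoelder_norm \<alpha> S f \<le> ennreal (A + B + (C + 2 * B))"
proof -
  have vd: "vector_derivative f (at x within S) = f' x" if "x \<in> S" for x
    using f[OF that] nontriv[OF that]
    by (intro vector_derivative_within) (auto simp: has_real_derivative_iff_has_vector_derivative)
  have diff: "f differentiable_on S"
    using f by (auto simp: differentiable_on_def real_differentiable_def)
  have hoelder: "\<bar>f' x - f' y\<bar> / \<bar>x - y\<bar> powr \<alpha> \<le> C + 2 * B" if "x \<in> S" "y \<in> S" "x \<noteq> y" for x y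
  proof (cases "\<bar>x - y\<bar> \<le> 1")
    case True
    have "\<bar>f' x - f' y\<bar> \<le> C * \<bar>x - y\<bar> powr 1" using lip[OF that(1,2)] that(3) by simp
    also have "\<dots> \<le> C * \<bar>x - y\<bar> powr \<alpha>"
      using True \<alpha> nonneg that(3) by (intro mult_left_mono powr_mono') auto
    finally show ?thesis using that(3) nonneg by (simp add: divide_le_eq algebra_simps add_increasing2)
  next
    case False
    have "\<bar>f' x - f' y\<bar> \<le> 2 * B" using b(2)[OF that(1)] b(2)[OF that(2)] by linarith
    also have "\<dots> \<le> 2 * B * \<bar>x - y\<bar> powr \<alpha>"
      using False \<alpha> nonneg ge_one_powr_ge_zero[of "\<bar>x - y\<bar>" \<alpha>]
        mult_left_mono[of 1 "\<bar>x - y\<bar> powr \<alpha>" "2 * B"] by simp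
    also have "\<dots> \<le> (C + 2 * B) * \<bar>x - y\<bar> powr \<alpha>" using nonneg by (intro mult_right_mono) auto
    finally show ?thesis using that(3) by (simp add: divide_le_eq)
  qed
  have "C1_Hoelder_norm \<alpha> S f = (SUP x\<in>S. ennreal \<bar>f x\<bar>) + (SUP x\<in>S. ennreal \<bar>f' x\<bar>) +
           (SUP x\<in>S. SUP y\<in>S - {x}. ennreal (\<bar>f' x - f' y\<bar> / \<bar>x - y\<bar> powr \<alpha>))"
    unfolding C1_Hoelder_norm_def Let_def if_P[OF diff]
    by (intro arg_cong2[where f = "(+)"] SUP_cong refl) (auto simp: vd)
  also have "\<dots> \<le> ennreal A + ennreal B + ennreal (C + 2 * B)"
    by (intro add_mono SUP_least ennreal_leI b hoelder) auto
  also have "\<dots> = ennreal (A + B + (C + 2 * B))" using nonneg by (simp flip: ennreal_plus)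
  finally show ?thesis .
qed

section \<open>The obstacle problem at a fixed level\<close>

text \<open>The entire function \<open>(exp t - 1)/t\<close>.\<close>

definition E1 :: "real \<Rightarrow> real" where "E1 t = integral {0..1} (\<lambda>s. exp (t * s))"

definition E1' :: "real \<Rightarrow> real" where "E1' t = integral {0..1} (\<lambda>s. s * exp (t * s))"

lemma DERIV_E1: "(E1 has_real_derivative E1' t) (at t within A)"
proof -
  have "((\<lambda>t. integral (cbox 0 1) (\<lambda>s. exp (t * s))) has_real_derivative
      integral (cbox 0 1) (\<lambda>s. s * exp (t * s))) (at t within UNIV)"
    by (rule leibniz_rule_field_derivative)
      (auto intro!: derivative_eq_intros continuous_intros integrable_continuous_real simp: case_prod_unfold)
  then show ?thesis by (auto simp: E1_def[abs_def] E1'_def intro: has_field_derivative_at_within)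
qed

lemma continuous_on_E1 [continuous_intros]:
  assumes "continuous_on A f" shows "continuous_on A (\<lambda>x. E1 (f x))"
  by (rule continuous_on_compose2[OF DERIV_continuous_on[OF DERIV_E1] assms subset_UNIV])

lemma continuous_on_E1' [continuous_intros]:
  assumes "continuous_on A f" shows "continuous_on A (\<lambda>x. E1' (f x))"
proof -
  have "continuous_on UNIV (\<lambda>t. integral (cbox 0 1) (\<lambda>s. s * exp (t * s :: real)))"
    by (rule integral_continuous_on_param) (auto intro!: continuous_intros simp: case_prod_unfold)
  then have "continuous_on UNIV E1'" by (simp add: E1'_def[abs_def])
  then show ?thesis by (rule continuous_on_compose2[OF _ assms subset_UNIV])
qed

lemma E1_mult: "t * E1 t = exp t - 1"
proof -
  have "((\<lambda>s. t * exp (t * s)) has_integral exp (t * 1) - exp (t * 0)) {0..1}"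
    by (rule fundamental_theorem_of_calculus)
      (auto simp flip: has_real_derivative_iff_has_vector_derivative intro!: derivative_eq_intros)
  from integral_unique[OF this] show ?thesis by (simp add: E1_def)
qed

lemma E1_pos: "E1 t > 0"
proof -
  consider "t < 0" | "t = 0" | "t > 0" by linarith
  then show ?thesis
  proof cases
    case 1
    then have "t * E1 t < 0" by (simp add: E1_mult)
    then show ?thesis using 1 by (simp add: mult_less_0_iff)
  next
    case 2
    then show ?thesis by (simp add: E1_def)
  next
    case 3
    then have "t * E1 t > 0" by (simp add: E1_mult)
    then show ?thesis using 3 by (simp add: zero_less_mult_iff)
  qed
qed

text \<open>\<open>a\<close> stands for \<open>2/\<sigma>\<^sup>2\<close>, so that \<open>a \<L>\<^sub>c h = h'' + kap c * h' - a r h\<close>; its characteristic roots are \<open>nu c\<close>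
  and \<open>- lam c\<close>. \<open>S c\<close> solves \<open>\<L>\<^sub>c h = 0\<close> and \<open>psi c\<close> the adjoint equation.\<close>

locale ratcheting =
  fixes a r \<mu> T :: real
  assumes a: "a > 0" and r: "r > 0" and T: "0 < T" "T \<le> \<mu>" and profitable: "r < a * \<mu> * T"
begin

definition kap where "kap c = a * (\<mu> - c)"
definition th where "th c = sqrt ((kap c)\<^sup>2 + 4 * a * r)"
definition lam where "lam c = (th c + kap c) / 2"
definition nu where "nu c = (th c - kap c) / 2"
definition psi where "psi c y = exp (lam c * y) - exp (- nu c * y)"
definition S where "S c y = exp (nu c * y) - exp (- lam c * y)"
definition S' where "S' c y = nu c * exp (nu c * y) + lam c * exp (- lam c * y)"

lemma th_pos: "th c > 0"
  using a r by (auto simp: th_def intro!: add_nonneg_pos)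

lemma th_sq: "(th c)\<^sup>2 = (kap c)\<^sup>2 + 4 * a * r"
  using a r by (simp add: th_def)

lemma th_gt: "\<bar>kap c\<bar> < th c"
  using a r th_sq[of c] th_pos[of c] by (intro power_less_imp_less_base[of "\<bar>kap c\<bar>" 2]) auto

lemma lam_pos: "lam c > 0" and nu_pos: "nu c > 0"
  using th_gt[of c] by (auto simp: lam_def nu_def)

lemma lam_plus_nu: "lam c + nu c = th c" and lam_minus_nu: "lam c - nu c = kap c"
  by (auto simp: lam_def nu_def field_simps)

lemma lam_times_nu: "lam c * nu c = a * r"
  using th_sq[of c] by (simp add: lam_def nu_def power2_eq_square field_simps)

lemma lam_sq: "(lam c)\<^sup>2 = kap c * lam c + a * r" and nu_sq: "(nu c)\<^sup>2 = a * r - kap c * nu c"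
  using lam_times_nu[of c] by (simp_all flip: lam_minus_nu add: power2_eq_square algebra_simps)

lemma kap_nonneg: "c \<le> T \<Longrightarrow> kap c \<ge> 0"
  using a T by (simp add: kap_def)

lemma nu_le_lam: "c \<le> T \<Longrightarrow> nu c \<le> lam c"
  using kap_nonneg[of c] lam_minus_nu[of c] by simp

lemma DERIV_kap: "(kap has_real_derivative - a) (at c within A)"
  unfolding kap_def[abs_def] by (auto intro!: derivative_eq_intros)

lemma DERIV_th: "(th has_real_derivative - (a * kap c / th c)) (at c within A)"
proof -
  have "(kap c)\<^sup>2 + 4 * a * r > 0" using a r by (intro add_nonneg_pos) auto
  then have "(th has_real_derivative inverse (sqrt ((kap c)\<^sup>2 + 4 * a * r)) / 2 * (2 * kap c * - a)) (at c within A)"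
    unfolding th_def[abs_def]
    by (intro DERIV_chain2[OF DERIV_real_sqrt]) (auto intro!: derivative_eq_intros DERIV_kap)
  moreover have "inverse (sqrt ((kap c)\<^sup>2 + 4 * a * r)) / 2 * (2 * kap c * - a) = - (a * kap c / th c)"
    unfolding th_def[symmetric] using th_pos[of c] by (simp add: field_simps)
  ultimately show ?thesis by simp
qed

lemma DERIV_lam: "(lam has_real_derivative - (a * lam c / th c)) (at c within A)"
proof -
  have "(lam has_real_derivative (- (a * kap c / th c) + - a) / 2) (at c within A)"
    unfolding lam_def[abs_def] by (auto intro!: derivative_eq_intros DERIV_kap DERIV_th)
  moreover have "(- (a * kap c / th c) + - a) / 2 = - (a * lam c / th c)"
    using th_pos[of c] by (simp add: lam_def field_simps)
  ultimately show ?thesis by simp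
qed

lemma DERIV_nu: "(nu has_real_derivative a * nu c / th c) (at c within A)"
proof -
  have "(nu has_real_derivative (- (a * kap c / th c) - - a) / 2) (at c within A)"
    unfolding nu_def[abs_def] by (auto intro!: derivative_eq_intros DERIV_kap DERIV_th)
  moreover have "(- (a * kap c / th c) - - a) / 2 = a * nu c / th c"
    using th_pos[of c] by (simp add: nu_def field_simps)
  ultimately show ?thesis by simp
qed

lemma continuous_on_params [continuous_intros]:
  assumes "continuous_on A f"
  shows "continuous_on A (\<lambda>x. kap (f x))" "continuous_on A (\<lambda>x. th (f x))"
    "continuous_on A (\<lambda>x. lam (f x))" "continuous_on A (\<lambda>x. nu (f x))"
  using continuous_on_compose2[OF DERIV_continuous_on[OF DERIV_kap] assms subset_UNIV]
    continuous_on_compose2[OF DERIV_continuous_on[OF DERIV_th] assms subset_UNIV]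
    continuous_on_compose2[OF DERIV_continuous_on[OF DERIV_lam] assms subset_UNIV]
    continuous_on_compose2[OF DERIV_continuous_on[OF DERIV_nu] assms subset_UNIV]
  by simp_all

lemma continuous_on_kernels [continuous_intros]:
  assumes "continuous_on A f" "continuous_on A g"
  shows "continuous_on A (\<lambda>x. psi (f x) (g x))" "continuous_on A (\<lambda>x. S (f x) (g x))"
    "continuous_on A (\<lambda>x. S' (f x) (g x))"
  unfolding psi_def S_def S'_def by (intro continuous_intros assms)+

lemma psi_eq: "psi c y = exp (kap c * y) * S c y"
  by (simp add: psi_def S_def right_diff_distrib flip: exp_add lam_minus_nu) (simp add: algebra_simps)

text \<open>Splits off the simple zero at \<open>y = 0\<close>; the remaining factor never vanishes.
  Positivity of \<open>psi\<close> and the regular form of \<open>G / psi^2\<close> both rest on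
  this.\<close>

lemma psi_E1: "psi c y = exp (- nu c * y) * (th c * y * E1 (th c * y))"
proof -
  have "exp (- nu c * y) * exp (th c * y) = exp (lam c * y)"
    by (simp flip: exp_add lam_plus_nu add: algebra_simps)
  then show ?thesis by (simp add: E1_mult psi_def right_diff_distrib)
qed

lemma psi_0 [simp]: "psi c 0 = 0" and S_0 [simp]: "S c 0 = 0"
  by (simp_all add: psi_def S_def)

lemma psi_pos: "y > 0 \<Longrightarrow> psi c y > 0"
  using th_pos E1_pos by (simp add: psi_E1)

lemma S_pos: "y > 0 \<Longrightarrow> S c y > 0"
  using psi_pos[of y c] by (simp add: psi_eq zero_less_mult_iff)

lemma DERIV_S: "(S c has_real_derivative S' c y) (at y within A)"
  unfolding S_def[abs_def] S'_def by (auto intro!: derivative_eq_intros)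

lemma DERIV_S': "(S' c has_real_derivative a * r * S c y - kap c * S' c y) (at y within A)"
proof -
  have "(S' c has_real_derivative (nu c)\<^sup>2 * exp (nu c * y) - (lam c)\<^sup>2 * exp (- lam c * y)) (at y within A)"
    unfolding S'_def[abs_def] by (auto intro!: derivative_eq_intros simp: power2_eq_square)
  then show ?thesis by (simp add: lam_sq nu_sq S_def S'_def algebra_simps)
qed

definition psi' where "psi' c y = lam c * exp (lam c * y) + nu c * exp (- nu c * y)"

lemma DERIV_psi: "(psi c has_real_derivative psi' c y) (at y within A)"
  unfolding psi_def[abs_def] psi'_def by (auto intro!: derivative_eq_intros)

lemma psi'_pos: "psi' c y > 0"
  using lam_pos nu_pos by (simp add: psi'_def add_pos_pos)

lemma psi_mono:
  assumes "x \<le> y"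
  shows "psi c x \<le> psi c y"
proof (rule DERIV_nonneg_imp_nondecreasing[OF assms])
  show "\<exists>l. (psi c has_real_derivative l) (at z) \<and> 0 \<le> l" for z
    using DERIV_psi[of c z UNIV] psi'_pos[of c z] less_imp_le by blast
qed

lemma psi'_eq: "psi' c y = exp (kap c * y) * S' c y + kap c * psi c y"
proof -
  have "exp (kap c * y) * exp (nu c * y) = exp (lam c * y)" "exp (kap c * y) * exp (- lam c * y) = exp (- nu c * y)"
    by (simp_all flip: exp_add lam_minus_nu add: algebra_simps)
  then have "exp (kap c * y) * S' c y = nu c * exp (lam c * y) + lam c * exp (- nu c * y)"
    by (simp add: S'_def algebra_simps)
  then show ?thesis by (simp add: psi'_def psi_def flip: lam_minus_nu) (simp add: algebra_simps)
qed

text \<open>The derivative of \<open>psi\<close> in \<open>c\<close> and the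
  \<open>y\<close>-derivative of that, written out with \<open>lam' = - a lam / th\<close> and
  \<open>nu' = a nu / th\<close>.\<close>

definition chi where "chi c y = - (a / th c) * (y * (lam c * exp (lam c * y) - nu c * exp (- nu c * y)))"
definition chi' where "chi' c y = - (a / th c) * ((lam c * exp (lam c * y) - nu c * exp (- nu c * y))
    + y * ((lam c)\<^sup>2 * exp (lam c * y) + (nu c)\<^sup>2 * exp (- nu c * y)))"

lemma DERIV_psi_c: "((\<lambda>c. psi c y) has_real_derivative chi c y) (at c within A)"
  unfolding psi_def chi_def
  by (rule derivative_eq_intros DERIV_lam DERIV_nu refl)+ (simp add: algebra_simps)

text \<open>The bracket in \<open>chi\<close> is nonnegative because
  \<open>nu c \<le> lam c\<close>, which rests on \<open>T \<le> \<mu>\<close>. The sign is wanted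
  to the right of the free boundary, where \<open>f < 0\<close>.\<close>

lemma chi_nonpos:
  assumes "c \<le> T" "y \<ge> 0" shows "chi c y \<le> 0"
proof -
  have "nu c * exp (- nu c * y) \<le> lam c * exp (lam c * y)"
    using assms nu_le_lam nu_pos[of c] lam_pos[of c]
    by (intro mult_mono) (auto intro: order_trans[of _ 0] mult_nonneg_nonneg)
  then have "0 \<le> (a / th c) * (y * (lam c * exp (lam c * y) - nu c * exp (- nu c * y)))"
    using assms a th_pos[of c] by (intro mult_nonneg_nonneg divide_nonneg_nonneg) auto
  then show ?thesis unfolding chi_def by linarith
qed

lemma chi_0 [simp]: "chi c 0 = 0"
  by (simp add: chi_def)

lemma DERIV_chi: "(chi c has_real_derivative chi' c y) (at y within A)"
  unfolding chi_def[abs_def] chi'_def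
  by (intro DERIV_cmult, (rule derivative_eq_intros refl)+) (simp add: power2_eq_square algebra_simps)

text \<open>This is the \<open>c\<close>-derivative of the adjoint equation
  \<open>psi'' = kap psi' + a r psi\<close>. The source \<open>- a psi'\<close> comes from
  \<open>kap' = - a\<close> and is what gives Green's identity a definite sign.\<close>

lemma DERIV_chi': "(chi' c has_real_derivative kap c * chi' c y + a * r * chi c y - a * psi' c y) (at y within A)"
proof -
  let ?p = "exp (lam c * y)" and ?m = "exp (- nu c * y)"
  let ?k = "- (a / th c)"
  have der: "(chi' c has_real_derivative ?k * (2 * ((lam c)\<^sup>2 * ?p + (nu c)\<^sup>2 * ?m)
      + y * ((lam c) ^ 3 * ?p - (nu c) ^ 3 * ?m))) (at y within A)"
    unfolding chi'_def[abs_def]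
    by (intro DERIV_cmult, (rule derivative_eq_intros refl)+) (simp add: power2_eq_square power3_eq_cube algebra_simps)
  have cube: "(lam c) ^ 3 = kap c * (lam c)\<^sup>2 + a * r * lam c" "(nu c) ^ 3 = a * r * nu c - kap c * (nu c)\<^sup>2"
    using arg_cong[OF lam_sq[of c], of "(*) (lam c)"] arg_cong[OF nu_sq[of c], of "(*) (nu c)"]
    by (simp_all add: power3_eq_cube power2_eq_square algebra_simps)
  have sq2: "2 * (lam c)\<^sup>2 = kap c * lam c + th c * lam c" "2 * (nu c)\<^sup>2 = th c * nu c - kap c * nu c"
    by (simp_all flip: lam_minus_nu lam_plus_nu add: power2_eq_square algebra_simps)
  have "2 * ((lam c)\<^sup>2 * ?p + (nu c)\<^sup>2 * ?m) = (2 * (lam c)\<^sup>2) * ?p + (2 * (nu c)\<^sup>2) * ?m"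
    by simp
  also have "\<dots> = kap c * (lam c * ?p - nu c * ?m) + th c * psi' c y"
    unfolding sq2 psi'_def by (simp add: algebra_simps)
  finally have quad: "2 * ((lam c)\<^sup>2 * ?p + (nu c)\<^sup>2 * ?m)
      = kap c * (lam c * ?p - nu c * ?m) + th c * psi' c y" .
  have "(chi' c has_real_derivative ?k * (kap c * (lam c * ?p - nu c * ?m) + th c * psi' c y
      + y * ((kap c * (lam c)\<^sup>2 + a * r * lam c) * ?p - (a * r * nu c - kap c * (nu c)\<^sup>2) * ?m))) (at y within A)"
    using der unfolding quad cube .
  moreover have "?k * th c = - a" using th_pos[of c] by simp
  then have "?k * (kap c * (lam c * ?p - nu c * ?m) + th c * psi' c y
      + y * ((kap c * (lam c)\<^sup>2 + a * r * lam c) * ?p - (a * r * nu c - kap c * (nu c)\<^sup>2) * ?m))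
    = kap c * chi' c y + a * r * chi c y - a * psi' c y"
    unfolding chi_def chi'_def distrib_left[of ?k] mult.assoc[symmetric, of ?k "th c"]
    by (simp add: algebra_simps)
  ultimately show ?thesis by simp
qed

lemma continuous_on_chi [continuous_intros]:
  assumes "continuous_on A f" "continuous_on A g"
  shows "continuous_on A (\<lambda>x. chi (f x) (g x))" "continuous_on A (\<lambda>x. psi' (f x) (g x))"
  unfolding chi_def psi'_def using th_pos by (intro continuous_intros assms; simp add: less_imp_neq[symmetric])+

section \<open>The value function at the terminal level\<close>

definition g where "g x = T / r * (1 - exp (- lam T * x))"
definition g' where "g' x = T / r * lam T * exp (- lam T * x)"

lemma DERIV_g: "(g has_real_derivative g' x) (at x within A)"
  unfolding g_def[abs_def] g'_def using r by (auto intro!: derivative_eq_intros)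

lemma DERIV_g': "(g' has_real_derivative a * r * g x - a * T - kap T * g' x) (at x within A)"
proof -
  have "(g' has_real_derivative - (T / r * (lam T)\<^sup>2 * exp (- lam T * x))) (at x within A)"
    unfolding g'_def[abs_def] using r by (auto intro!: derivative_eq_intros simp: power2_eq_square)
  moreover have "- (T / r * (lam T)\<^sup>2 * exp (- lam T * x)) = a * r * g x - a * T - kap T * g' x"
    using r by (simp add: lam_sq g_def g'_def field_simps)
  ultimately show ?thesis by simp
qed

text \<open>The profitability assumption acts here. The claim means \<open>lam T > r / T\<close>. In
  the opposite case, putting \<open>r / T\<close> for \<open>lam T\<close> into
  \<open>a r = lam T (lam T - kap T)\<close> gives \<open>a r \<le> r / T (r / T - kap T)\<close>,
  that is \<open>a \<mu> \<le> r / T\<close>.\<close>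

lemma g'_0: "g' 0 > 1"
proof -
  have "r / T < lam T"
  proof (rule ccontr)
    assume "\<not> r / T < lam T"
    then have le: "lam T \<le> r / T" by simp
    have "a * r = lam T * (lam T - kap T)"
      using lam_times_nu[of T] lam_minus_nu[of T] by (simp add: algebra_simps)
    moreover have "0 < lam T - kap T" using lam_minus_nu[of T] nu_pos[of T] by simp
    ultimately have "a * r \<le> r / T * (r / T - kap T)"
      using le lam_pos[of T] mult_mono[OF le, of "lam T - kap T" "r / T - kap T"] by linarith
    then have "a * r * T \<le> r * (r / T - kap T)" using T by (simp add: field_simps)
    then have "a * T \<le> r / T - kap T" using r by (simp add: mult.assoc mult.left_commute)
    then have "a * \<mu> \<le> r / T" by (simp add: kap_def algebra_simps)
    then show False using profitable T by (simp add: field_simps)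
  qed
  then show ?thesis using T r by (simp add: g'_def field_simps)
qed

lemma g'_pos: "g' x > 0"
  using T r lam_pos by (simp add: g'_def)

lemma g'_strict_decreasing: "x < y \<Longrightarrow> g' y < g' x"
  using T r lam_pos[of T] unfolding g'_def by (intro mult_strict_left_mono) auto

lemma g_bounds: "x \<ge> 0 \<Longrightarrow> 0 \<le> g x" "g x \<le> T / r"
  using T r lam_pos[of T] by (auto simp: g_def field_simps intro!: mult_nonneg_nonneg)

lemma continuous_on_g [continuous_intros]:
  assumes "continuous_on A f" 
  shows "continuous_on A (\<lambda>x. g (f x))" "continuous_on A (\<lambda>x. g' (f x))"
  unfolding g_def g'_def by (intro continuous_intros assms)+

text \<open>\<open>Q f x c\<close> equals \<open>(\<integral>\<^sub>0\<^sup>x psi c y * f y c dy) / (psi c x)\<^sup>2\<close>, after the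
  substitution \<open>y = x t\<close> that removes the singularity at \<open>x = 0\<close>; \<open>D B f\<close> is the \<open>x\<close>-derivative of the
  candidate \<open>a * S c x * I B f x c\<close> for \<open>u\<close>.\<close>

definition pre where "pre c z = exp (2 * nu c * z) / (th c * (E1 (th c * z))\<^sup>2)"
definition ker where "ker c z t = t * exp (- nu c * (z * t)) * E1 (th c * (z * t))"
definition Q where "Q f z c = pre c z * integral {0..1} (\<lambda>t. ker c z t * f (z * t) c)"
definition I where "I B f x c = integral {x..B} (\<lambda>z. exp (kap c * z) * max 0 (Q f z c))"
definition D where "D B f x c = a * (S' c x * I B f x c - psi c x * max 0 (Q f x c))"

lemma continuous_on_pre [continuous_intros]:
  assumes "continuous_on A p" "continuous_on A q"
  shows "continuous_on A (\<lambda>x. pre (p x) (q x))"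
  unfolding pre_def using th_pos E1_pos
  by (intro continuous_intros assms) (simp add: less_imp_neq[symmetric])

lemma continuous_on_ker [continuous_intros]:
  assumes "continuous_on A p" "continuous_on A q" "continuous_on A w"
  shows "continuous_on A (\<lambda>x. ker (p x) (q x) (w x))"
  unfolding ker_def by (intro continuous_intros assms)

lemma scaled_mem: "z \<in> {0..B} \<Longrightarrow> t \<in> {0..1} \<Longrightarrow> z * t \<in> {0..B}" for z t B :: real
  using mult_left_mono[of t 1 z] by auto

lemma ker_f_cont:
  fixes f :: "real \<Rightarrow> real \<Rightarrow> real"
  assumes f: "jcont {0..B} C f" and k: "continuous_on ((C \<times> {0..B}) \<times> {0..1}) (\<lambda>p. k (fst (fst p)) (snd (fst p)) (snd p))"
  shows "continuous_on (({0..B} \<times> C) \<times> {0..1})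
    (\<lambda>p. k (snd (fst p)) (fst (fst p)) (snd p) * f (fst (fst p) * snd p) (snd (fst p)))"
proof (intro continuous_on_mult)
  show "continuous_on (({0..B} \<times> C) \<times> {0..1}) (\<lambda>p. k (snd (fst p)) (fst (fst p)) (snd p))"
  proof -
    have "continuous_on (({0..B} \<times> C) \<times> {0..1}) (\<lambda>p. ((snd (fst p), fst (fst p)), snd p))"
      by (intro continuous_intros)
    from continuous_on_compose2[OF k this] show ?thesis by force
  qed
  show "continuous_on (({0..B} \<times> C) \<times> {0..1}) (\<lambda>p. f (fst (fst p) * snd p) (snd (fst p)))"
  proof (rule jcont_compose[OF f])
    show "(\<lambda>p. fst (fst p) * snd p) ` (({0..B} \<times> C) \<times> {0..1}) \<subseteq> {0..B}"
    proof (rule image_subsetI)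
      fix p :: "(real \<times> real) \<times> real" assume "p \<in> ({0..B} \<times> C) \<times> {0..1}"
      then show "fst (fst p) * snd p \<in> {0..B}"
        using scaled_mem[of "fst (fst p)" B "snd p"] by (simp only: mem_Times_iff)
    qed
  qed (auto intro!: continuous_intros)
qed

lemma Q_param_cont:
  fixes f :: "real \<Rightarrow> real \<Rightarrow> real"
  assumes "jcont {0..B} C f" "continuous_on ((C \<times> {0..B}) \<times> {0..1}) (\<lambda>p. k (fst (fst p)) (snd (fst p)) (snd p))"
  shows "jcont {0..B} C (\<lambda>z c. integral {0..1} (\<lambda>t. k c z t * f (z * t) c))"
proof -
  have "continuous_on (({0..B} \<times> C) \<times> cbox 0 1) (\<lambda>(p, t). k (snd p) (fst p) t * f (fst p * t) (snd p))"
    using ker_f_cont[OF assms] by (simp only: case_prod_unfold box_real)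
  from integral_continuous_on_param[OF this] show ?thesis by simp
qed

lemma Q_cont:
  assumes "jcont {0..B} C f"
  shows "jcont {0..B} C (Q f)"
  unfolding Q_def
  by (intro continuous_on_mult Q_param_cont[OF assms] continuous_intros)

lemma Q_integrand_integrable:
  assumes "jcont {0..B} C f" "z \<in> {0..B}" "c \<in> C"
  shows "(\<lambda>t. ker c z t * f (z * t) c) integrable_on {0..1}"
  using scaled_mem[of z B] assms(2,3)
  by (intro integrable_continuous_real continuous_on_mult jcont_compose[OF assms(1)] continuous_intros) auto

lemma psi_sq_Q:
  assumes f: "continuous_on {0..x} (\<lambda>y. f y c)" and x: "x \<ge> 0"
  shows "(psi c x)\<^sup>2 * Q f x c = integral {0..x} (\<lambda>y. psi c y * f y c)"
proof (cases "x = 0")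
  case False
  have "integral {0..x} (\<lambda>y. psi c y * f y c) = x * integral {0..1} (\<lambda>t. psi c (x * t) * f (x * t) c)"
  proof -
    have "continuous_on {0..x} (\<lambda>y. psi c y * f y c)" by (intro continuous_intros f)
    from integral_scale_unit[OF this x] show ?thesis by simp
  qed
  also have "(\<lambda>t. psi c (x * t) * f (x * t) c) = (\<lambda>t. (th c * x) * (ker c x t * f (x * t) c))"
    by (simp add: psi_E1 ker_def mult_ac)
  finally have "integral {0..x} (\<lambda>y. psi c y * f y c) = th c * x\<^sup>2 * integral {0..1} (\<lambda>t. ker c x t * f (x * t) c)"
    by (simp add: power2_eq_square)
  moreover have "(psi c x)\<^sup>2 * pre c x = th c * x\<^sup>2"
  proof -
    have "exp (2 * nu c * x) = (exp (nu c * x))\<^sup>2" by (simp add: power2_eq_square flip: exp_add)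
    moreover have "exp (- nu c * x) * exp (nu c * x) = 1" by (simp flip: exp_add)
    ultimately show ?thesis
      using th_pos[of c] E1_pos[of "th c * x"]
      by (simp add: psi_E1 pre_def power_mult_distrib power2_eq_square field_simps)
  qed
  ultimately show ?thesis by (simp add: Q_def)
qed simp

lemma I_integrand_cont:
  assumes "jcont {0..B} C f"
  shows "jcont {0..B} C (\<lambda>z c. exp (kap c * z) * max 0 (Q f z c))"
  by (intro continuous_intros continuous_on_max Q_cont[OF assms])

lemma I_cont:
  assumes "jcont {0..B} C f"
  shows "jcont {0..B} C (I B f)"
  unfolding I_def
  by (rule continuous_on_integral_lower[where ?c0.0 = 0], rule jcont_compose[OF I_integrand_cont[OF assms]])
    (auto intro!: continuous_intros)

lemma D_cont:
  assumes "jcont {0..B} C f"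
  shows "jcont {0..B} C (D B f)"
  unfolding D_def
  by (intro continuous_intros continuous_on_max Q_cont[OF assms] I_cont[OF assms])

text \<open>At level \<open>s\<close> the operator sees only the slice \<open>f y s\<close>, which
  is the levelwise form that the Picard iteration asks for. Taking positive parts does not increase
  distances, and all kernels are bounded by compactness.\<close>

lemma D_lipschitz:
  assumes B: "B \<ge> 0" and C: "compact C"
  obtains \<Lambda> where "\<Lambda> \<ge> 0" "\<And>f g s d x. jcont {0..B} C f \<Longrightarrow> jcont {0..B} C g \<Longrightarrow> s \<in> C \<Longrightarrow>
      (\<And>y. y \<in> {0..B} \<Longrightarrow> \<bar>f y s - g y s\<bar> \<le> d) \<Longrightarrow> x \<in> {0..B} \<Longrightarrow> \<bar>D B f x s - D B g x s\<bar> \<le> \<Lambda> * d"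
proof -
  have ker_cont: "jcont (C \<times> {0..B}) {0..1} (\<lambda>p t. ker (fst p) (snd p) t)"
    by (intro continuous_intros)
  obtain Mk where Mk: "Mk > 0" "\<And>c z t. c \<in> C \<Longrightarrow> z \<in> {0..B} \<Longrightarrow> t \<in> {0..1} \<Longrightarrow> \<bar>ker c z t\<bar> \<le> Mk"
    using jcont_bounded[OF ker_cont compact_Times[OF C compact_Icc] compact_Icc]
    by (metis SigmaI fst_conv snd_conv)
  have bd: "\<exists>M>0. \<forall>c\<in>C. \<forall>z\<in>{0..B}. \<bar>h c z\<bar> \<le> M" if "jcont C {0..B} h" for h
    using jcont_bounded[OF that C compact_Icc] by metis
  obtain Mp where Mp: "Mp > 0" "\<And>c z. c \<in> C \<Longrightarrow> z \<in> {0..B} \<Longrightarrow> \<bar>pre c z\<bar> \<le> Mp"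
    using bd[of pre] by (force intro: continuous_intros)
  obtain Ms where Ms: "Ms > 0" "\<And>c z. c \<in> C \<Longrightarrow> z \<in> {0..B} \<Longrightarrow> \<bar>S' c z\<bar> \<le> Ms"
    using bd[of S'] by (force intro: continuous_intros)
  obtain Mq where Mq: "Mq > 0" "\<And>c z. c \<in> C \<Longrightarrow> z \<in> {0..B} \<Longrightarrow> \<bar>psi c z\<bar> \<le> Mq"
    using bd[of psi] by (force intro: continuous_intros)
  obtain Me where Me: "Me > 0" "\<And>c z. c \<in> C \<Longrightarrow> z \<in> {0..B} \<Longrightarrow> \<bar>exp (kap c * z)\<bar> \<le> Me"
    using bd[of "\<lambda>c z. exp (kap c * z)"] by (force intro: continuous_intros)
  define M where "M = Mp * Mk"
  have "M > 0" using Mp Mk by (simp add: M_def)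
  have "\<bar>D B f x s - D B g x s\<bar> \<le> (a * (Ms * (B * (Me * M)) + Mq * M)) * d"
    if f: "jcont {0..B} C f" and g: "jcont {0..B} C g" and s: "s \<in> C"
      and d: "\<And>y. y \<in> {0..B} \<Longrightarrow> \<bar>f y s - g y s\<bar> \<le> d" and x: "x \<in> {0..B}" for f g s d x
  proof -
    have "d \<ge> 0" using d[OF x] by linarith
    have Qd: "\<bar>Q f z s - Q g z s\<bar> \<le> M * d" if z: "z \<in> {0..B}" for z
    proof -
      have diff: "integral {0..1} (\<lambda>t. ker s z t * f (z * t) s) - integral {0..1} (\<lambda>t. ker s z t * g (z * t) s)
          = integral {0..1} (\<lambda>t. ker s z t * f (z * t) s - ker s z t * g (z * t) s)"
        by (rule Henstock_Kurzweil_Integration.integral_diff[symmetric])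
          (rule Q_integrand_integrable[OF f z s] Q_integrand_integrable[OF g z s])+
      have "norm (integral {0..1} (\<lambda>t. ker s z t * f (z * t) s - ker s z t * g (z * t) s))
          \<le> integral {0..1} (\<lambda>t::real. Mk * d)"
      proof (rule integral_norm_bound_integral)
        show "(\<lambda>t. ker s z t * f (z * t) s - ker s z t * g (z * t) s) integrable_on {0..1}"
          by (intro integrable_diff Q_integrand_integrable[OF f z s] Q_integrand_integrable[OF g z s])
        show "norm (ker s z t * f (z * t) s - ker s z t * g (z * t) s) \<le> Mk * d" if "t \<in> {0..1}" for t
          using mult_mono[OF Mk(2)[OF s z that] d[OF scaled_mem[OF z that]]] Mk(1)
          by (simp add: abs_mult flip: right_diff_distrib)
      qed auto
      then have "\<bar>integral {0..1} (\<lambda>t. ker s z t * f (z * t) s) - integral {0..1} (\<lambda>t. ker s z t * g (z * t) s)\<bar> \<le> Mk * d"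
        unfolding diff by simp
      then have "\<bar>pre s z\<bar> * \<bar>integral {0..1} (\<lambda>t. ker s z t * f (z * t) s) - integral {0..1} (\<lambda>t. ker s z t * g (z * t) s)\<bar> \<le> Mp * (Mk * d)"
        using Mp(2)[OF s z] Mp(1) by (intro mult_mono) auto
      then show ?thesis by (simp add: Q_def M_def abs_mult flip: right_diff_distrib)
    qed
    then have Qm: "\<bar>max 0 (Q f z s) - max 0 (Q g z s)\<bar> \<le> M * d" if z: "z \<in> {0..B}" for z
      using Qd[OF z] by linarith
    have Id: "\<bar>I B f x s - I B g x s\<bar> \<le> B * (Me * M) * d"
    proof -
      have ii: "(\<lambda>z. exp (kap s * z) * max 0 (Q h z s)) integrable_on {x..B}" if "jcont {0..B} C h" for h
        using x by (intro integrable_continuous_real continuous_on_subset[OF jcont_slice2[OF I_integrand_cont[OF that] s]]) auto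
      have diff: "I B f x s - I B g x s = integral {x..B} (\<lambda>z. exp (kap s * z) * max 0 (Q f z s) - exp (kap s * z) * max 0 (Q g z s))"
        unfolding I_def by (rule Henstock_Kurzweil_Integration.integral_diff[symmetric]) (rule ii f g)+
      have "norm (integral {x..B} (\<lambda>z. exp (kap s * z) * max 0 (Q f z s) - exp (kap s * z) * max 0 (Q g z s)))
          \<le> integral {x..B} (\<lambda>z. Me * (M * d))"
      proof (rule integral_norm_bound_integral)
        show "(\<lambda>z. exp (kap s * z) * max 0 (Q f z s) - exp (kap s * z) * max 0 (Q g z s)) integrable_on {x..B}"
          by (intro integrable_diff ii f g)
        show "norm (exp (kap s * z) * max 0 (Q f z s) - exp (kap s * z) * max 0 (Q g z s)) \<le> Me * (M * d)"
          if "z \<in> {x..B}" for z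
        proof -
          have z: "z \<in> {0..B}" using that x by auto
          show ?thesis
            using mult_mono[OF Me(2)[OF s z] Qm[OF z]] Me(1)
            unfolding right_diff_distrib[symmetric] real_norm_def abs_mult by auto
        qed
      qed auto
      also have "\<dots> = (B - x) * (Me * (M * d))" using x by simp
      also have "\<dots> \<le> B * (Me * (M * d))"
        using x Me \<open>M > 0\<close> \<open>d \<ge> 0\<close> by (intro mult_right_mono) auto
      finally show ?thesis unfolding diff by (simp add: mult.assoc)
    qed
    have eq: "D B f x s - D B g x s = a * (S' s x * (I B f x s - I B g x s) - psi s x * (max 0 (Q f x s) - max 0 (Q g x s)))"
      by (simp add: D_def algebra_simps)
    have "\<bar>S' s x * (I B f x s - I B g x s)\<bar> \<le> Ms * (B * (Me * M) * d)"
      unfolding abs_mult using Ms(2)[OF s x] Id Ms(1) by (intro mult_mono) auto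
    moreover have "\<bar>psi s x * (max 0 (Q f x s) - max 0 (Q g x s))\<bar> \<le> Mq * (M * d)"
      unfolding abs_mult using Mq(2)[OF s x] Qm[OF x] Mq(1) by (intro mult_mono) auto
    ultimately have "\<bar>S' s x * (I B f x s - I B g x s) - psi s x * (max 0 (Q f x s) - max 0 (Q g x s))\<bar>
        \<le> Ms * (B * (Me * M) * d) + Mq * (M * d)"
      by linarith
    then have "\<bar>D B f x s - D B g x s\<bar> \<le> a * (Ms * (B * (Me * M) * d) + Mq * (M * d))"
      unfolding eq abs_mult using a by (intro mult_mono) auto
    then show ?thesis by (simp add: algebra_simps)
  qed
  moreover have "a * (Ms * (B * (Me * M)) + Mq * M) \<ge> 0"
    using a B Ms(1) Mq(1) Me(1) \<open>M > 0\<close> by (intro mult_nonneg_nonneg add_nonneg_nonneg) auto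
  ultimately show thesis using that by blast
qed

lemma exists_solution:
  assumes "B \<ge> 0"
  obtains f where "jcont {0..B} {0..T} f"
    and "\<And>x c. x \<in> {0..B} \<Longrightarrow> c \<in> {0..T} \<Longrightarrow> f x c = g' x - 1 + integral {c..T} (D B f x)"
proof -
  obtain \<Lambda> where "\<Lambda> \<ge> 0" "\<And>f g s d x. jcont {0..B} {0..T} f \<Longrightarrow> jcont {0..B} {0..T} g \<Longrightarrow> s \<in> {0..T} \<Longrightarrow>
      (\<And>y. y \<in> {0..B} \<Longrightarrow> \<bar>f y s - g y s\<bar> \<le> d) \<Longrightarrow> x \<in> {0..B} \<Longrightarrow> \<bar>D B f x s - D B g x s\<bar> \<le> \<Lambda> * d"
    using D_lipschitz[OF assms compact_Icc[of 0 T]] by blast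
  moreover have "continuous_on {0..B} (\<lambda>x. g' x - 1)" by (intro continuous_intros)
  ultimately show thesis
    using that D_cont by (rule_tac picard_lindelof_integral_equation[of "{0..B}" "\<lambda>x. g' x - 1" \<Lambda> T "D B"]) (auto simp only: compact_Icc)
qed

text \<open>\<open>g'\<close> decays to 0 and \<open>psi T\<close> increases, so the integrand is
  eventually below a negative constant and the integral becomes negative. \<open>B\<close> will lie
  to the right of the free boundary at every level.\<close>

lemma exists_right_end:
  obtains B where "B > 0" "integral {0..B} (\<lambda>y. psi T y * (g' y - 1)) < 0" "g' B < 1"
proof -
  define k where "k = T / r * lam T"
  \<comment> \<open>Then \<open>lam T * x1 = 2 k + 1\<close>, and \<open>exp z \<ge> 1 + z\<close>
    gives \<open>g' x < 1/2\<close> from \<open>x1\<close> on.\<close>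
  define x1 where "x1 = (2 * k + 1) / lam T"
  have "k > 0" using T r lam_pos by (simp add: k_def)
  have x1: "x1 > 0" "\<And>x. x \<ge> x1 \<Longrightarrow> g' x < 1 / 2"
  proof -
    show "x1 > 0" using \<open>k > 0\<close> lam_pos[of T] by (simp add: x1_def)
    fix x assume "x \<ge> x1"
    then have "2 * k + 1 \<le> lam T * x" using lam_pos[of T] by (simp add: x1_def divide_le_eq mult.commute)
    then have "2 * k < exp (lam T * x)" using exp_ge_add_one_self[of "lam T * x"] by linarith
    then have "2 * k * exp (- (lam T * x)) < exp (lam T * x) * exp (- (lam T * x))"
      by (rule mult_strict_right_mono) simp
    then show "g' x < 1 / 2" by (simp add: g'_def k_def exp_minus_inverse mult_ac)
  qed
  let ?h = "\<lambda>y. psi T y * (g' y - 1)"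
  define J where "J = integral {0..x1} ?h"
  \<comment> \<open>Beyond \<open>x1\<close> the integral falls at rate at least
    \<open>psi T x1 / 2\<close>; this length makes the fall exceed
    \<open>\<bar>J\<bar>\<close>.\<close>
  define B where "B = x1 + (2 * \<bar>J\<bar> + 1) / psi T x1"
  have "psi T x1 > 0" by (rule psi_pos[OF x1(1)])
  then have B: "x1 < B" "psi T x1 * (B - x1) = 2 * \<bar>J\<bar> + 1" by (auto simp: B_def)
  have hint: "?h integrable_on {l..u}" for l u
    by (intro integrable_continuous_real continuous_intros)
  have "integral {x1..B} ?h \<le> integral {x1..B} (\<lambda>_. - (psi T x1 / 2))"
  proof (rule integral_le[OF hint])
    fix y assume y: "y \<in> {x1..B}"
    have "psi T x1 \<le> psi T y"
      using y by (intro psi_mono) auto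
    then have "psi T x1 * (1 / 2) \<le> psi T y * (1 - g' y)"
      using x1(2)[of y] y \<open>psi T x1 > 0\<close> by (intro mult_mono) auto
    then show "?h y \<le> - (psi T x1 / 2)" by (simp add: algebra_simps)
  qed auto
  also have "\<dots> = - (psi T x1 * (B - x1) / 2)" using B(1) by simp
  also have "\<dots> < - \<bar>J\<bar>" unfolding B(2) by simp
  finally have "integral {x1..B} ?h < - \<bar>J\<bar>" .
  moreover have "integral {0..B} ?h = J + integral {x1..B} ?h"
    unfolding J_def using x1 B
    by (intro Henstock_Kurzweil_Integration.integral_combine[symmetric] hint) auto
  moreover have "g' B < 1" using x1(2)[of B] B by simp
  ultimately show thesis using that[of B] x1 B by linarith
qed

section \<open>Derivatives of the kernels in \<open>c\<close>, for the bound on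
  \<open>u_c\<close>\<close>

definition dnu where "dnu c = a * nu c / th c"
definition dth where "dth c = - (a * kap c / th c)"
definition dpre where "dpre c z = pre c z * (2 * z * dnu c - dth c / th c - 2 * z * dth c * E1' (th c * z) / E1 (th c * z))"
definition dker where "dker c z t = t * (exp (- nu c * (z * t)) * (z * t * (E1' (th c * (z * t)) * dth c - dnu c * E1 (th c * (z * t)))))"
definition dQ where "dQ f f_c z c = dpre c z * integral {0..1} (\<lambda>t. ker c z t * f (z * t) c)
  + pre c z * integral {0..1} (\<lambda>t. dker c z t * f (z * t) c + ker c z t * f_c (z * t) c)"
definition dS where "dS c y = y * (dnu c * exp (nu c * y) - (a * lam c / th c) * exp (- lam c * y))"

lemma DERIV_pre: "((\<lambda>c. pre c z) has_real_derivative dpre c z) (at c within A)"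
proof -
  have nz: "th c \<noteq> 0" "E1 (th c * z) \<noteq> 0" using th_pos[of c] E1_pos[of "th c * z"] by auto
  have E: "((\<lambda>c. E1 (th c * z)) has_real_derivative E1' (th c * z) * (dth c * z)) (at c within A)"
    by (rule DERIV_chain2[OF DERIV_E1]) (auto intro!: derivative_eq_intros DERIV_th simp: dth_def)
  have X: "((\<lambda>c. exp (2 * nu c * z)) has_real_derivative exp (2 * nu c * z) * (2 * dnu c * z)) (at c within A)"
    by (auto intro!: derivative_eq_intros DERIV_nu simp: dnu_def)
  have D: "((\<lambda>c. th c * (E1 (th c * z))\<^sup>2) has_real_derivative
      th c * (2 * E1 (th c * z) * (E1' (th c * z) * (dth c * z))) + dth c * (E1 (th c * z))\<^sup>2) (at c within A)"
    using DERIV_mult[OF DERIV_th[of c A, folded dth_def] DERIV_power[OF E, of 2]]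
    by (simp add: algebra_simps)
  have "(exp (2 * nu c * z) * (2 * dnu c * z) * (th c * (E1 (th c * z))\<^sup>2)
      - exp (2 * nu c * z) * (th c * (2 * E1 (th c * z) * (E1' (th c * z) * (dth c * z))) + dth c * (E1 (th c * z))\<^sup>2))
      / (th c * (E1 (th c * z))\<^sup>2 * (th c * (E1 (th c * z))\<^sup>2)) = dpre c z"
    using nz unfolding dpre_def pre_def by (simp add: field_simps power2_eq_square)
  then show ?thesis
    using DERIV_divide[OF X D] nz by (simp add: pre_def[abs_def])
qed

lemma DERIV_ker: "((\<lambda>c. ker c z t) has_real_derivative dker c z t) (at c within A)"
proof -
  have E: "((\<lambda>c. E1 (th c * (z * t))) has_real_derivative E1' (th c * (z * t)) * (dth c * (z * t))) (at c within A)"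
    by (rule DERIV_chain2[OF DERIV_E1]) (auto intro!: derivative_eq_intros DERIV_th simp: dth_def)
  have X: "((\<lambda>c. exp (- nu c * (z * t))) has_real_derivative exp (- nu c * (z * t)) * (- dnu c * (z * t))) (at c within A)"
    by (auto intro!: derivative_eq_intros DERIV_nu simp: dnu_def)
  have "((\<lambda>c. t * (exp (- nu c * (z * t)) * E1 (th c * (z * t)))) has_real_derivative
    t * (exp (- nu c * (z * t)) * (E1' (th c * (z * t)) * (dth c * (z * t)))
      + exp (- nu c * (z * t)) * (- dnu c * (z * t)) * E1 (th c * (z * t)))) (at c within A)"
    by (intro DERIV_cmult DERIV_mult' X E)
  then show ?thesis by (simp add: ker_def dker_def algebra_simps)
qed

lemma DERIV_S_c: "((\<lambda>c. S c y) has_real_derivative dS c y) (at c within A)"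
  unfolding S_def dS_def dnu_def
  by (rule derivative_eq_intros DERIV_lam DERIV_nu refl)+ (simp add: algebra_simps)

lemma continuous_on_dS [continuous_intros]:
  assumes "continuous_on A l" "continuous_on A m"
  shows "continuous_on A (\<lambda>x. dS (l x) (m x))" 
  unfolding dS_def dnu_def using th_pos
  by (intro continuous_intros assms) (simp_all add: less_imp_neq[symmetric])

lemma continuous_on_dpre [continuous_intros]:
  assumes "continuous_on A l" "continuous_on A m"
  shows "continuous_on A (\<lambda>x. dpre (l x) (m x))"
  unfolding dpre_def dnu_def dth_def using th_pos E1_pos
  by (intro continuous_intros assms) (simp_all add: less_imp_neq[symmetric])

lemma continuous_on_dker [continuous_intros]:
  assumes "continuous_on A l" "continuous_on A m" "continuous_on A n"
  shows "continuous_on A (\<lambda>x. dker (l x) (m x) (n x))"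
  unfolding dker_def dnu_def dth_def using th_pos
  by (intro continuous_intros assms) (simp_all add: less_imp_neq[symmetric])

lemma dQ_integrand_cont:
  assumes f: "jcont {0..B} C f" and f_c: "jcont {0..B} C f_c"
  shows "continuous_on (({0..B} \<times> C) \<times> {0..1})
    (\<lambda>p. dker (snd (fst p)) (fst (fst p)) (snd p) * f (fst (fst p) * snd p) (snd (fst p))
      + ker (snd (fst p)) (fst (fst p)) (snd p) * f_c (fst (fst p) * snd p) (snd (fst p)))"
  by (intro continuous_on_add ker_f_cont[OF f] ker_f_cont[OF f_c] continuous_intros)

lemma dQ_cont:
  assumes f: "jcont {0..B} C f" and f_c: "jcont {0..B} C f_c"
  shows "jcont {0..B} C (dQ f f_c)"
proof -
  have "continuous_on (({0..B} \<times> C) \<times> cbox 0 1)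
    (\<lambda>(p, t). dker (snd p) (fst p) t * f (fst p * t) (snd p) + ker (snd p) (fst p) t * f_c (fst p * t) (snd p))"
    using dQ_integrand_cont[OF assms] by (simp only: case_prod_unfold box_real)
  from integral_continuous_on_param[OF this]
  have "jcont {0..B} C (\<lambda>z c. integral {0..1} (\<lambda>t. dker c z t * f (z * t) c + ker c z t * f_c (z * t) c))"
    by simp
  then show ?thesis
    unfolding dQ_def by (intro continuous_on_add continuous_on_mult Q_param_cont[OF f] continuous_intros)
qed

lemma DERIV_Q_c:
  assumes f: "jcont {0..B} {0..T} f" and f_c: "jcont {0..B} {0..T} f_c"
    and der: "\<And>x c. x \<in> {0..B} \<Longrightarrow> c \<in> {0..T} \<Longrightarrow> (f x has_real_derivative f_c x c) (at c within {0..T})"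
    and z: "z \<in> {0..B}" and c: "c \<in> {0..T}"
  shows "(Q f z has_real_derivative dQ f f_c z c) (at c within {0..T})"
proof -
  have "((\<lambda>c. integral (cbox 0 1) (\<lambda>t. ker c z t * f (z * t) c)) has_real_derivative
      integral (cbox 0 1) (\<lambda>t. dker c z t * f (z * t) c + ker c z t * f_c (z * t) c)) (at c within {0..T})"
  proof (rule leibniz_rule_field_derivative[where U = "{0..T}"])
    show "((\<lambda>c. ker c z t * f (z * t) c) has_real_derivative dker s z t * f (z * t) s + ker s z t * f_c (z * t) s)
        (at s within {0..T})" if "s \<in> {0..T}" "t \<in> cbox 0 1" for s t
      using DERIV_mult[OF DERIV_ker der[OF scaled_mem[OF z] that(1)], of t z] that(2) by (simp add: algebra_simps)
    show "(\<lambda>t. ker s z t * f (z * t) s) integrable_on cbox 0 1" if "s \<in> {0..T}" for s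
      using Q_integrand_integrable[OF f z that] by simp
    have "continuous_on ({0..T} \<times> {0..1}) (\<lambda>p. ((z, fst p), snd p))" by (intro continuous_intros)
    from continuous_on_compose2[OF dQ_integrand_cont[OF f f_c] this]
    have "continuous_on ({0..T} \<times> {0..1})
      (\<lambda>p. dker (fst p) z (snd p) * f (z * snd p) (fst p) + ker (fst p) z (snd p) * f_c (z * snd p) (fst p))"
      using z by force
    then show "continuous_on ({0..T} \<times> cbox 0 1) (\<lambda>(s, t). dker s z t * f (z * t) s + ker s z t * f_c (z * t) s)"
      by (simp add: case_prod_unfold)
  qed (use c in auto)
  from DERIV_mult'[OF DERIV_pre this]
  show ?thesis by (simp add: Q_def[abs_def] dQ_def add.commute)
qed

end

section \<open>The free boundary\<close>

lemma jcont_uniform: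
  assumes "jcont X Y f" "compact (X :: real set)" "compact (Y :: real set)" "e > 0"
  obtains d where "d > 0" "\<And>x x' y y'. x \<in> X \<Longrightarrow> x' \<in> X \<Longrightarrow> y \<in> Y \<Longrightarrow> y' \<in> Y \<Longrightarrow>
    \<bar>x - x'\<bar> < d \<Longrightarrow> \<bar>y - y'\<bar> < d \<Longrightarrow> \<bar>f x y - f x' y'\<bar> < e"
proof -
  have "uniformly_continuous_on (X \<times> Y) (\<lambda>p. f (fst p) (snd p))"
    by (intro compact_uniformly_continuous compact_Times assms)
  then obtain d where d: "d > 0" "\<And>p p'. p \<in> X \<times> Y \<Longrightarrow> p' \<in> X \<times> Y \<Longrightarrow> dist p' p < d \<Longrightarrow>
      dist (f (fst p') (snd p')) (f (fst p) (snd p)) < e"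
    using \<open>e > 0\<close> unfolding uniformly_continuous_on_def by metis
  show thesis
  proof (rule that[of "d / 2"])
    fix x x' y y' assume "x \<in> X" "x' \<in> X" "y \<in> Y" "y' \<in> Y" "\<bar>x - x'\<bar> < d / 2" "\<bar>y - y'\<bar> < d / 2"
    moreover from this have "dist (x, y) (x', y') < d"
      using sqrt_sum_squares_le_sum_abs[of "dist x x'" "dist y y'"]
      by (simp add: dist_Pair_Pair dist_real_def)
    ultimately show "\<bar>f x y - f x' y'\<bar> < e"
      using d(2)[of "(x', y')" "(x, y)"] by (simp add: dist_real_def)
  qed (use d in auto)
qed

text \<open>The requirements on \<open>B\<close> concern only the level \<open>T\<close>; at lower
  levels the free boundary stays below \<open>B\<close> because it increases with \<open>c\<close>.
  Since \<open>f\<close> is controlled on \<open>[0,B]\<close> only, \<open>u\<close> and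
  \<open>ux\<close> are continued by their values at \<open>B\<close>, which will turn out to be
  0.\<close>

locale ratcheting_solution = ratcheting +
  fixes B :: real and f :: "real \<Rightarrow> real \<Rightarrow> real"
  assumes B: "B > 0" "integral {0..B} (\<lambda>y. psi T y * (g' y - 1)) < 0" "g' B < 1"
    and f_cont: "jcont {0..B} {0..T} f"
    and f_eq: "\<And>x c. x \<in> {0..B} \<Longrightarrow> c \<in> {0..T} \<Longrightarrow> f x c = g' x - 1 + integral {c..T} (D B f x)"
begin

text \<open>\<open>p\<close> and \<open>ux\<close> will be \<open>v\<^sub>x\<close> and \<open>u\<^sub>x\<close>. \<open>q\<close> and \<open>w\<close> are the values that the equations in the problems
  (H) and (U) prescribe for \<open>v\<^sub>x\<^sub>x\<close> and \<open>u\<^sub>x\<^sub>x\<close>; they satisfy \<open>\<partial>q/\<partial>c = - w\<close>.\<close>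

definition G where "G x c = integral {0..x} (\<lambda>y. psi c y * f y c)"
definition ux where "ux x c = D B f (min x B) c"
definition u where "u x c = a * (S c (min x B) * I B f (min x B) c)"
definition p where "p x c = g' x + integral {c..T} (\<lambda>s. ux x s)"
definition v where "v x c = g x + integral {c..T} (\<lambda>s. u x s)"
definition q where "q x c = a * r * v x c - a * c - kap c * p x c"
definition w where "w x c = a * r * u x c - a * (p x c - 1) - kap c * ux x c"

lemma ux_cont: "jcont {0..} {0..T} ux"
  unfolding ux_def using B
  by (intro jcont_compose[OF D_cont[OF f_cont]]) (auto intro!: continuous_intros)

lemma u_cont: "jcont {0..} {0..T} u"
  unfolding u_def using B
  by (intro continuous_intros jcont_compose[OF I_cont[OF f_cont]]) (auto intro!: continuous_intros)

lemma integral_c_cont: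
  assumes h: "jcont {0..} {0..T} h"
  shows "jcont {0..} {0..T} (\<lambda>x c. integral {c..T} (\<lambda>s. h x s))"
proof (rule continuous_on_integral_lower[where ?c0.0 = 0])
  show "continuous_on (({0..} \<times> {0..T}) \<times> {0..T}) (\<lambda>p. h (fst (fst p)) (snd p))"
    by (rule jcont_compose[OF h]) (auto intro!: continuous_intros)
qed (auto intro!: continuous_intros)

lemma p_cont: "jcont {0..} {0..T} p"
  unfolding p_def by (intro continuous_intros integral_c_cont ux_cont)

lemma v_cont: "jcont {0..} {0..T} v"
  unfolding v_def by (intro continuous_intros integral_c_cont u_cont)

lemma w_cont: "jcont {0..} {0..T} w"
  unfolding w_def by (intro continuous_intros p_cont u_cont ux_cont)

lemma ux_eq: "x \<le> B \<Longrightarrow> ux x c = D B f x c"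
  by (simp add: ux_def)

lemma f_p: "x \<in> {0..B} \<Longrightarrow> c \<in> {0..T} \<Longrightarrow> f x c = p x c - 1"
  by (simp add: f_eq p_def ux_eq)

lemma DERIV_integral_c:
  assumes h: "continuous_on {0..T} h" and c: "c \<in> {0..T}"
  shows "((\<lambda>c. integral {c..T} h) has_real_derivative - h c) (at c within {0..T})"
  by (rule integral_has_real_derivative'[OF h c])

lemma DERIV_p_c: "x \<ge> 0 \<Longrightarrow> c \<in> {0..T} \<Longrightarrow> (p x has_real_derivative - ux x c) (at c within {0..T})"
  unfolding p_def[abs_def] using DERIV_integral_c[OF jcont_slice1[OF ux_cont], of x c]
  by (auto intro!: derivative_eq_intros)

lemma DERIV_v_c: "x \<ge> 0 \<Longrightarrow> c \<in> {0..T} \<Longrightarrow> (v x has_real_derivative - u x c) (at c within {0..T})"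
  unfolding v_def[abs_def] using DERIV_integral_c[OF jcont_slice1[OF u_cont], of x c]
  by (auto intro!: derivative_eq_intros)

lemma DERIV_q_c: "x \<ge> 0 \<Longrightarrow> c \<in> {0..T} \<Longrightarrow> (q x has_real_derivative - w x c) (at c within {0..T})"
  unfolding q_def[abs_def] w_def
  by (rule derivative_eq_intros DERIV_p_c DERIV_v_c DERIV_kap refl | assumption)+ (simp add: algebra_simps)

lemma q_T: "q x T = a * r * g x - a * T - kap T * g' x"
  by (simp add: q_def v_def p_def)

lemma q_eq:
  assumes "x \<ge> 0" "c \<in> {0..T}"
  shows "q x c = q x T + integral {c..T} (\<lambda>s. w x s)"
proof -
  have "((\<lambda>s. - w x s) has_integral q x T - q x c) {c..T}"
  proof (rule fundamental_theorem_of_calculus)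
    show "(q x has_vector_derivative - w x s) (at s within {c..T})" if "s \<in> {c..T}" for s
      using DERIV_subset[OF DERIV_q_c[of x s], of "{c..T}"] that assms
      by (simp add: has_real_derivative_iff_has_vector_derivative)
  qed (use assms in auto)
  from integral_unique[OF this] show ?thesis by simp
qed

text \<open>No sign information enters: with \<open>I' = - exp (kap x) max 0 Q\<close> and
  \<open>psi = exp (kap x) S\<close> the product rule reproduces \<open>D\<close>.\<close>

lemma DERIV_u_x_within_B:
  assumes c: "c \<in> {0..T}" and x: "x \<in> {0..B}"
  shows "((\<lambda>x. u x c) has_real_derivative ux x c) (at x within {0..B})"
proof -
  have "continuous_on {0..B} (\<lambda>z. exp (kap c * z) * max 0 (Q f z c))"
    using jcont_slice2[OF I_integrand_cont[OF f_cont] c] .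
  from integral_has_real_derivative'[OF this x]
  have "((\<lambda>x. I B f x c) has_real_derivative - (exp (kap c * x) * max 0 (Q f x c))) (at x within {0..B})"
    unfolding I_def .
  from DERIV_cmult[OF DERIV_mult[OF DERIV_S this], of a]
  have "((\<lambda>x. a * (S c x * I B f x c)) has_real_derivative ux x c) (at x within {0..B})"
    using x by (simp add: ux_eq D_def psi_eq algebra_simps)
  then show ?thesis
    by (rule has_field_derivative_transform_within[OF _ zero_less_one x]) (simp add: u_def)
qed

lemma DERIV_v_x_within_B:
  assumes c: "c \<in> {0..T}" and x: "x \<in> {0..B}"
  shows "((\<lambda>x. v x c) has_real_derivative p x c) (at x within {0..B})"
proof -
  have "((\<lambda>x. integral (cbox c T) (\<lambda>s. u x s)) has_real_derivative integral (cbox c T) (\<lambda>s. ux x s)) (at x within {0..B})"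
  proof (rule leibniz_rule_field_derivative[where U = "{0..B}"])
    show "((\<lambda>x. u x s) has_real_derivative ux y s) (at y within {0..B})" if "y \<in> {0..B}" "s \<in> cbox c T" for y s
      using that c by (intro DERIV_u_x_within_B) auto
    show "(\<lambda>s. u y s) integrable_on cbox c T" if "y \<in> {0..B}" for y
      using that c by (intro integrable_continuous continuous_on_subset[OF jcont_slice1[OF u_cont]]) auto
    show "continuous_on ({0..B} \<times> cbox c T) (\<lambda>(x, s). ux x s)"
      unfolding case_prod_unfold by (rule continuous_on_subset[OF ux_cont]) (use c in auto)
  qed (use x in auto)
  then show ?thesis
    unfolding v_def p_def by (auto intro!: derivative_eq_intros DERIV_g)
qed

lemma psi_f_cont: "jcont {0..B} {0..T} (\<lambda>y c. psi c y * f y c)"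
  by (intro continuous_intros f_cont)

lemma DERIV_G_x: "c \<in> {0..T} \<Longrightarrow> x \<in> {0..B} \<Longrightarrow> ((\<lambda>x. G x c) has_real_derivative psi c x * f x c) (at x within {0..B})"
  unfolding G_def using integral_has_real_derivative[OF jcont_slice2[OF psi_f_cont]] by blast

lemma G_Q: "c \<in> {0..T} \<Longrightarrow> x \<in> {0..B} \<Longrightarrow> G x c = (psi c x)\<^sup>2 * Q f x c"
  unfolding G_def
  by (rule psi_sq_Q[symmetric]) (auto intro!: continuous_on_subset[OF jcont_slice2[OF f_cont]])

lemma G_cont: "jcont {0..B} {0..T} G"
proof -
  have "jcont {0..B} {0..T} (\<lambda>x c. (psi c x)\<^sup>2 * Q f x c)"
    by (intro continuous_intros Q_cont[OF f_cont])
  then show ?thesis by (rule continuous_on_cong[THEN iffD1, rotated -1]) (auto simp: G_Q)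
qed

lemma G_sgn:
  assumes "c \<in> {0..T}" "x \<in> {0<..B}"
  shows "0 < G x c \<longleftrightarrow> 0 < Q f x c" "G x c \<le> 0 \<longleftrightarrow> Q f x c \<le> 0"
  using assms psi_pos[of x c] by (auto simp: G_Q zero_less_mult_iff mult_le_0_iff)

lemma G_strict_mono:
  assumes "c \<in> {0..T}" "0 \<le> x" "x < y" "y \<le> B"
  shows "(\<And>z. x < z \<Longrightarrow> z < y \<Longrightarrow> f z c > 0) \<Longrightarrow> G x c < G y c"
    and "(\<And>z. x < z \<Longrightarrow> z < y \<Longrightarrow> f z c < 0) \<Longrightarrow> G y c < G x c"
proof -
  have c: "continuous_on {x..y} (\<lambda>x. G x c)"
    using assms by (intro continuous_on_subset[OF jcont_slice2[OF G_cont]]) auto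
  have d: "((\<lambda>x. G x c) has_real_derivative psi c z * f z c) (at z)" if "x < z" "z < y" for z
    using DERIV_G_x[of c z] at_within_Icc_at[of 0 z B] that assms by auto
  show "G x c < G y c" if f: "\<And>z. x < z \<Longrightarrow> z < y \<Longrightarrow> f z c > 0"
  proof (rule DERIV_pos_imp_increasing_open[OF assms(3) _ c])
    show "\<exists>l. ((\<lambda>x. G x c) has_real_derivative l) (at z) \<and> 0 < l" if "x < z" "z < y" for z
      using d[OF that] f[OF that] psi_pos[of z c] that assms by (auto intro!: mult_pos_pos)
  qed
  show "G y c < G x c" if f: "\<And>z. x < z \<Longrightarrow> z < y \<Longrightarrow> f z c < 0"
  proof (rule DERIV_neg_imp_decreasing_open[OF assms(3) _ c])
    show "\<exists>l. ((\<lambda>x. G x c) has_real_derivative l) (at z) \<and> l < 0" if "x < z" "z < y" for z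
      using d[OF that] f[OF that] psi_pos[of z c] that assms by (auto intro!: mult_pos_neg)
  qed
qed

lemma G_0 [simp]: "G 0 c = 0"
  by (simp add: G_def)

lemma I_nonneg: "0 \<le> I B f x c"
proof (cases "(\<lambda>z. exp (kap c * z) * max 0 (Q f z c)) integrable_on {x..B}")
  case True
  then show ?thesis unfolding I_def by (rule Henstock_Kurzweil_Integration.integral_nonneg) simp
next
  case False
  then show ?thesis unfolding I_def by (simp add: not_integrable_integral)
qed

lemma u_nonneg: "x \<ge> 0 \<Longrightarrow> 0 \<le> u x c"
proof -
  assume "x \<ge> 0"
  then have "0 \<le> S c (min x B)" using B S_pos[of "min x B" c] by (cases "x = 0") (auto simp: less_imp_le)
  then show ?thesis using a I_nonneg by (simp add: u_def)
qed

lemma u_0 [simp]: "u 0 c = 0"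
  using B by (simp add: u_def)

text \<open>The negative term of \<open>D\<close> carries the factor \<open>psi c 0 = 0\<close>, and
  the remaining term \<open>a S' I\<close> is nonnegative. Lowering \<open>c\<close> can therefore
  only raise \<open>f\<close> at 0.\<close>

lemma f_0: 
  assumes c: "c \<in> {0..T}"
  shows "g' 0 - 1 \<le> f 0 c"
proof -
  have "0 \<le> integral {c..T} (D B f 0)"
    using a lam_pos nu_pos I_nonneg B
    by (intro Henstock_Kurzweil_Integration.integral_nonneg integrable_continuous_real
        continuous_on_subset[OF jcont_slice1[OF D_cont[OF f_cont]]])
      (use c in \<open>auto simp: D_def S'_def add_nonneg_nonneg less_imp_le\<close>)
  then show ?thesis using c B by (simp add: f_eq)
qed

text \<open>One \<open>\<eta>\<close> serves all levels, by uniform continuity. It keeps the free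
  boundary away from 0 during the continuation.\<close>

lemma f_pos_near_0:
  obtains \<eta> where "0 < \<eta>" "\<eta> < B" "\<And>x c. x \<in> {0..\<eta>} \<Longrightarrow> c \<in> {0..T} \<Longrightarrow> f x c > 0"
proof -
  have "g' 0 - 1 > 0" using g'_0 by simp
  from jcont_uniform[OF f_cont compact_Icc compact_Icc this]
  obtain d where d: "d > 0" "\<And>x x' y y'. x \<in> {0..B} \<Longrightarrow> x' \<in> {0..B} \<Longrightarrow> y \<in> {0..T} \<Longrightarrow> y' \<in> {0..T} \<Longrightarrow>
    \<bar>x - x'\<bar> < d \<Longrightarrow> \<bar>y - y'\<bar> < d \<Longrightarrow> \<bar>f x y - f x' y'\<bar> < g' 0 - 1" by metis
  show thesis
  proof (rule that[of "min (d / 2) (B / 2)"])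
    fix x c assume "x \<in> {0..min (d / 2) (B / 2)}" "c \<in> {0..T}"
    then show "f x c > 0" using d(2)[of x 0 c c] f_0[of c] d(1) B by auto
  qed (use d B in auto)
qed

text \<open>\<open>G 0 c = 0\<close> says nothing at the singular point. The rescaled integral does:
  there it equals \<open>E1 0 * f 0 c\<close> times the integral of \<open>t\<close> over
  \<open>[0,1]\<close>.\<close>

lemma Q_0: "c \<in> {0..T} \<Longrightarrow> Q f 0 c > 0"
proof -
  assume c: "c \<in> {0..T}"
  have "f 0 c > 0" using f_0[OF c] g'_0 by simp
  moreover have "integral {0..1} (\<lambda>t::real. t * k) = k / 2" for k :: real
  proof -
    have "((\<lambda>t. t * k) has_integral 1\<^sup>2 * k / 2 - 0\<^sup>2 * k / 2) {0..1}"
      by (rule fundamental_theorem_of_calculus)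
        (auto simp flip: has_real_derivative_iff_has_vector_derivative intro!: derivative_eq_intros)
    from integral_unique[OF this] show ?thesis by simp
  qed
  then have "integral {0..1} (\<lambda>t. t * E1 0 * f 0 c) = E1 0 * f 0 c / 2"
    by (simp add: mult.assoc)
  ultimately show ?thesis using th_pos[of c] E1_pos[of 0] by (simp add: Q_def pre_def ker_def)
qed

text \<open>\<open>b\<close> is the free boundary at level \<open>c\<close>: below, \<open>u(\<cdot>,c)\<close> turns out to be positive exactly on \<open>(0,b)\<close>.\<close>

definition good where "good c b \<longleftrightarrow> 0 < b \<and> b < B \<and> (\<forall>x\<in>{0<..<b}. 0 < G x c) \<and> G b c = 0 \<and> (\<forall>x\<in>{b..B}. f x c < 0)"

context
  fixes c b
  assumes c: "c \<in> {0..T}" and good: "good c b"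
begin

lemma good_b: "0 < b" "b < B"
  using good by (auto simp: good_def)

lemma good_G_pos: "0 < x \<Longrightarrow> x < b \<Longrightarrow> 0 < G x c" and good_G_b: "G b c = 0"
  using good by (auto simp: good_def)

lemma good_G_neg: "b < x \<Longrightarrow> x \<le> B \<Longrightarrow> G x c < 0"
  using G_strict_mono(2)[OF c, of b x] good by (auto simp: good_def)

lemma good_G_le_0: "x \<in> {0<..B} \<Longrightarrow> G x c \<le> 0 \<longleftrightarrow> b \<le> x"
  using good_G_neg[of x] good_G_pos[of x] good_G_b by (cases x b rule: linorder_cases) auto

lemma good_Q_left: "x \<in> {0..b} \<Longrightarrow> max 0 (Q f x c) = Q f x c"
proof (cases "x = 0")
  case True
  then show ?thesis using Q_0[OF c] by simp
next
  case False
  assume "x \<in> {0..b}"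
  then have "0 \<le> G x c" using False good_G_pos[of x] good_G_b by (cases x b rule: linorder_cases) auto
  then show ?thesis using \<open>x \<in> {0..b}\<close> False good_b psi_pos[of x c] c by (auto simp: G_Q zero_le_mult_iff)
qed

lemma good_Q_right: "x \<in> {b..B} \<Longrightarrow> max 0 (Q f x c) = 0"
  using good_G_le_0[of x] G_sgn(2)[OF c, of x] good_b by auto

lemma good_Q_nonzero: "x \<in> {0..B} \<Longrightarrow> x \<noteq> b \<Longrightarrow> Q f x c \<noteq> 0"
proof (cases "x = 0")
  case True
  then show ?thesis using Q_0[OF c] by simp
next
  case False
  assume x: "x \<in> {0..B}" "x \<noteq> b"
  then have "G x c \<noteq> 0" using False good_G_neg[of x] good_G_pos[of x] by (cases x b rule: linorder_cases) auto
  then show ?thesis using G_Q[OF c x(1)] by auto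
qed

lemma good_vanish:
  assumes "b \<le> x" shows "ux x c = 0" "u x c = 0"
proof -
  have "I B f (min x B) c = integral {min x B..B} (\<lambda>_. 0)"
    unfolding I_def by (rule Henstock_Kurzweil_Integration.integral_cong) (use good_Q_right assms good_b in auto)
  then show "ux x c = 0" "u x c = 0"
    using good_Q_right[of "min x B"] assms good_b by (simp_all add: ux_def D_def u_def)
qed

text \<open>Left of \<open>b\<close> the positive part is inactive. Writing
  \<open>psi Q = G / psi\<close> and using \<open>G_x = psi f\<close> avoids differentiating
  \<open>Q\<close> in \<open>x\<close>; the terms then collect to \<open>w\<close>.\<close>

lemma DERIV_ux_interior:
  assumes x: "0 < x" "x < b"
  shows "((\<lambda>x. ux x c) has_real_derivative w x c) (at x)"
proof -
  have xB: "x \<in> {0..B}" and at: "at x within {0..B} = at x"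
    using x good_b by (auto intro: at_within_Icc_at)
  have "continuous_on {0..B} (\<lambda>z. exp (kap c * z) * max 0 (Q f z c))"
    using jcont_slice2[OF I_integrand_cont[OF f_cont] c] .
  from integral_has_real_derivative'[OF this xB]
  have I': "((\<lambda>x. I B f x c) has_real_derivative - (exp (kap c * x) * Q f x c)) (at x)"
    unfolding I_def at using good_Q_left[of x] x by simp
  have G': "((\<lambda>x. G x c) has_real_derivative psi c x * f x c) (at x)"
    using DERIV_G_x[OF c xB] unfolding at .
  have psi: "psi c x > 0" by (rule psi_pos[OF x(1)])
  have "((\<lambda>x. a * (S' c x * I B f x c - G x c / psi c x)) has_real_derivative
    a * ((S' c x * - (exp (kap c * x) * Q f x c) + (a * r * S c x - kap c * S' c x) * I B f x c)
      - (psi c x * f x c * psi c x - G x c * psi' c x) / (psi c x * psi c x))) (at x)"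
    using psi by (intro DERIV_cmult DERIV_diff DERIV_mult' DERIV_divide DERIV_S' I' G' DERIV_psi) auto
  moreover have "(psi c x * f x c * psi c x - G x c * psi' c x) / (psi c x * psi c x) = f x c - Q f x c * psi' c x"
    using psi by (simp add: G_Q[OF c xB] power2_eq_square field_simps)
  ultimately have "((\<lambda>x. a * (S' c x * I B f x c - G x c / psi c x)) has_real_derivative
    a * ((S' c x * - (exp (kap c * x) * Q f x c) + (a * r * S c x - kap c * S' c x) * I B f x c)
      - (f x c - Q f x c * psi' c x))) (at x)"
    by simp
  moreover have "w x c = a * ((S' c x * - (exp (kap c * x) * Q f x c) + (a * r * S c x - kap c * S' c x) * I B f x c)
      - (f x c - Q f x c * psi' c x))"
    using xB c good_Q_left[of x] x f_p[OF xB c, symmetric]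
    by (simp add: w_def u_def ux_def D_def psi'_eq algebra_simps)
  ultimately have "((\<lambda>x. a * (S' c x * I B f x c - G x c / psi c x)) has_real_derivative w x c) (at x)"
    by simp
  then show ?thesis
  proof (rule has_field_derivative_transform_within_open[of _ _ _ "{0<..<b}"])
    fix z assume z: "z \<in> {0<..<b}"
    then have "G z c / psi c z = psi c z * Q f z c"
      using psi_pos[of z c] good_b by (simp add: G_Q[OF c] power2_eq_square)
    then show "a * (S' c z * I B f z c - G z c / psi c z) = ux z c"
      using z good_b good_Q_left[of z] by (simp add: ux_def D_def)
  qed (use x in auto)
qed

text \<open>\<open>psi\<close> vanishes at 0 and \<open>u_xx\<close> jumps at \<open>b\<close>, so
  the endpoints escape the interior computation. Their one-sided derivatives follow from the
  continuity of \<open>ux\<close> and \<open>w\<close>.\<close>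

lemma DERIV_ux_left:
  assumes "x \<in> {0..b}"
  shows "((\<lambda>x. ux x c) has_real_derivative w x c) (at x within {0..b})"
  by (rule has_real_derivative_at_closed_interval[OF _ _ DERIV_ux_interior assms])
    (auto intro!: continuous_on_subset[OF jcont_slice2[OF ux_cont c]] continuous_on_subset[OF jcont_slice2[OF w_cont c]])

text \<open>At \<open>x = b\<close> the two one-sided second derivatives of \<open>u\<close> differ:
  \<open>w b c = - a f b c > 0\<close> on the left, 0 on the right.\<close>

lemma DERIV_ux:
  assumes "x \<ge> 0" "x \<noteq> b"
  shows "((\<lambda>x. ux x c) has_real_derivative (if x < b then w x c else 0)) (at x within {0..})"
proof (cases "x < b")
  case True
  then have "at x within {0..} = at x within {0..b}"
    by (intro at_within_nhd[of x "{..<b}"]) auto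
  then show ?thesis using DERIV_ux_left[of x] True assms by simp
next
  case False
  have "((\<lambda>x. ux x c) has_real_derivative 0) (at x)"
    using False assms good_vanish(1)
    by (intro has_field_derivative_transform_within_open[OF DERIV_const[of 0], of "{b<..}"]) auto
  then show ?thesis using False by (simp add: has_field_derivative_at_within)
qed

lemma DERIV_u:
  assumes "x \<ge> 0"
  shows "((\<lambda>x. u x c) has_real_derivative ux x c) (at x within {0..})"
proof (cases "x < B")
  case True
  then have "at x within {0..} = at x within {0..B}"
    by (intro at_within_nhd[of x "{..<B}"]) auto
  then show ?thesis using DERIV_u_x_within_B[OF c, of x] True assms by simp
next
  case False
  have "((\<lambda>x. u x c) has_real_derivative 0) (at x)"
    using False assms good_vanish(2) good_b
    by (intro has_field_derivative_transform_within_open[OF DERIV_const[of 0], of "{b<..}"]) auto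
  then show ?thesis using False good_vanish(1)[of x] good_b by (simp add: has_field_derivative_at_within)
qed

text \<open>\<open>ux z c = ux (min z b) c\<close>, so only the smooth piece \<open>[0,b]\<close>
  matters and the kink at \<open>b\<close> is never crossed.\<close>

lemma ux_lipschitz:
  assumes M: "\<And>x. x \<in> {0..B} \<Longrightarrow> \<bar>w x c\<bar> \<le> M" and xy: "x \<ge> 0" "y \<ge> 0"
  shows "\<bar>ux x c - ux y c\<bar> \<le> M * \<bar>x - y\<bar>"
proof -
  have "M \<ge> 0" using M[of 0] B by force
  have eq: "ux z c = ux (min z b) c" for z using good_vanish(1)[of z] good_vanish(1)[of b] by (cases "z \<le> b") auto
  have "norm (ux (min x b) c - ux (min y b) c) \<le> M * norm (min x b - min y b)"
    by (rule field_differentiable_bound[of "{0..b}" "\<lambda>x. ux x c" "\<lambda>x. w x c"])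
      (use DERIV_ux_left M xy good_b in auto)
  also have "\<dots> \<le> M * \<bar>x - y\<bar>" using \<open>M \<ge> 0\<close> by (intro mult_left_mono) auto
  finally show ?thesis unfolding eq[of x] eq[of y] real_norm_def .
qed

lemma u_pos:
  assumes x: "0 < x" "x < b"
  shows "0 < u x c"
proof -
  let ?h = "\<lambda>z. exp (kap c * z) * max 0 (Q f z c)"
  have "I B f x c \<noteq> 0"
  proof
    assume "I B f x c = 0"
    moreover have "continuous_on {x..B} ?h"
      using x by (intro continuous_on_subset[OF jcont_slice2[OF I_integrand_cont[OF f_cont] c]]) auto
    ultimately have "?h x = 0"
      using x good_b integral_eq_0_iff[of x B ?h] unfolding I_def by auto
    moreover have "Q f x c > 0"
      using good x good_b G_sgn(1)[OF c, of x] by (auto simp: good_def)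
    ultimately show False by simp
  qed
  then have "0 < I B f x c" using I_nonneg[of x c] by simp
  then show ?thesis using x good_b a S_pos[of x c] by (simp add: u_def)
qed

text \<open>Green's identity for \<open>u\<close> and the adjoint solutions \<open>psi\<close> and \<open>chi = \<partial>psi/\<partial>c\<close>; the boundary terms
  vanish because \<open>u\<close> and \<open>u\<^sub>x\<close> do so at the free boundary.\<close>

lemma G_c_integral_pos:
  assumes x: "b \<le> x" "x \<le> B"
  shows "0 < integral {0..x} (\<lambda>y. chi c y * f y c - psi c y * ux y c)"
proof -
  let ?h = "\<lambda>y. chi c y * f y c - psi c y * ux y c"
  \<comment> \<open>The first part of \<open>Y\<close> is the boundary form of Green's identity for
    \<open>chi\<close> and \<open>u\<close>, where \<open>f\<close> is replaced by
    \<open>- (u'' + kap u' - a r u) / a\<close>; it leaves the integrand \<open>psi' u\<close>. The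
    term \<open>psi u\<close> comes from integrating \<open>psi u_x\<close> by parts and leaves
    \<open>psi' u\<close> once more, hence the factor 2 below.\<close>
  define Y where "Y y = - (1 / a) * (chi c y * ux y c - chi' c y * u y c + kap c * (chi c y * u y c)) - psi c y * u y c" for y
  have fc: "continuous_on A (\<lambda>y. f y c)" if "A \<subseteq> {0..B}" for A
    by (rule continuous_on_subset[OF jcont_slice2[OF f_cont c] that])
  have uxc: "continuous_on A (\<lambda>y. ux y c)" and uc: "continuous_on A (\<lambda>y. u y c)" if "A \<subseteq> {0..B}" for A
    using that by (auto intro!: continuous_on_subset[OF jcont_slice2[OF ux_cont c]] continuous_on_subset[OF jcont_slice2[OF u_cont c]])
  have cont: "continuous_on A ?h" if "A \<subseteq> {0..B}" for A
    by (intro continuous_intros fc uxc that)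
  have der: "(Y has_vector_derivative ?h y - 2 * (psi' c y * u y c)) (at y within {0..b})" if y: "y \<in> {0..b}" for y
  proof -
    have u': "((\<lambda>x. u x c) has_real_derivative ux y c) (at y within {0..b})"
      using DERIV_subset[OF DERIV_u[of y], of "{0..b}"] y by auto
    have "(Y has_real_derivative
       - (1 / a) * ((chi c y * w y c + chi' c y * ux y c)
         - (chi' c y * ux y c + (kap c * chi' c y + a * r * chi c y - a * psi' c y) * u y c)
         + kap c * (chi c y * ux y c + chi' c y * u y c))
       - (psi c y * ux y c + psi' c y * u y c)) (at y within {0..b})"
      unfolding Y_def[abs_def]
      by (intro DERIV_diff DERIV_add DERIV_cmult DERIV_mult' DERIV_chi DERIV_chi' DERIV_psi u' DERIV_ux_left y)
    moreover have "- (1 / a) * ((chi c y * w y c + chi' c y * ux y c)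
         - (chi' c y * ux y c + (kap c * chi' c y + a * r * chi c y - a * psi' c y) * u y c)
         + kap c * (chi c y * ux y c + chi' c y * u y c))
       - (psi c y * ux y c + psi' c y * u y c) = ?h y - 2 * (psi' c y * u y c)"
    proof -
      have "p y c = f y c + 1" using f_p[of y c] y good_b c by simp
      then show ?thesis using a by (simp add: w_def field_simps)
    qed
    ultimately show ?thesis by (simp only: has_real_derivative_iff_has_vector_derivative)
  qed
  have "((\<lambda>y. ?h y - 2 * (psi' c y * u y c)) has_integral Y b - Y 0) {0..b}"
    using good_b by (intro fundamental_theorem_of_calculus der) auto
  moreover have "Y b = 0" "Y 0 = 0" using good_vanish[of b] by (simp_all add: Y_def)
  ultimately have "integral {0..b} (\<lambda>y. ?h y - 2 * (psi' c y * u y c)) = 0" by (simp add: integral_unique)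
  moreover have "integral {0..b} (\<lambda>y. ?h y - 2 * (psi' c y * u y c))
      = integral {0..b} ?h - integral {0..b} (\<lambda>y. 2 * (psi' c y * u y c))"
    using good_b by (intro Henstock_Kurzweil_Integration.integral_diff integrable_continuous_real cont continuous_intros uc) auto
  moreover have "0 < integral {0..b} (\<lambda>y. 2 * (psi' c y * u y c))"
  proof -
    have nn: "0 \<le> 2 * (psi' c y * u y c)" if "y \<in> {0..b}" for y
      using u_nonneg[of y] psi'_pos[of c y] that by simp
    have ct: "continuous_on {0..b} (\<lambda>y. 2 * (psi' c y * u y c))"
      using good_b by (intro continuous_intros uc) auto
    have "2 * (psi' c (b / 2) * u (b / 2) c) \<noteq> 0"
      using u_pos[of "b / 2"] good_b psi'_pos[of c "b / 2"] by auto
    then have "integral {0..b} (\<lambda>y. 2 * (psi' c y * u y c)) \<noteq> 0"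
      using integral_eq_0_iff[OF ct good_b(1) nn] good_b by (auto dest!: bspec[of _ _ "b / 2"])
    moreover have "0 \<le> integral {0..b} (\<lambda>y. 2 * (psi' c y * u y c))"
      by (rule Henstock_Kurzweil_Integration.integral_nonneg[OF integrable_continuous_real[OF ct] nn])
    ultimately show ?thesis by linarith
  qed
  \<comment> \<open>Past the boundary \<open>u_x\<close> vanishes, and \<open>chi\<close> and
    \<open>f\<close> are both nonpositive.\<close>
  moreover have "0 \<le> integral {b..x} ?h"
  proof (rule Henstock_Kurzweil_Integration.integral_nonneg[OF integrable_continuous_real[OF cont]])
    show "0 \<le> ?h y" if "y \<in> {b..x}" for y
    proof -
      have "f y c < 0" "chi c y \<le> 0" "ux y c = 0"
        using that good x good_b c chi_nonpos[of c y] good_vanish[of y] by (auto simp: good_def)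
      then show ?thesis by (simp add: mult_nonpos_nonpos)
    qed
  qed (use x good_b in auto)
  moreover have "integral {0..x} ?h = integral {0..b} ?h + integral {b..x} ?h"
    using x good_b
    by (intro Henstock_Kurzweil_Integration.integral_combine[symmetric] integrable_continuous_real cont) auto
  ultimately show ?thesis by linarith
qed

end

lemma DERIV_G_c:
  assumes x: "x \<in> {0..B}" and c: "c \<in> {0..T}"
  shows "(G x has_real_derivative integral {0..x} (\<lambda>y. chi c y * f y c - psi c y * ux y c)) (at c within {0..T})"
proof -
  have "((\<lambda>c. integral (cbox 0 x) (\<lambda>y. psi c y * f y c)) has_real_derivative
      integral (cbox 0 x) (\<lambda>y. chi c y * f y c - psi c y * ux y c)) (at c within {0..T})"
  proof (rule leibniz_rule_field_derivative[where U = "{0..T}"])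
    fix s y assume s: "s \<in> {0..T}" and "y \<in> cbox 0 x"
    then have y: "y \<in> {0..B}" using x by auto
    have "((\<lambda>c. p y c - 1) has_real_derivative - ux y s) (at s within {0..T})"
      using DERIV_p_c[of y s] y s by (auto intro!: derivative_eq_intros)
    then have "(f y has_real_derivative - ux y s) (at s within {0..T})"
      by (rule has_field_derivative_transform_within[OF _ zero_less_one s]) (use f_p[OF y] in simp)
    from DERIV_mult[OF DERIV_psi_c this]
    show "((\<lambda>c. psi c y * f y c) has_real_derivative chi s y * f y s - psi s y * ux y s) (at s within {0..T})"
      by (simp add: algebra_simps)
  next
    show "(\<lambda>y. psi s y * f y s) integrable_on cbox 0 x" if "s \<in> {0..T}" for s
      using x that by (intro integrable_continuous continuous_on_subset[OF jcont_slice2[OF psi_f_cont that]]) auto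
    have jc: "jcont {0..B} {0..T} (\<lambda>y c. chi c y * f y c - psi c y * ux y c)"
      by (intro continuous_intros f_cont continuous_on_subset[OF ux_cont]) auto
    have "{0..T} \<times> cbox 0 x \<subseteq> {0..T} \<times> {0..B}" using x by auto
    from continuous_on_subset[OF jcont_swap[OF jc] this] show "continuous_on ({0..T} \<times> cbox 0 x) (\<lambda>(c, y). chi c y * f y c - psi c y * ux y c)"
      unfolding case_prod_unfold .
  qed (use c in auto)
  then show ?thesis by (simp add: G_def[abs_def])
qed

text \<open>\<open>G x s \<le> 0\<close> places the boundary at level \<open>s\<close> at or left of
  \<open>x\<close>, which is the situation where Green's identity gives
  \<open>\<partial>G/\<partial>c > 0\<close>. The barrier argument in \<open>c\<close> then applies
  at the fixed \<open>x\<close>.\<close>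

lemma G_neg_before:
  assumes "0 \<le> c1" "c1 \<le> t" "t < c2" "c2 \<le> T" and good: "\<And>s. s \<in> {c1..c2} \<Longrightarrow> \<exists>b. good s b"
    and x: "x \<in> {0<..B}" and neg: "G x c2 \<le> 0"
  shows "G x t < 0"
proof (rule neg_before_barrier[where h = "G x" and ?c1.0 = c1 and ?c2.0 = c2])
  show "continuous_on {c1..c2} (G x)"
    using assms by (intro continuous_on_subset[OF jcont_slice1[OF G_cont]]) auto
  fix s assume s: "s \<in> {c1..c2}" and "G x s \<le> 0"
  then obtain b where b: "good s b" using good by blast
  have s': "s \<in> {0..T}" using s assms by auto
  have "b \<le> x" using good_G_le_0[OF s' b x] \<open>G x s \<le> 0\<close> by simp
  then have "0 < integral {0..x} (\<lambda>y. chi s y * f y s - psi s y * ux y s)"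
    using x by (intro G_c_integral_pos[OF s' b]) auto
  moreover have "(G x has_real_derivative integral {0..x} (\<lambda>y. chi s y * f y s - psi s y * ux y s)) (at s within {c1..c2})"
    by (rule DERIV_subset[OF DERIV_G_c]) (use x s' assms in auto)
  ultimately show "\<exists>d>0. (G x has_real_derivative d) (at s within {c1..c2})" by blast
qed (use assms in auto)

lemma free_boundary_strict_mono:
  assumes "0 \<le> c1" "c1 < c2" "c2 \<le> T" and good: "\<And>s. s \<in> {c1..c2} \<Longrightarrow> \<exists>b. good s b"
    and b1: "good c1 b1" and b2: "good c2 b2"
  shows "b1 < b2"
proof -
  have "G b2 c1 < 0"
    using b2 assms by (intro G_neg_before[of c1 c1 c2]) (auto simp: good_def)
  moreover have "b2 \<in> {0<..B}" using b2 by (auto simp: good_def)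
  ultimately have "b1 \<le> b2" "b1 \<noteq> b2"
    using good_G_le_0[OF _ b1, of b2] b1 assms by (auto simp: good_def)
  then show ?thesis by simp
qed

subsection \<open>Continuation in the dividend rate\<close>

text \<open>On \<open>[0,b]\<close> the function \<open>G\<close> first rises and then falls to
  \<open>G b c = 0\<close>, so it is positive in between; \<open>f b c < 0\<close> makes the final
  descent strict. \<open>single\<close> is the form in which the maximum principle supplies the sign
  structure of \<open>f\<close>.\<close>

lemma goodI:
  assumes c: "c \<in> {0..T}" and b: "0 < b" "b < B" and Gb: "G b c = 0" and neg: "\<And>x. x \<in> {b..B} \<Longrightarrow> f x c < 0"
    and single: "\<And>y z. 0 \<le> y \<Longrightarrow> y \<le> z \<Longrightarrow> z \<le> b \<Longrightarrow> f y c \<le> 0 \<Longrightarrow> f z c \<le> 0"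
  shows "good c b"
proof -
  have "0 < G x c" if x: "x \<in> {0<..<b}" for x
  proof (cases "\<forall>y\<in>{0<..<x}. f y c > 0")
    case True
    then show ?thesis using G_strict_mono(1)[OF c, of 0 x] x b by auto
  next
    case False
    then obtain y where y: "0 < y" "y < x" "f y c \<le> 0" by force
    have "f b c < 0" using neg b by auto
    moreover have "continuous_on {0..b} (\<lambda>x. f x c)"
      using b by (intro continuous_on_subset[OF jcont_slice2[OF f_cont c]]) auto
    ultimately have "\<forall>\<^sub>F z in at b within {0..b}. f z c < 0"
      using b by (intro order_tendstoD(2)) (auto simp: continuous_on_def)
    then obtain e where e: "e > 0" "\<And>z. z \<in> {0..b} \<Longrightarrow> z \<noteq> b \<Longrightarrow> dist z b < e \<Longrightarrow> f z c < 0"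
      unfolding eventually_at by auto
    define z where "z = max x (b - e / 2)"
    have z: "x \<le> z" "z < b" "b - e < z" using x e(1) by (auto simp: z_def)
    have "G b c < G z c"
      using z x b e(2) by (intro G_strict_mono(2)[OF c]) (auto simp: dist_real_def)
    moreover have "G z c \<le> G x c"
    proof (rule DERIV_nonpos_imp_decreasing_open[OF z(1)])
      show "\<exists>l. ((\<lambda>x. G x c) has_real_derivative l) (at t) \<and> l \<le> 0" if "x < t" "t < z" for t
      proof -
        have t: "t \<in> {0..B}" "at t within {0..B} = at t"
          using that x z b by (auto intro: at_within_Icc_at)
        have "f t c \<le> 0" using single[of y t] y that z by auto
        then have "psi c t * f t c \<le> 0" using psi_pos[of t c] that x by (intro mult_nonneg_nonpos) auto
        then show ?thesis using DERIV_G_x[OF c t(1)] t(2) by auto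
      qed
      show "continuous_on {x..z} (\<lambda>x. G x c)"
        using x z b by (intro continuous_on_subset[OF jcont_slice2[OF G_cont c]]) auto
    qed
    ultimately show ?thesis using Gb by linarith
  qed
  then show ?thesis using assms by (auto simp: good_def)
qed

text \<open>At \<open>T\<close> the function \<open>f = g' - 1\<close> is strictly decreasing, so
  everything is explicit: the choice of \<open>B\<close> yields a zero of \<open>G\<close>, and
  \<open>f \<ge> 0\<close> at that zero would make \<open>G\<close> positive there.\<close>

lemma good_terminal: "\<exists>b. good T b"
proof -
  have T': "T \<in> {0..T}" using T by auto
  have fT: "f x T = g' x - 1" if "x \<in> {0..B}" for x using that T by (simp add: f_eq)
  have "G B T = integral {0..B} (\<lambda>y. psi T y * (g' y - 1))"
    unfolding G_def by (rule Henstock_Kurzweil_Integration.integral_cong) (simp add: fT)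
  then have GB: "G B T < 0" using B by simp
  obtain \<eta> where \<eta>: "0 < \<eta>" "\<eta> < B" "\<And>x c. x \<in> {0..\<eta>} \<Longrightarrow> c \<in> {0..T} \<Longrightarrow> f x c > 0"
    using f_pos_near_0 by blast
  have "0 < G \<eta> T" using G_strict_mono(1)[OF T', of 0 \<eta>] \<eta> T by auto
  moreover have "continuous_on {\<eta>..B} (\<lambda>x. G x T)"
    using \<eta> by (intro continuous_on_subset[OF jcont_slice2[OF G_cont T']]) auto
  ultimately obtain b where b: "\<eta> \<le> b" "b \<le> B" "G b T = 0"
    using IVT2'[of "\<lambda>x. G x T" B 0 \<eta>] GB \<eta> by auto
  have "b < B" using b GB by (cases "b = B") auto
  have fb: "f b T < 0"
  proof (rule ccontr)
    assume "\<not> f b T < 0"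
    then have "f x T > 0" if "0 < x" "x < b" for x
      using that b \<open>b < B\<close> fT[of x] fT[of b] g'_strict_decreasing[of x b] by auto
    then have "G 0 T < G b T" using b \<eta> \<open>b < B\<close> by (intro G_strict_mono(1)[OF T']) auto
    then show False using b by simp
  qed
  have dec: "f y T \<le> f x T" if "0 \<le> x" "x \<le> y" "y \<le> B" for x y
    using that fT[of x] fT[of y] g'_strict_decreasing[of x y] by (cases "x = y") auto
  have "good T b"
  proof (rule goodI[OF T'])
    show "f x T < 0" if "x \<in> {b..B}" for x using dec[of b x] fb that b \<eta> by auto
    show "f z T \<le> 0" if "0 \<le> y" "y \<le> z" "z \<le> b" "f y T \<le> 0" for y z
      using dec[of y z] that \<open>b < B\<close> by auto
  qed (use b \<eta> \<open>b < B\<close> in auto)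
  then show ?thesis by blast
qed

text \<open>Three strict inequalities on compact sets survive a small change of level:
  \<open>f < 0\<close> on \<open>[l,B]\<close>, \<open>Q > 0\<close> on \<open>[0,l]\<close> and
  \<open>G < 0\<close> at \<open>B\<close>. \<open>Q\<close> replaces \<open>G\<close> on the left
  because \<open>G\<close> vanishes at 0. They force exactly one zero of \<open>G\<close>, strictly
  between \<open>l\<close> and \<open>B\<close>.\<close>

lemma good_open:
  assumes c: "c \<in> {0..T}" and good: "good c b"
  obtains d where "d > 0" "\<And>s. s \<in> {0..T} \<Longrightarrow> \<bar>s - c\<bar> < d \<Longrightarrow> \<exists>b'. good s b'"
proof -
  note gb = good_b[OF c good]
  have "f b c < 0" using good gb by (auto simp: good_def)
  moreover have "continuous_on {0..b} (\<lambda>x. f x c)"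
    using gb by (intro continuous_on_subset[OF jcont_slice2[OF f_cont c]]) auto
  ultimately have "\<forall>\<^sub>F z in at b within {0..b}. f z c < 0"
    using gb by (intro order_tendstoD(2)) (auto simp: continuous_on_def)
  then obtain e where e: "e > 0" "\<And>z. z \<in> {0..b} \<Longrightarrow> z \<noteq> b \<Longrightarrow> dist z b < e \<Longrightarrow> f z c < 0"
    unfolding eventually_at by auto
  define l where "l = max (b / 2) (b - e / 2)"
  have l: "0 < l" "l < b" "b - e < l" using gb e(1) by (auto simp: l_def)
  have fneg: "f x c < 0" if "x \<in> {l..B}" for x
    using that e(2)[of x] good l by (cases "x < b") (auto simp: good_def dist_real_def)
  have "continuous_on {l..B} (\<lambda>x. f x c)"
    using l by (intro continuous_on_subset[OF jcont_slice2[OF f_cont c]]) auto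
  then obtain m where m: "m \<in> {l..B}" "\<And>x. x \<in> {l..B} \<Longrightarrow> f x c \<le> f m c"
    using continuous_attains_sup[of "{l..B}" "\<lambda>x. f x c"] l gb by auto
  have Qpos: "Q f x c > 0" if "x \<in> {0..l}" for x
    using that Q_0[OF c] G_sgn(1)[OF c, of x] good_G_pos[OF c good, of x] l gb by (cases "x = 0") auto
  have "continuous_on {0..l} (\<lambda>x. Q f x c)"
    using l gb by (intro continuous_on_subset[OF jcont_slice2[OF Q_cont[OF f_cont] c]]) auto
  then obtain n where n: "n \<in> {0..l}" "\<And>x. x \<in> {0..l} \<Longrightarrow> Q f n c \<le> Q f x c"
    using continuous_attains_inf[of "{0..l}" "\<lambda>x. Q f x c"] l by auto
  have GB: "G B c < 0" using good_G_neg[OF c good, of B] gb by auto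
  obtain d1 where d1: "d1 > 0" "\<And>x s. x \<in> {0..B} \<Longrightarrow> s \<in> {0..T} \<Longrightarrow> \<bar>s - c\<bar> < d1 \<Longrightarrow> \<bar>f x s - f x c\<bar> < - f m c"
    using jcont_uniform[OF f_cont compact_Icc compact_Icc, of "- f m c"] fneg[OF m(1)] c by (metis abs_zero cancel_comm_monoid_add_class.diff_cancel neg_0_less_iff_less)
  obtain d2 where d2: "d2 > 0" "\<And>x s. x \<in> {0..B} \<Longrightarrow> s \<in> {0..T} \<Longrightarrow> \<bar>s - c\<bar> < d2 \<Longrightarrow> \<bar>Q f x s - Q f x c\<bar> < Q f n c"
    using jcont_uniform[OF Q_cont[OF f_cont] compact_Icc compact_Icc, of "Q f n c"] Qpos[OF n(1)] c by (metis abs_zero cancel_comm_monoid_add_class.diff_cancel)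
  obtain d3 where d3: "d3 > 0" "\<And>x s. x \<in> {0..B} \<Longrightarrow> s \<in> {0..T} \<Longrightarrow> \<bar>s - c\<bar> < d3 \<Longrightarrow> \<bar>G x s - G x c\<bar> < - G B c"
    using jcont_uniform[OF G_cont compact_Icc compact_Icc, of "- G B c"] GB c by (metis abs_zero cancel_comm_monoid_add_class.diff_cancel neg_0_less_iff_less)
  show thesis
  proof (rule that[of "min d1 (min d2 d3)"])
    show "0 < min d1 (min d2 d3)" using d1 d2 d3 by simp
    fix s assume s: "s \<in> {0..T}" and "\<bar>s - c\<bar> < min d1 (min d2 d3)"
    then have near: "\<bar>s - c\<bar> < d1" "\<bar>s - c\<bar> < d2" "\<bar>s - c\<bar> < d3" by auto
    have f': "f x s < 0" if "x \<in> {l..B}" for x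
      using d1(2)[of x s] near m(2)[OF that] that l s by auto
    have G': "G x s > 0" if "x \<in> {0<..l}" for x
    proof -
      have "Q f x s > 0" using d2(2)[of x s] near n(2)[of x] that l gb s by auto
      then show ?thesis using G_sgn(1)[OF s, of x] that l gb by auto
    qed
    have "G B s < 0" using d3(2)[of B s] near B s by auto
    moreover have "continuous_on {l..B} (\<lambda>x. G x s)"
      using l by (intro continuous_on_subset[OF jcont_slice2[OF G_cont s]]) auto
    ultimately obtain b' where b': "l \<le> b'" "b' \<le> B" "G b' s = 0"
      using IVT2'[of "\<lambda>x. G x s" B 0 l] G'[of l] l gb by auto
    have "b' \<noteq> B" "b' \<noteq> l" using b' \<open>G B s < 0\<close> G'[of l] l by auto
    have "G x s > 0" if "0 < x" "x < b'" for x
    proof (cases "x \<le> l")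
      case False
      then have "G b' s < G x s"
        using that b' f' l by (intro G_strict_mono(2)[OF s]) auto
      then show ?thesis using b' by simp
    qed (use G' that in auto)
    then have "good s b'"
      using b' f' l \<open>b' \<noteq> B\<close> by (auto simp: good_def)
    then show "\<exists>b'. good s b'" by blast
  qed
qed

text \<open>For fixed \<open>x\<close> the integrand \<open>ux x s\<close> lacks its
  \<open>x\<close>-derivative only where \<open>\<beta> s = x\<close>. Strict monotonicity leaves at
  most one such level, and the common Lipschitz bound permits differentiation under the
  integral.\<close>

lemma DERIV_p_x:
  assumes c: "c \<in> {0..T}" and good: "\<And>s. s \<in> {c<..T} \<Longrightarrow> good s (\<beta> s)" and x: "x \<ge> 0"
  defines "k \<equiv> \<lambda>s. if x < \<beta> s then w x s else 0"
  shows "((\<lambda>x. p x c) has_real_derivative q x T + integral {c..T} k) (at x within {0..})"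
    and "k integrable_on {c..T}"
proof -
  have inj: "\<beta> s1 \<noteq> \<beta> s2" if "s1 \<in> {c<..T}" "s2 \<in> {c<..T}" "s1 < s2" for s1 s2
  proof -
    have "\<exists>b. good s b" if "s \<in> {s1..s2}" for s
      using good[of s] that \<open>s1 \<in> _\<close> \<open>s2 \<in> _\<close> by auto
    then show ?thesis
      using free_boundary_strict_mono[of s1 s2] good[of s1] good[of s2] that c by force
  qed
  \<comment> \<open>The level \<open>c\<close> is included because only the levels above it are
    known to be good; this is the situation in the closure step.\<close>
  define N where "N = insert c {s \<in> {c<..T}. \<beta> s = x}"
  have "inj_on \<beta> {s \<in> {c<..T}. \<beta> s = x}"
  proof (rule inj_onI)
    fix s1 s2 assume "s1 \<in> {s \<in> {c<..T}. \<beta> s = x}" "s2 \<in> {s \<in> {c<..T}. \<beta> s = x}" "\<beta> s1 = \<beta> s2"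
    then show "s1 = s2" using inj[of s1 s2] inj[of s2 s1] by (cases s1 s2 rule: linorder_cases) auto
  qed
  moreover have "finite (\<beta> ` {s \<in> {c<..T}. \<beta> s = x})"
    by (rule finite_subset[of _ "{x}"]) auto
  ultimately have "finite N" unfolding N_def using finite_imageD by blast
  then have N: "negligible N" by (rule negligible_finite)
  have "jcont {0..B} {0..T} w" by (rule continuous_on_subset[OF w_cont]) auto
  from jcont_bounded[OF this compact_Icc compact_Icc]
  obtain M where M: "M > 0" "\<And>y s. y \<in> {0..B} \<Longrightarrow> s \<in> {0..T} \<Longrightarrow> \<bar>w y s\<bar> \<le> M"
    by blast
  have int: "ux y integrable_on {c..T}" if "y \<in> {0..}" for y
    using that c by (intro integrable_continuous_real continuous_on_subset[OF jcont_slice1[OF ux_cont]]) auto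
  have lip: "\<bar>ux y s - ux x s\<bar> \<le> M * \<bar>y - x\<bar>" if "y \<in> {0..}" "s \<in> {c..T} - N" for y s
    using that c x M(2) by (intro ux_lipschitz[OF _ good]) (auto simp: N_def)
  have der: "((\<lambda>x. ux x s) has_real_derivative k s) (at x within {0..})" if "s \<in> {c..T} - N" for s
    unfolding k_def using that c x by (intro DERIV_ux[OF _ good]) (auto simp: N_def)
  note dom = has_real_derivative_integral_dominated[OF _ int N lip der]
  from dom(1) have "((\<lambda>x. integral {c..T} (ux x)) has_real_derivative integral {c..T} k) (at x within {0..})"
    using x by auto
  then show "((\<lambda>x. p x c) has_real_derivative q x T + integral {c..T} k) (at x within {0..})"
    unfolding p_def q_T by (intro DERIV_add DERIV_g') auto
  show "k integrable_on {c..T}"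
  proof (rule dom(2))
    show "x islimpt {0..}"
    proof -
      have "x islimpt {x<..}" by (rule islimpt_greaterThanLessThan1[of x "x + 1", THEN islimpt_subset]) auto
      then show ?thesis by (rule islimpt_subset) (use x in auto)
    qed
  qed (use x in auto)
qed

lemma DERIV_p_left:
  assumes c: "c \<in> {0..T}" and good: "\<And>s. s \<in> {c<..T} \<Longrightarrow> good s (\<beta> s)"
    and x: "x \<ge> 0" and left: "\<And>s. s \<in> {c<..T} \<Longrightarrow> x < \<beta> s"
  shows "((\<lambda>x. p x c) has_real_derivative q x c) (at x within {0..})"
proof -
  have "integral {c..T} (\<lambda>s. if x < \<beta> s then w x s else 0) = integral {c..T} (w x)"
    by (rule integral_spike[of "{c}"]) (use left in auto)
  then show ?thesis
    using DERIV_p_x(1)[OF c good x] q_eq[OF x c] by simp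
qed

text \<open>Left of all boundaries at higher levels no level is cut off, so \<open>v_xx = q\<close>.
  As \<open>q\<close> was defined by the equation \<open>\<L> v + c = 0\<close>, one more
  \<open>x\<close>-derivative, with the constant \<open>c\<close> dropping out, closes the
  system.\<close>

lemma p_linear_ode:
  assumes c: "c \<in> {0..T}" and good: "\<And>s. s \<in> {c<..T} \<Longrightarrow> good s (\<beta> s)"
    and b: "0 < b" "b \<le> B" and left: "\<And>s. s \<in> {c<..T} \<Longrightarrow> b < \<beta> s"
  shows "linear_ode (kap c) (a * r) b (\<lambda>x. p x c) (\<lambda>x. q x c)"
proof
  show "0 < a * r" using a r by simp
  fix x assume x: "x \<in> {0..b}"
  show p': "((\<lambda>x. p x c) has_real_derivative q x c) (at x within {0..b})"
    by (rule DERIV_subset[OF DERIV_p_left[OF c good]]) (use x left in force)+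
  have "((\<lambda>x. v x c) has_real_derivative p x c) (at x within {0..b})"
    by (rule DERIV_subset[OF DERIV_v_x_within_B[OF c]]) (use x b in auto)
  then have "((\<lambda>x. a * r * v x c - a * c - kap c * p x c) has_real_derivative a * r * p x c - 0 - kap c * q x c)
      (at x within {0..b})"
    by (intro DERIV_diff DERIV_cmult p' DERIV_const)
  then show "((\<lambda>x. q x c) has_real_derivative a * r * p x c - kap c * q x c) (at x within {0..b})"
    by (simp only: q_def diff_0_right)
qed

text \<open>The candidate is the decreasing limit of the boundaries as \<open>s\<close> falls to
  \<open>c\<close>. \<open>G b c = 0\<close> passes to the limit by continuity, whereas
  \<open>f < 0\<close> would survive only as \<open>f \<le> 0\<close>. Strictness is recovered in
  two ways: right of \<open>b\<close> because \<open>u_x\<close> vanishes at nearby levels, at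
  \<open>b\<close> itself by the maximum principle.\<close>

lemma good_closed:
  assumes c: "0 \<le> c" "c < T" and good: "\<And>s. s \<in> {c<..T} \<Longrightarrow> good s (\<beta> s)"
  shows "\<exists>b. good c b"
proof -
  have cT: "c \<in> {0..T}" using c by auto
  obtain \<eta> where \<eta>: "0 < \<eta>" "\<eta> < B" "\<And>x s. x \<in> {0..\<eta>} \<Longrightarrow> s \<in> {0..T} \<Longrightarrow> f x s > 0"
    using f_pos_near_0 by blast
  have mono: "\<beta> s1 < \<beta> s2" if "c < s1" "s1 < s2" "s2 \<le> T" for s1 s2
  proof (rule free_boundary_strict_mono[of s1 s2])
    show "\<exists>b. good s b" if "s \<in> {s1..s2}" for s
      using good[of s] that \<open>c < s1\<close> \<open>s2 \<le> T\<close> by auto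
  qed (use that c good in auto)
  define b where "b = Inf (\<beta> ` {c<..T})"
  have \<beta>_ge: "\<eta> \<le> \<beta> s" and \<beta>_lt: "\<beta> s < B" if "s \<in> {c<..T}" for s
  proof -
    have "0 < \<beta> s" "\<beta> s < B" "f (\<beta> s) s < 0" using good[OF that] by (auto simp: good_def)
    then show "\<eta> \<le> \<beta> s" "\<beta> s < B" using \<eta>(3)[of "\<beta> s" s] that c by force+
  qed
  have bdd: "bdd_below (\<beta> ` {c<..T})" using \<beta>_ge by (auto intro!: bdd_belowI[of _ \<eta>])
  have ne: "\<beta> ` {c<..T} \<noteq> {}" using c by auto
  have b_le: "b \<le> \<beta> s" if "s \<in> {c<..T}" for s
    unfolding b_def using that by (intro cInf_lower bdd) auto
  \<comment> \<open>The level halfway between \<open>c\<close> and \<open>s\<close> has a strictly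
    smaller boundary, still at least \<open>b\<close>.\<close>
  have b_less: "b < \<beta> s" if "s \<in> {c<..T}" for s
    using b_le[of "(c + s) / 2"] mono[of "(c + s) / 2" s] that by auto
  have "\<eta> \<le> b" unfolding b_def using ne \<beta>_ge by (intro cInf_greatest) auto
  have "b < B" using b_le[of T] \<beta>_lt[of T] c by auto
  have approach: "\<exists>s1\<in>{c<..T}. \<forall>s\<in>{c<..s1}. \<beta> s < x" if "b < x" for x
  proof -
    obtain s1 where s1: "s1 \<in> {c<..T}" "\<beta> s1 < x"
      using cInf_lessD[OF ne \<open>b < x\<close>[unfolded b_def]] by blast
    have "\<beta> s < x" if "s \<in> {c<..s1}" for s
      using mono[of s s1] that s1 by (cases "s = s1") auto
    then show ?thesis using s1 by blast
  qed
  have Gb: "G b c = 0"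
  proof (rule ccontr)
    assume "G b c \<noteq> 0"
    then have "\<bar>G b c\<bar> > 0" by simp
    from jcont_uniform[OF G_cont compact_Icc compact_Icc this]
    obtain d where d: "d > 0" "\<And>x x' y y'. x \<in> {0..B} \<Longrightarrow> x' \<in> {0..B} \<Longrightarrow> y \<in> {0..T} \<Longrightarrow> y' \<in> {0..T} \<Longrightarrow>
      \<bar>x - x'\<bar> < d \<Longrightarrow> \<bar>y - y'\<bar> < d \<Longrightarrow> \<bar>G x y - G x' y'\<bar> < \<bar>G b c\<bar>" by metis
    obtain s1 where s1: "s1 \<in> {c<..T}" "\<And>s. s \<in> {c<..s1} \<Longrightarrow> \<beta> s < b + d"
      using approach[of "b + d"] d(1) by auto
    define s where "s = min s1 (c + d / 2)"
    have s: "s \<in> {c<..s1}" "s \<in> {c<..T}" "\<bar>s - c\<bar> < d" using s1(1) d(1) by (auto simp: s_def)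
    have "\<bar>\<beta> s - b\<bar> < d" using s1(2)[OF s(1)] b_le[OF s(2)] by auto
    then have "\<bar>G (\<beta> s) s - G b c\<bar> < \<bar>G b c\<bar>"
      using s c \<open>\<eta> \<le> b\<close> \<eta> \<open>b < B\<close> \<beta>_ge[OF s(2)] \<beta>_lt[OF s(2)] by (intro d(2)) auto
    moreover have "G (\<beta> s) s = 0" using good[OF s(2)] by (simp add: good_def)
    ultimately show False by simp
  qed
  \<comment> \<open>Once the boundaries have passed to the left of \<open>x\<close>, lowering the
    level no longer changes \<open>f x\<close>; its value is already negative at
    \<open>s1\<close>.\<close>
  have f_right: "f x c < 0" if x: "b < x" "x \<le> B" for x
  proof -
    obtain s1 where s1: "s1 \<in> {c<..T}" "\<And>s. s \<in> {c<..s1} \<Longrightarrow> \<beta> s < x"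
      using approach[OF x(1)] by auto
    have x': "x \<in> {0..B}" using x \<open>\<eta> \<le> b\<close> \<eta> by auto
    have "ux x s = 0" if "s \<in> {c..s1} - {c}" for s
    proof (rule good_vanish(1)[OF _ good])
      show "\<beta> s \<le> x" using s1(2)[of s] that by simp
    qed (use that s1(1) c in auto)
    then have "integral {c..s1} (ux x) = integral {c..s1} (\<lambda>_. 0)"
      by (intro integral_spike[of "{c}"]) auto
    moreover have "integral {c..T} (ux x) = integral {c..s1} (ux x) + integral {s1..T} (ux x)"
      using s1 c x' by (intro Henstock_Kurzweil_Integration.integral_combine[symmetric] integrable_continuous_real
          continuous_on_subset[OF jcont_slice1[OF ux_cont]]) auto
    ultimately have "p x c = p x s1" by (simp add: p_def)
    then have "f x c = f x s1" using f_p[OF x', of c] f_p[OF x', of s1] s1 c by auto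
    then show ?thesis
      using good[OF s1(1)] s1(2)[of s1] s1(1) x by (auto simp: good_def)
  qed
  have b0: "0 < b" using \<open>\<eta> \<le> b\<close> \<eta> by simp
  interpret ode: linear_ode "kap c" "a * r" b "\<lambda>x. p x c" "\<lambda>x. q x c"
    by (rule p_linear_ode[OF cT good b0 _ b_less]) (use \<open>b < B\<close> in auto)
  have bB: "b \<in> {0..B}" using b0 \<open>b < B\<close> by auto
  have p': "((\<lambda>x. p x c) has_real_derivative q b c) (at b within {0..})"
    by (rule DERIV_p_left[OF cT good _ b_less]) (use b0 in auto)
  have fb: "f b c < 0"
  proof (rule ccontr)
    assume fb: "\<not> f b c < 0"
    have pb: "p b c \<ge> 1" using fb f_p[OF bB cT] by simp
    \<comment> \<open>A positive slope at \<open>b\<close> would push \<open>p\<close> above 1 just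
      to the right, against \<open>f_right\<close>. The derivative from \<open>DERIV_p_left\<close>
      is valid on both sides of \<open>b\<close>.\<close>
    have "q b c \<le> 0"
    proof (rule ccontr)
      assume "\<not> q b c \<le> 0"
      then obtain d where d: "d > 0" "\<And>h. 0 < h \<Longrightarrow> b + h \<in> {0..} \<Longrightarrow> h < d \<Longrightarrow> p b c < p (b + h) c"
        using has_real_derivative_pos_inc_right[OF p'] by auto
      define h where "h = min (d / 2) (B - b)"
      have h: "0 < h" "h < d" "b + h \<le> B" using d(1) \<open>b < B\<close> by (auto simp: h_def)
      then have "p b c < p (b + h) c" using d(2)[of h] b0 by auto
      moreover have "f (b + h) c < 0" using f_right[of "b + h"] h by auto
      ultimately show False using pb f_p[of "b + h" c] h b0 cT by auto
    qed
    have f_nonneg: "f x c \<ge> 0" if "0 \<le> x" "x \<le> b" for x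
      using ode.ge_terminal[of b x] that b0 pb \<open>q b c \<le> 0\<close> f_p[of x c] cT \<open>b < B\<close> by auto
    \<comment> \<open>\<open>f \<ge> 0\<close> on \<open>[0,b]\<close> alone is compatible with
      \<open>G b c = 0\<close>; strict positivity near 0 is what excludes it.\<close>
    have "G 0 c < G \<eta> c" using \<eta> cT by (intro G_strict_mono(1)) auto
    moreover have "G \<eta> c \<le> G b c"
    proof (rule DERIV_nonneg_imp_increasing_open[OF \<open>\<eta> \<le> b\<close>])
      show "\<exists>l. ((\<lambda>x. G x c) has_real_derivative l) (at t) \<and> 0 \<le> l" if "\<eta> < t" "t < b" for t
      proof -
        have t: "t \<in> {0..B}" "at t within {0..B} = at t"
          using that \<eta> \<open>b < B\<close> by (auto intro: at_within_Icc_at)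
        have "0 \<le> psi c t * f t c" using psi_pos[of t c] f_nonneg[of t] that \<eta> by (intro mult_nonneg_nonneg) auto
        then show ?thesis using DERIV_G_x[OF cT t(1)] t(2) by auto
      qed
      show "continuous_on {\<eta>..b} (\<lambda>x. G x c)"
        using \<eta> \<open>b < B\<close> by (intro continuous_on_subset[OF jcont_slice2[OF G_cont cT]]) auto
    qed
    ultimately show False using Gb by simp
  qed
  have "good c b"
  proof (rule goodI[OF cT b0 \<open>b < B\<close> Gb])
    show "f x c < 0" if "x \<in> {b..B}" for x
      using fb f_right[of x] that by (cases "x = b") auto
    \<comment> \<open>With \<open>p y c \<le> 1\<close> and \<open>p b c < 1\<close> the maximum
      principle on \<open>[y,b]\<close> bounds \<open>p z c\<close> by 1.\<close>
    show "f z c \<le> 0" if "0 \<le> y" "y \<le> z" "z \<le> b" "f y c \<le> 0" for y z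
      using ode.maximum_principle[of y z b] that fb f_p[of y c] f_p[of z c] f_p[OF bB cT] cT \<open>b < B\<close> by auto
  qed
  then show ?thesis by blast
qed

text \<open>\<open>A\<close> collects levels above which nothing fails, since the closure step needs
  all higher levels to be good. The infimum of \<open>A\<close> is good by closedness, and openness
  forces it to be 0.\<close>

lemma good_everywhere:
  assumes "c \<in> {0..T}"
  shows "\<exists>b. good c b"
proof -
  define A where "A = {c \<in> {0..T}. \<forall>s\<in>{c..T}. \<exists>b. good s b}"
  define m where "m = Inf A"
  have "T \<in> A" using good_terminal T by (simp add: A_def)
  have bdd: "bdd_below A" by (auto simp: A_def intro!: bdd_belowI[of _ 0])
  have "m \<le> T" unfolding m_def using \<open>T \<in> A\<close> bdd by (rule cInf_lower)
  have "0 \<le> m" unfolding m_def 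
  proof (rule cInf_greatest)
    show "A \<noteq> {}" using \<open>T \<in> A\<close> by blast
  qed (auto simp: A_def)
  have right: "\<exists>b. good s b" if "m < s" "s \<le> T" for s
  proof -
    have "A \<noteq> {}" "Inf A < s" using that \<open>T \<in> A\<close> by (auto simp: m_def)
    from cInf_lessD[OF this] obtain c where "c \<in> A" "c < s" by blast
    then show ?thesis using that by (auto simp: A_def)
  qed
  then have "\<forall>s\<in>{m<..T}. \<exists>b. good s b" by auto
  from bchoice[OF this] obtain \<beta> where \<beta>: "\<And>s. s \<in> {m<..T} \<Longrightarrow> good s (\<beta> s)" by blast
  have good_m: "\<exists>b. good m b"
    using good_closed[OF \<open>0 \<le> m\<close> _ \<beta>] good_terminal \<open>m \<le> T\<close> by (cases "m = T") auto
  have "m = 0"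
  proof (rule ccontr)
    assume "m \<noteq> 0"
    obtain d where d: "d > 0" "\<And>s. s \<in> {0..T} \<Longrightarrow> \<bar>s - m\<bar> < d \<Longrightarrow> \<exists>b. good s b"
      using good_m good_open[of m] \<open>0 \<le> m\<close> \<open>m \<le> T\<close> by (metis atLeastAtMost_iff)
    define c where "c = max 0 (m - d / 2)"
    have c: "0 \<le> c" "c < m" "m - d < c" using d(1) \<open>m \<noteq> 0\<close> \<open>0 \<le> m\<close> by (auto simp: c_def)
    have "\<exists>b. good s b" if "s \<in> {c..T}" for s
      using d(2)[of s] right[of s] that c by (cases "m < s") auto
    then have "c \<in> A" using c \<open>m \<le> T\<close> by (auto simp: A_def)
    then show False using cInf_lower[OF _ bdd] c unfolding m_def by force
  qed
  then show ?thesis using right[of c] good_m assms by (cases "c = 0") auto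
qed

subsection \<open>Estimates\<close>

definition \<beta> where "\<beta> c = (SOME b. good c b)"

lemma good_\<beta>: "c \<in> {0..T} \<Longrightarrow> good c (\<beta> c)"
  unfolding \<beta>_def using good_everywhere by (rule someI_ex)

lemma \<beta>_bounds: "c \<in> {0..T} \<Longrightarrow> 0 < \<beta> c" "c \<in> {0..T} \<Longrightarrow> \<beta> c < B"
  using good_b good_\<beta> by blast+

lemma \<beta>_mono: "0 \<le> c1 \<Longrightarrow> c1 < c2 \<Longrightarrow> c2 \<le> T \<Longrightarrow> \<beta> c1 < \<beta> c2"
  by (rule free_boundary_strict_mono[of c1 c2]) (simp_all add: good_\<beta> good_everywhere)

lemma vanish: "c \<in> {0..T} \<Longrightarrow> \<beta> c \<le> x \<Longrightarrow> ux x c = 0" "c \<in> {0..T} \<Longrightarrow> \<beta> c \<le> x \<Longrightarrow> u x c = 0"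
  using good_vanish good_\<beta> by blast+

lemma u_pos_imp_left: "c \<in> {0..T} \<Longrightarrow> x \<ge> 0 \<Longrightarrow> 0 < u x c \<Longrightarrow> x < \<beta> c"
  using vanish(2)[of c x] by force

lemma p_right: "x \<ge> B \<Longrightarrow> c \<in> {0..T} \<Longrightarrow> p x c = g' x"
  and v_right: "x \<ge> B \<Longrightarrow> c \<in> {0..T} \<Longrightarrow> v x c = g x"
proof -
  assume x: "x \<ge> B" and c: "c \<in> {0..T}"
  have "\<beta> s \<le> x" "s \<in> {0..T}" if "s \<in> {c..T}" for s using \<beta>_bounds(2)[of s] x c that by auto
  then have "integral {c..T} (ux x) = integral {c..T} (\<lambda>_. 0)" "integral {c..T} (u x) = integral {c..T} (\<lambda>_. 0)"
    by (intro Henstock_Kurzweil_Integration.integral_cong vanish; blast)+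
  then show "p x c = g' x" "v x c = g x" by (simp_all add: p_def v_def)
qed

lemma p_lt_1: 
  assumes c: "c \<in> {0..T}" and x: "\<beta> c \<le> x"
  shows "p x c < 1"
proof (cases "x \<le> B")
  case True
  then have "f x c < 0" using good_\<beta>[OF c] x by (auto simp: good_def)
  then show ?thesis using True f_p[of x c] \<beta>_bounds[OF c] c x by auto
next
  case False
  then show ?thesis using p_right[of x c] g'_strict_decreasing[of B x] B c by simp
qed

lemma DERIV_v_x:
  assumes c: "c \<in> {0..T}" and x: "x \<ge> 0"
  shows "((\<lambda>x. v x c) has_real_derivative p x c) (at x within {0..})"
proof -
  have "((\<lambda>x. integral (cbox c T) (\<lambda>s. u x s)) has_real_derivative integral (cbox c T) (\<lambda>s. ux x s)) (at x within {0..})"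
  proof (rule leibniz_rule_field_derivative[where U = "{0..}"])
    show "((\<lambda>x. u x s) has_real_derivative ux y s) (at y within {0..})" if "y \<in> {0..}" "s \<in> cbox c T" for y s
      using that c by (intro DERIV_u[OF _ good_\<beta>]) auto
    show "(\<lambda>s. u y s) integrable_on cbox c T" if "y \<in> {0..}" for y
      using that c by (intro integrable_continuous continuous_on_subset[OF jcont_slice1[OF u_cont]]) auto
    show "continuous_on ({0..} \<times> cbox c T) (\<lambda>(x, s). ux x s)"
      unfolding case_prod_unfold by (rule continuous_on_subset[OF ux_cont]) (use c in auto)
  qed (use x in auto)
  then show ?thesis
    unfolding v_def p_def by (auto intro!: derivative_eq_intros DERIV_g)
qed

text \<open>This is \<open>v_xx\<close>: levels \<open>s\<close> with
  \<open>\<beta> s \<le> x\<close> contribute nothing because \<open>u\<close> vanishes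
  there.\<close>

definition px where "px x c = q x T + integral {c..T} (\<lambda>s. if x < \<beta> s then w x s else 0)"

lemma DERIV_p:
  assumes "c \<in> {0..T}" "x \<ge> 0"
  shows "((\<lambda>x. p x c) has_real_derivative px x c) (at x within {0..})"
  unfolding px_def by (rule DERIV_p_x(1)[OF assms(1) good_\<beta> assms(2)]) (use assms in auto)

lemma px_left:
  assumes c: "c \<in> {0..T}" and x: "0 \<le> x" "x \<le> \<beta> c"
  shows "px x c = q x c"
proof -
  have "x < \<beta> s" if "s \<in> {c<..T}" for s using \<beta>_mono[of c s] that c x by auto
  then have "integral {c..T} (\<lambda>s. if x < \<beta> s then w x s else 0) = integral {c..T} (w x)"
    by (intro integral_spike[of "{c}"]) auto
  then show ?thesis using q_eq[OF x(1) c] by (simp add: px_def)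
qed

text \<open>\<open>q - px\<close> integrates \<open>w\<close> over the levels whose boundary lies at
  or left of \<open>x\<close>. There \<open>u = u_x = 0\<close> and \<open>v_x < 1\<close>, so
  \<open>w = a (1 - v_x) \<ge> 0\<close>. This is the inequality in (H), up to the factor
  \<open>a\<close>.\<close>

lemma px_le:
  assumes c: "c \<in> {0..T}" and x: "0 \<le> x"
  shows "px x c \<le> q x c"
proof -
  have "integral {c..T} (\<lambda>s. if x < \<beta> s then w x s else 0) \<le> integral {c..T} (w x)"
  proof (rule integral_le)
    show "(\<lambda>s. if x < \<beta> s then w x s else 0) integrable_on {c..T}"
      by (rule DERIV_p_x(2)[OF c good_\<beta> x]) (use c in auto)
    show "w x integrable_on {c..T}"
      using c x by (intro integrable_continuous_real continuous_on_subset[OF jcont_slice1[OF w_cont]]) auto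
    show "(if x < \<beta> s then w x s else 0) \<le> w x s" if "s \<in> {c..T}" for s
    proof (cases "x < \<beta> s")
      case False
      have s: "s \<in> {0..T}" using that c by auto
      have "0 \<le> a * (1 - p x s)" using a p_lt_1[OF s, of x] False by simp
      then show ?thesis using False vanish[OF s, of x] by (simp add: w_def algebra_simps)
    qed simp
  qed
  then show ?thesis using q_eq[OF x c] by (simp add: px_def)
qed

lemma ode_p:
  assumes c: "c \<in> {0..T}"
  shows "linear_ode (kap c) (a * r) (\<beta> c) (\<lambda>x. p x c) (\<lambda>x. q x c)"
proof (rule p_linear_ode[OF c, of \<beta>])
  show "\<beta> c < \<beta> s" if "s \<in> {c<..T}" for s using \<beta>_mono[of c s] that c by auto
qed (use good_\<beta> c \<beta>_bounds[OF c] in auto)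

lemma p_0_pos: "c \<in> {0..T} \<Longrightarrow> p 0 c > 1"
  using f_0[of c] g'_0 f_p[of 0 c] B by auto

text \<open>A negative value forces a negative slope, so \<open>p\<close> is still smaller slightly
  further right. There is room for this because \<open>\<beta> c < B\<close>.\<close>

lemma no_negative_minimum_left:
  assumes c: "c \<in> {0..T}" and x: "0 \<le> x" "x \<le> \<beta> c" and neg: "p x c < 0"
    and min: "\<And>y. y \<in> {0..B} \<Longrightarrow> p x c \<le> p y c"
  shows False
proof -
  interpret linear_ode "kap c" "a * r" "\<beta> c" "\<lambda>x. p x c" "\<lambda>x. q x c" by (rule ode_p[OF c])
  have "q x c < 0" using slope_at_negative[of x] x neg p_0_pos[OF c] by simp
  moreover have "((\<lambda>x. p x c) has_real_derivative q x c) (at x within {0..})"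
    using DERIV_p[OF c x(1)] px_left[OF c x] by simp
  ultimately obtain d where d: "d > 0" "\<And>h. 0 < h \<Longrightarrow> x + h \<in> {0..} \<Longrightarrow> h < d \<Longrightarrow> p (x + h) c < p x c"
    using has_real_derivative_neg_dec_right by metis
  define h where "h = min (d / 2) (B - x)"
  have "0 < h" "h < d" "x + h \<le> B" using d(1) x \<beta>_bounds(2)[OF c] by (auto simp: h_def)
  then show False using d(2)[of h] min[of "x + h"] x by auto
qed

text \<open>A negative minimum of \<open>p\<close> over the whole rectangle would be attained on \<open>x \<le> \<beta> c\<close> for some
  \<open>c\<close>, because to the right of the free boundary \<open>p\<close> does not depend on \<open>c\<close>.\<close>

lemma p_nonneg:
  assumes "c \<in> {0..T}" "x \<ge> 0"
  shows "p x c \<ge> 0"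
proof (rule ccontr)
  assume neg: "\<not> 0 \<le> p x c"
  then have "x < B" using p_right[of x c] g'_pos[of x] assms by force
  have "continuous_on ({0..B} \<times> {0..T}) (\<lambda>z. p (fst z) (snd z))"
    by (rule continuous_on_subset[OF p_cont]) auto
  then obtain z where z: "z \<in> {0..B} \<times> {0..T}" "\<And>z'. z' \<in> {0..B} \<times> {0..T} \<Longrightarrow> p (fst z) (snd z) \<le> p (fst z') (snd z')"
    using continuous_attains_inf[OF compact_Times[OF compact_Icc compact_Icc], of 0 B 0 T] assms B by force
  define y c1 where "y = fst z" and "c1 = snd z"
  have y: "y \<in> {0..B}" and c1: "c1 \<in> {0..T}" using z(1) by (auto simp: y_def c1_def)
  have min: "p y c1 \<le> p y' c'" if "y' \<in> {0..B}" "c' \<in> {0..T}" for y' c'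
    using z(2)[of "(y', c')"] that by (simp add: y_def c1_def)
  have py: "p y c1 < 0" using min[of x c] neg assms \<open>x < B\<close> by auto
  show False
  proof (cases "y \<le> \<beta> c1")
    case True
    then show False using no_negative_minimum_left[OF c1 _ True py] min c1 y by auto
  next
    case False
    \<comment> \<open>At fixed \<open>y\<close> the level is raised as long as the boundary stays
      left of \<open>y\<close>; \<open>p y\<close> keeps its minimal value on the way. The claim is
      that at \<open>c2\<close> the boundary has reached \<open>y\<close>.\<close>
    define E where "E = {s \<in> {c1..T}. \<beta> s \<le> y}"
    define c2 where "c2 = Sup E"
    have E: "c1 \<in> E" "bdd_above E" using False c1 by (auto simp: E_def intro!: bdd_aboveI[of _ T])
    have c1c2: "c1 \<le> c2" unfolding c2_def by (rule cSup_upper[OF E])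
    have "c2 \<le> T" unfolding c2_def
    proof (rule cSup_least)
      show "E \<noteq> {}" using E(1) by blast
    qed (auto simp: E_def)
    have c2: "c2 \<in> {0..T}" using c1 c1c2 \<open>c2 \<le> T\<close> by auto
    have left: "\<beta> s \<le> y" if s: "c1 \<le> s" "s < c2" for s
    proof -
      have "E \<noteq> {}" "s < Sup E" using E(1) s(2) by (auto simp: c2_def)
      from less_cSupD[OF this] obtain t where t: "t \<in> E" "s < t" by blast
      then show ?thesis using \<beta>_mono[of s t] c1 s by (auto simp: E_def)
    qed
    have "ux y s = 0" if "s \<in> {c1..c2} - {c2}" for s
      using that left[of s] c1 \<open>c2 \<le> T\<close> by (intro vanish(1)) auto
    then have "integral {c1..c2} (ux y) = integral {c1..c2} (\<lambda>_. 0)"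
      by (intro integral_spike[of "{c2}"]) auto
    moreover have "integral {c1..T} (ux y) = integral {c1..c2} (ux y) + integral {c2..T} (ux y)"
      using c1 c1c2 \<open>c2 \<le> T\<close> y
      by (intro Henstock_Kurzweil_Integration.integral_combine[symmetric] integrable_continuous_real
          continuous_on_subset[OF jcont_slice1[OF ux_cont]]) auto
    ultimately have eq: "p y c2 = p y c1" by (simp add: p_def)
    \<comment> \<open>Otherwise \<open>G y c2 < 0\<close>, and by continuity the boundary remains
      left of \<open>y\<close> at slightly higher levels. Such levels exist, since at
      \<open>T\<close> the value \<open>p y T = g' y\<close> is positive.\<close>
    have "y \<le> \<beta> c2"
    proof (rule ccontr)
      assume "\<not> y \<le> \<beta> c2"
      then have gt: "\<beta> c2 < y" by simp
      have "c2 \<noteq> T" using eq py g'_pos[of y] by (auto simp: p_def)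
      have Gy: "- G y c2 > 0" using good_G_neg[OF c2 good_\<beta>[OF c2] gt] y by auto
      from jcont_uniform[OF G_cont compact_Icc compact_Icc Gy]
      obtain d where d: "d > 0" "\<And>x x' y' y''. x \<in> {0..B} \<Longrightarrow> x' \<in> {0..B} \<Longrightarrow> y' \<in> {0..T} \<Longrightarrow> y'' \<in> {0..T} \<Longrightarrow>
        \<bar>x - x'\<bar> < d \<Longrightarrow> \<bar>y' - y''\<bar> < d \<Longrightarrow> \<bar>G x y' - G x' y''\<bar> < - G y c2" by metis
      define s where "s = min T (c2 + d / 2)"
      have s: "c2 < s" "s \<in> {0..T}" "\<bar>s - c2\<bar> < d"
        using d(1) c2 \<open>c2 \<noteq> T\<close> by (auto simp: s_def)
      have "G y s < 0" using d(2)[of y y s c2] s c2 y d(1) by auto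
      then have "\<beta> s \<le> y"
        using good_G_le_0[OF s(2) good_\<beta>[OF s(2)], of y] y gt \<beta>_bounds(1)[OF c2] by auto
      then have "s \<in> E" using s c1c2 by (auto simp: E_def)
      then have "s \<le> c2" unfolding c2_def using E(2) by (rule cSup_upper)
      then show False using s(1) by simp
    qed
    then show False
      using no_negative_minimum_left[OF c2, of y] eq py min c2 y by auto
  qed
qed

text \<open>The upper bound follows from monotonicity: \<open>v_x \<ge> 0\<close>, and beyond
  \<open>B\<close> the function coincides with \<open>g\<close>.\<close>

lemma v_bounds:
  assumes c: "c \<in> {0..T}" and x: "x \<ge> 0"
  shows "0 \<le> v x c" "v x c \<le> T / r"
proof -
  have "0 \<le> integral {c..T} (u x)"
    using c x u_nonneg
    by (intro Henstock_Kurzweil_Integration.integral_nonneg integrable_continuous_real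
        continuous_on_subset[OF jcont_slice1[OF u_cont]]) auto
  then show "0 \<le> v x c" using g_bounds(1)[OF x] by (simp add: v_def)
  have "v x c \<le> v (max x B) c"
  proof (rule DERIV_nonneg_imp_increasing_open[where f = "\<lambda>x. v x c"])
    show "\<exists>l. ((\<lambda>x. v x c) has_real_derivative l) (at z) \<and> 0 \<le> l" if "x < z" "z < max x B" for z
    proof -
      have "at z within {0..} = at z" using that x by (intro at_within_interior) auto
      then show ?thesis using DERIV_v_x[OF c, of z] p_nonneg[OF c, of z] that x by auto
    qed
    show "continuous_on {x..max x B} (\<lambda>x. v x c)"
      using x by (intro continuous_on_subset[OF jcont_slice2[OF v_cont c]]) auto
  qed simp
  also have "\<dots> \<le> T / r" using v_right[of "max x B" c] g_bounds(2)[of "max x B"] c by simp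
  finally show "v x c \<le> T / r" .
qed

text \<open>The 1 in the bound is the value of \<open>v_x\<close> that the free boundary cannot
  reach: the maximum principle is applied up to \<open>\<beta> c\<close>, where
  \<open>p < 1\<close>, and \<open>p < 1\<close> persists beyond.\<close>

lemma p_le_max:
  assumes c: "c \<in> {0..T}" and x: "0 \<le> x" "x \<le> y"
  shows "p y c \<le> max (p x c) 1"
proof (cases "y \<le> \<beta> c")
  case True
  interpret linear_ode "kap c" "a * r" "\<beta> c" "\<lambda>x. p x c" "\<lambda>x. q x c" by (rule ode_p[OF c])
  show ?thesis
    using maximum_principle[of x y "\<beta> c"] True x p_lt_1[OF c, of "\<beta> c"] by auto
next
  case False
  then show ?thesis using p_lt_1[OF c, of y] by auto
qed

lemma global_bound:
  obtains K where "K > 0" "\<And>x c. x \<ge> 0 \<Longrightarrow> c \<in> {0..T} \<Longrightarrow> \<bar>u x c\<bar> \<le> K \<and> \<bar>ux x c\<bar> \<le> K \<and> \<bar>p x c\<bar> \<le> K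
    \<and> \<bar>v x c\<bar> \<le> K \<and> \<bar>w x c\<bar> \<le> K \<and> \<bar>q x c\<bar> \<le> K"
proof -
  have sub: "{0..B} \<times> {0..T} \<subseteq> {0..} \<times> {0..T}" by auto
  obtain Mu where Mu: "Mu > 0" "\<And>x c. x \<in> {0..B} \<Longrightarrow> c \<in> {0..T} \<Longrightarrow> \<bar>u x c\<bar> \<le> Mu"
    using jcont_bounded[OF continuous_on_subset[OF u_cont sub] compact_Icc compact_Icc] by blast
  obtain Mx where Mx: "Mx > 0" "\<And>x c. x \<in> {0..B} \<Longrightarrow> c \<in> {0..T} \<Longrightarrow> \<bar>ux x c\<bar> \<le> Mx"
    using jcont_bounded[OF continuous_on_subset[OF ux_cont sub] compact_Icc compact_Icc] by blast
  have u: "\<bar>u x c\<bar> \<le> Mu" and ux: "\<bar>ux x c\<bar> \<le> Mx" if "x \<ge> 0" "c \<in> {0..T}" for x c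
    using Mu(2)[of "min x B" c] Mx(2)[of "min x B" c] that B by (auto simp: u_def ux_def)
  have p: "\<bar>p x c\<bar> \<le> g' 0 + Mx * T" if "x \<ge> 0" "c \<in> {0..T}" for x c
  proof -
    have "norm (integral {c..T} (ux x)) \<le> Mx * (T - c)"
      using that ux by (intro integral_bound continuous_on_subset[OF jcont_slice1[OF ux_cont]]) auto
    also have "\<dots> \<le> Mx * T" using that Mx(1) by (intro mult_left_mono) auto
    finally have "\<bar>integral {c..T} (ux x)\<bar> \<le> Mx * T" by simp
    moreover have "0 < g' x" "g' x \<le> g' 0" using g'_pos[of x] g'_strict_decreasing[of 0 x] that by (cases "x = 0"; simp)+
    ultimately show ?thesis by (simp add: p_def)
  qed
  define Mp where "Mp = g' 0 + Mx * T"
  define K where "K = Mu + Mx + Mp + T / r + (a * r * Mu + a * (Mp + 1) + a * \<mu> * Mx) + (a * r * (T / r) + a * T + a * \<mu> * Mp)"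
  have pos: "0 \<le> Mp" "0 \<le> a * r * Mu" "0 \<le> a * (Mp + 1)" "0 \<le> a * \<mu> * Mx" "0 \<le> a * r * (T / r)" "0 \<le> a * T" "0 \<le> a * \<mu> * Mp" "0 \<le> T / r"
    using a r T Mu(1) Mx(1) g'_pos[of 0] by (auto simp: Mp_def intro!: mult_nonneg_nonneg add_nonneg_nonneg)
  show thesis
  proof (rule that[of K])
    show "K > 0" using pos Mu(1) Mx(1) by (simp add: K_def)
    fix x c :: real assume x: "x \<ge> 0" and c: "c \<in> {0..T}"
    have px: "\<bar>p x c\<bar> \<le> Mp" using p[OF x c] by (simp add: Mp_def)
    have vx: "\<bar>v x c\<bar> \<le> T / r" using v_bounds[OF c x] by auto
    have kap: "0 \<le> kap c" "kap c \<le> a * \<mu>" using kap_nonneg[of c] c a by (auto simp: kap_def)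
    have 1: "\<bar>a * r * u x c\<bar> \<le> a * r * Mu" using u[OF x c] a r by (simp add: abs_mult)
    have 2: "\<bar>a * (p x c - 1)\<bar> \<le> a * (Mp + 1)" using px a unfolding abs_mult by (intro mult_mono) auto
    have 3: "\<bar>kap c * ux x c\<bar> \<le> a * \<mu> * Mx" using ux[OF x c] kap a T unfolding abs_mult by (intro mult_mono) auto
    have 4: "\<bar>a * r * v x c\<bar> \<le> a * r * (T / r)" using vx a r unfolding abs_mult by (intro mult_mono) auto
    have 5: "\<bar>a * c\<bar> \<le> a * T" using a c by (simp add: abs_mult)
    have 6: "\<bar>kap c * p x c\<bar> \<le> a * \<mu> * Mp" using px kap a T unfolding abs_mult by (intro mult_mono) auto
    have "\<bar>w x c\<bar> \<le> K" using 1 2 3 pos Mu(1) Mx(1) unfolding w_def K_def by linarith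
    moreover have "\<bar>q x c\<bar> \<le> K" using 4 5 6 pos Mu(1) Mx(1) unfolding q_def K_def by linarith
    moreover have "\<bar>u x c\<bar> \<le> K" "\<bar>ux x c\<bar> \<le> K" "\<bar>p x c\<bar> \<le> K" "\<bar>v x c\<bar> \<le> K"
      using u[OF x c] ux[OF x c] px vx pos Mu(1) Mx(1) unfolding K_def by linarith+
    ultimately show "\<bar>u x c\<bar> \<le> K \<and> \<bar>ux x c\<bar> \<le> K \<and> \<bar>p x c\<bar> \<le> K \<and> \<bar>v x c\<bar> \<le> K \<and> \<bar>w x c\<bar> \<le> K \<and> \<bar>q x c\<bar> \<le> K"
      by blast
  qed
qed

lemma px_bound:
  assumes K: "K > 0" "\<And>x c. x \<ge> 0 \<Longrightarrow> c \<in> {0..T} \<Longrightarrow> \<bar>w x c\<bar> \<le> K \<and> \<bar>q x c\<bar> \<le> K" and c: "c \<in> {0..T}" and x: "x \<ge> 0"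
  shows "\<bar>px x c\<bar> \<le> K + T * K"
proof -
  have "norm (integral {c..T} (\<lambda>s. if x < \<beta> s then w x s else 0)) \<le> integral {c..T} (\<lambda>s. K)"
  proof (rule integral_norm_bound_integral)
    show "(\<lambda>s. if x < \<beta> s then w x s else 0) integrable_on {c..T}"
      by (rule DERIV_p_x(2)[OF c good_\<beta> x]) (use c in auto)
  qed (use K c x in auto)
  also have "\<dots> = (T - c) * K" using c by simp
  also have "\<dots> \<le> T * K" using c K(1) by (intro mult_right_mono) auto
  finally have "\<bar>integral {c..T} (\<lambda>s. if x < \<beta> s then w x s else 0)\<bar> \<le> T * K" by simp
  moreover have "\<bar>q x T\<bar> \<le> K" using K(2)[OF x, of T] T by auto
  ultimately show ?thesis unfolding px_def by linarith
qed

text \<open>No regularity of the free boundary in \<open>c\<close> is required. The positive part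
  under the integral fails to be differentiable in \<open>c\<close> only at
  \<open>z = \<beta> c\<close>, since \<open>Q\<close> has no other zero. That is a null set, and a
  common Lipschitz constant dominates.\<close>

lemma u_c_differentiable:
  obtains K u_c where "K > 0" "\<And>x c. x \<ge> 0 \<Longrightarrow> c \<in> {0..T} \<Longrightarrow> (u x has_real_derivative u_c x c) (at c within {0..T}) \<and> \<bar>u_c x c\<bar> \<le> K"
proof -
  define f_c where "f_c x c = - ux x c" for x c
  have f_c: "jcont {0..B} {0..T} f_c"
    unfolding f_c_def by (intro continuous_intros continuous_on_subset[OF ux_cont]) auto
  have der_f: "(f x has_real_derivative f_c x c) (at c within {0..T})" if "x \<in> {0..B}" "c \<in> {0..T}" for x c
  proof -
    have "((\<lambda>c. p x c - 1) has_real_derivative f_c x c) (at c within {0..T})"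
      using DERIV_p_c[of x c] that by (auto intro!: derivative_eq_intros simp: f_c_def)
    then show ?thesis
      by (rule has_field_derivative_transform_within[OF _ zero_less_one that(2)]) (use f_p[OF that(1)] in simp)
  qed
  define H where "H c z = exp (kap c * z) * Q f z c" for c z
  define h where "h c z = exp (kap c * z) * dQ f f_c z c - a * z * exp (kap c * z) * Q f z c" for c z
  have H': "((\<lambda>c. H c z) has_real_derivative h c z) (at c within {0..T})" if "z \<in> {0..B}" "c \<in> {0..T}" for z c
  proof -
    have "((\<lambda>c. exp (kap c * z)) has_real_derivative exp (kap c * z) * (- a * z)) (at c within {0..T})"
      by (auto intro!: derivative_eq_intros DERIV_kap)
    from DERIV_mult'[OF this DERIV_Q_c[OF f_cont f_c der_f that]]
    show ?thesis by (simp add: H_def h_def algebra_simps)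
  qed
  have h_cont: "jcont {0..B} {0..T} (\<lambda>z c. h c z)"
    unfolding h_def by (intro continuous_intros dQ_cont[OF f_cont f_c] Q_cont[OF f_cont])
  obtain Mh where Mh: "Mh > 0" "\<And>z c. z \<in> {0..B} \<Longrightarrow> c \<in> {0..T} \<Longrightarrow> \<bar>h c z\<bar> \<le> Mh"
    using jcont_bounded[OF h_cont compact_Icc compact_Icc] by blast
  have I_H: "I B f x c = integral {x..B} (\<lambda>z. max 0 (H c z))" for x c
    unfolding I_def H_def by (intro arg_cong[where f = "integral _"] ext) (simp add: max_mult_distrib_left)
  define k where "k c z = (if z < \<beta> c then h c z else 0)" for c z
  have int: "(\<lambda>z. max 0 (H c z)) integrable_on {x..B}" if "x \<in> {0..B}" "c \<in> {0..T}" for x c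
  proof -
    have H_cont: "jcont {0..B} {0..T} (\<lambda>z c. max 0 (H c z))"
      unfolding H_def by (intro continuous_intros continuous_on_max Q_cont[OF f_cont])
    show ?thesis
      using that by (intro integrable_continuous_real continuous_on_subset[OF jcont_slice2[OF H_cont that(2)]]) auto
  qed
  have lip: "\<bar>max 0 (H s z) - max 0 (H c z)\<bar> \<le> Mh * \<bar>s - c\<bar>" if "z \<in> {0..B}" "c \<in> {0..T}" "s \<in> {0..T}" for z c s
  proof -
    have "norm (H s z - H c z) \<le> Mh * norm (s - c)"
      by (rule field_differentiable_bound[of "{0..T}" "\<lambda>c. H c z" "\<lambda>c. h c z"]) (use H' Mh that in auto)
    then show ?thesis by auto
  qed
  have der: "((\<lambda>c. max 0 (H c z)) has_real_derivative k c z) (at c within {0..T})"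
    if z: "z \<in> {0..B}" "z \<noteq> \<beta> c" and c: "c \<in> {0..T}" for z c
  proof -
    have cont: "((\<lambda>c. H c z) \<longlongrightarrow> H c z) (at c within {0..T})"
      using DERIV_continuous[OF H'[OF z(1) c]] by (simp add: continuous_within)
    show ?thesis
    proof (cases "z < \<beta> c")
      case True
      then have "H c z > 0"
        using good_Q_left[OF c good_\<beta>[OF c], of z] good_Q_nonzero[OF c good_\<beta>[OF c] z] z by (auto simp: H_def max_def split: if_splits)
      then have "\<forall>\<^sub>F s in at c within {0..T}. H s z = max 0 (H s z)"
        using order_tendstoD(1)[OF cont, of 0] by (auto elim: eventually_mono)
      then show ?thesis
        using True \<open>H c z > 0\<close> H'[OF z(1) c] has_field_derivative_cong_eventually[of "\<lambda>s. H s z" "\<lambda>s. max 0 (H s z)" c "{0..T}"]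
        by (simp add: k_def)
    next
      case False
      then have "H c z < 0"
        using good_Q_right[OF c good_\<beta>[OF c], of z] good_Q_nonzero[OF c good_\<beta>[OF c] z] z
        by (auto simp: H_def max_def mult_less_0_iff split: if_splits)
      then have "\<forall>\<^sub>F s in at c within {0..T}. 0 = max 0 (H s z)"
        using order_tendstoD(2)[OF cont, of 0] by (auto elim: eventually_mono)
      then show ?thesis
        using False \<open>H c z < 0\<close> has_field_derivative_cong_eventually[of "\<lambda>s. 0" "\<lambda>s. max 0 (H s z)" c "{0..T}" 0]
        by (simp add: k_def)
    qed
  qed
  have I': "((\<lambda>c. I B f x c) has_real_derivative integral {x..B} (k c)) (at c within {0..T})"
    and k_int: "k c integrable_on {x..B}" if x: "x \<in> {0..B}" and c: "c \<in> {0..T}" for x c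
  proof -
    have int': "(\<lambda>z. max 0 (H s z)) integrable_on {x..B}" if "s \<in> {0..T}" for s
      by (rule int[OF x that])
    have lip': "\<bar>max 0 (H s z) - max 0 (H c z)\<bar> \<le> Mh * \<bar>s - c\<bar>" if "s \<in> {0..T}" "z \<in> {x..B} - {\<beta> c}" for s z
      using lip[of z c s] that x c by auto
    have der': "((\<lambda>c. max 0 (H c z)) has_real_derivative k c z) (at c within {0..T})" if "z \<in> {x..B} - {\<beta> c}" for z
      using der[of z c] that x c by auto
    note dom = has_real_derivative_integral_dominated[OF c int' negligible_sing lip' der']
    show "((\<lambda>c. I B f x c) has_real_derivative integral {x..B} (k c)) (at c within {0..T})"
      unfolding I_H by (rule dom(1))
    have "c islimpt {0..T}"
      using c T by simp
    from has_real_derivative_integral_dominated(2)[where K = "\<lambda>s z. max 0 (H s z)" and k = "k c",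
        OF c int' negligible_sing lip' der' this]
    show "k c integrable_on {x..B}" .
  qed
  have I'_bound: "\<bar>integral {x..B} (k c)\<bar> \<le> B * Mh" if x: "x \<in> {0..B}" and c: "c \<in> {0..T}" for x c
  proof -
    have "norm (integral {x..B} (k c)) \<le> integral {x..B} (\<lambda>z. Mh)"
    proof (rule integral_norm_bound_integral[OF k_int[OF x c]])
      show "norm (k c z) \<le> Mh" if "z \<in> {x..B}" for z
        using Mh(2)[of z c] Mh(1) that x c by (auto simp: k_def)
    qed auto
    also have "\<dots> = (B - x) * Mh" using x by simp
    also have "\<dots> \<le> B * Mh" using x Mh(1) by (intro mult_right_mono) auto
    finally show ?thesis by simp
  qed
  have S_cont: "jcont {0..B} {0..T} (\<lambda>x c. S c x)" and dS_cont: "jcont {0..B} {0..T} (\<lambda>x c. dS c x)"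
    by (intro continuous_intros)+
  obtain Ms where Ms: "Ms > 0" "\<And>x c. x \<in> {0..B} \<Longrightarrow> c \<in> {0..T} \<Longrightarrow> \<bar>S c x\<bar> \<le> Ms"
    using jcont_bounded[OF S_cont compact_Icc compact_Icc] by blast
  obtain Md where Md: "Md > 0" "\<And>x c. x \<in> {0..B} \<Longrightarrow> c \<in> {0..T} \<Longrightarrow> \<bar>dS c x\<bar> \<le> Md"
    using jcont_bounded[OF dS_cont compact_Icc compact_Icc] by blast
  obtain Mi where Mi: "Mi > 0" "\<And>x c. x \<in> {0..B} \<Longrightarrow> c \<in> {0..T} \<Longrightarrow> \<bar>I B f x c\<bar> \<le> Mi"
    using jcont_bounded[OF I_cont[OF f_cont] compact_Icc compact_Icc] by blast
  show thesis
  proof (rule that)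
    show "0 < a * (Ms * (B * Mh) + Md * Mi)"
      using a B(1) Ms(1) Md(1) Mi(1) Mh(1) by (intro mult_pos_pos add_pos_pos)
    fix x c :: real assume "x \<ge> 0" and c: "c \<in> {0..T}"
    then have x: "min x B \<in> {0..B}" using B by auto
    have "(u x has_real_derivative a * (S c (min x B) * integral {min x B..B} (k c) + dS c (min x B) * I B f (min x B) c))
        (at c within {0..T})"
      unfolding u_def[abs_def] by (intro DERIV_cmult DERIV_mult' DERIV_S_c I' x c)
    moreover have "\<bar>S c (min x B) * integral {min x B..B} (k c)\<bar> \<le> Ms * (B * Mh)"
      unfolding abs_mult using Ms(2)[OF x c] I'_bound[OF x c] Ms(1) by (intro mult_mono) auto
    moreover have "\<bar>dS c (min x B) * I B f (min x B) c\<bar> \<le> Md * Mi"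
      unfolding abs_mult using Md(2)[OF x c] Mi(2)[OF x c] Md(1) by (intro mult_mono) auto
    then have "\<bar>S c (min x B) * integral {min x B..B} (k c) + dS c (min x B) * I B f (min x B) c\<bar> \<le> Ms * (B * Mh) + Md * Mi"
      using calculation(2) by linarith
    then have "\<bar>a * (S c (min x B) * integral {min x B..B} (k c) + dS c (min x B) * I B f (min x B) c)\<bar>
        \<le> a * (Ms * (B * Mh) + Md * Mi)"
      unfolding abs_mult using a by (intro mult_mono) auto
    ultimately show "(u x has_real_derivative a * (S c (min x B) * integral {min x B..B} (k c) + dS c (min x B) * I B f (min x B) c))
        (at c within {0..T}) \<and> \<bar>a * (S c (min x B) * integral {min x B..B} (k c) + dS c (min x B) * I B f (min x B) c)\<bar>
        \<le> a * (Ms * (B * Mh) + Md * Mi)"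
      by blast
  qed
qed

subsection \<open>The two problems\<close>

lemma nontrivial_x: "x \<ge> 0 \<Longrightarrow> at x within {0..} \<noteq> (bot :: real filter)"
  for x :: real
  using islimpt_subset[of x "{x..x + 1}" "{0..}"] by (auto simp: trivial_limit_within)

lemma Dx_eq:
  assumes "((\<lambda>y. h y c) has_real_derivative d) (at x within {0..})" "x \<ge> 0"
  shows "Dx h x c = d"
  unfolding Dx_def using assms nontrivial_x
  by (intro vector_derivative_within) (auto simp: has_real_derivative_iff_has_vector_derivative)

lemma Dc_eq:
  assumes "((\<lambda>s. h x s) has_real_derivative d) (at c within {0..T})" "c \<in> {0..T}"
  shows "Dc T h x c = d"
  unfolding Dc_def using assms T
  by (intro vector_derivative_within) (auto simp: has_real_derivative_iff_has_vector_derivative trivial_limit_within)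

lemma Dx_v: "c \<in> {0..T} \<Longrightarrow> x \<ge> 0 \<Longrightarrow> Dx v x c = p x c"
  by (intro Dx_eq DERIV_v_x)

lemma Dx_u: "c \<in> {0..T} \<Longrightarrow> x \<ge> 0 \<Longrightarrow> Dx u x c = ux x c"
  by (intro Dx_eq DERIV_u[OF _ good_\<beta>])

lemma Dc_v: "c \<in> {0..T} \<Longrightarrow> x \<ge> 0 \<Longrightarrow> Dc T v x c = - u x c"
  by (intro Dc_eq DERIV_v_c)

text \<open>The exceptional set is empty: \<open>v_x\<close> is differentiable at every
  \<open>x > 0\<close>, in contrast to \<open>u_x\<close>, whose derivative jumps at
  \<open>\<beta> c\<close>.\<close>

lemma piecewise_v:
  assumes c: "c \<in> {0..T}"
  obtains K where "piecewise_C2 (\<lambda>x. v x c) (\<lambda>x. p x c) (\<lambda>x. px x c) {} K"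
proof -
  obtain K where K: "K > 0" "\<And>x c. x \<ge> 0 \<Longrightarrow> c \<in> {0..T} \<Longrightarrow> \<bar>u x c\<bar> \<le> K \<and> \<bar>ux x c\<bar> \<le> K \<and> \<bar>p x c\<bar> \<le> K
    \<and> \<bar>v x c\<bar> \<le> K \<and> \<bar>w x c\<bar> \<le> K \<and> \<bar>q x c\<bar> \<le> K"
    using global_bound by blast
  have "0 \<le> T * K" using T K(1) by simp
  have "piecewise_C2 (\<lambda>x. v x c) (\<lambda>x. p x c) (\<lambda>x. px x c) {} (K + T * K)"
  proof
    fix x :: real assume x: "x > 0"
    have at: "at x within {0..} = at x" using x by (intro at_within_interior) auto
    show "((\<lambda>x. v x c) has_real_derivative p x c) (at x)" "((\<lambda>x. p x c) has_real_derivative px x c) (at x)"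
      using DERIV_v_x[OF c, of x] DERIV_p[OF c, of x] x by (simp_all add: at)
    show "\<bar>v x c\<bar> \<le> K + T * K" "\<bar>p x c\<bar> \<le> K + T * K" 
      using K(2)[of x c] c x \<open>0 \<le> T * K\<close> by force+
    show "\<bar>px x c\<bar> \<le> K + T * K" by (rule px_bound) (use K c x in auto)
  qed (auto intro!: continuous_on_subset[OF jcont_slice2[OF p_cont c]])
  then show thesis by (rule that)
qed

lemma piecewise_u:
  assumes c: "c \<in> {0..T}"
  obtains K where "piecewise_C2 (\<lambda>x. u x c) (\<lambda>x. ux x c) (\<lambda>x. if x < \<beta> c then w x c else 0) {\<beta> c} K"
proof -
  obtain K where K: "K > 0" "\<And>x c. x \<ge> 0 \<Longrightarrow> c \<in> {0..T} \<Longrightarrow> \<bar>u x c\<bar> \<le> K \<and> \<bar>ux x c\<bar> \<le> K \<and> \<bar>p x c\<bar> \<le> K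
    \<and> \<bar>v x c\<bar> \<le> K \<and> \<bar>w x c\<bar> \<le> K \<and> \<bar>q x c\<bar> \<le> K"
    using global_bound by blast
  have "piecewise_C2 (\<lambda>x. u x c) (\<lambda>x. ux x c) (\<lambda>x. if x < \<beta> c then w x c else 0) {\<beta> c} K"
  proof
    fix x :: real assume x: "x > 0"
    have at: "at x within {0..} = at x" using x by (intro at_within_interior) auto
    show "((\<lambda>x. u x c) has_real_derivative ux x c) (at x)"
      using DERIV_u[OF c good_\<beta>[OF c], of x] x by (simp add: at)
    show "((\<lambda>x. ux x c) has_real_derivative (if x < \<beta> c then w x c else 0)) (at x)" if "x \<notin> {\<beta> c}"
      using DERIV_ux[OF c good_\<beta>[OF c], of x] x that by (simp add: at)
    show "\<bar>u x c\<bar> \<le> K" "\<bar>ux x c\<bar> \<le> K" "\<bar>if x < \<beta> c then w x c else 0\<bar> \<le> K"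
      using K(2)[of x c] K(1) c x by auto
  qed (auto intro!: continuous_on_subset[OF jcont_slice2[OF ux_cont c]])
  then show thesis by (rule that)
qed

lemma cont_bdd:
  assumes "jcont {0..} {0..T} h" "\<And>x c. x \<ge> 0 \<Longrightarrow> c \<in> {0..T} \<Longrightarrow> h' x c = h x c \<and> \<bar>h x c\<bar> \<le> K"
  shows "cont_bdd_on_Q T h'"
proof -
  have "continuous_on (Qdom T) (\<lambda>(x, c). h' x c)"
    using assms by (subst continuous_on_cong[OF refl, of _ _ "\<lambda>p. h (fst p) (snd p)"]) (auto simp: Qdom_def)
  moreover have "bounded ((\<lambda>(x, c). h' x c) ` Qdom T)"
    using assms(2) by (intro boundedI[of _ K]) (auto simp: Qdom_def)
  ultimately show ?thesis by (simp add: cont_bdd_on_Q_def)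
qed

lemma differentiability: "x_differentiable T v" "c_differentiable T v" "x_differentiable T u" "c_differentiable T u"
proof -
  show "x_differentiable T v"
    unfolding x_differentiable_def differentiable_on_def real_differentiable_def
    by (auto intro!: exI DERIV_v_x)
  show "c_differentiable T v"
    unfolding c_differentiable_def differentiable_on_def real_differentiable_def
    using DERIV_v_c by fastforce
  show "x_differentiable T u"
    unfolding x_differentiable_def differentiable_on_def real_differentiable_def
    by (auto intro!: exI DERIV_u[OF _ good_\<beta>])
  obtain K u_c where "\<And>x c. x \<ge> 0 \<Longrightarrow> c \<in> {0..T} \<Longrightarrow> (u x has_real_derivative u_c x c) (at c within {0..T}) \<and> \<bar>u_c x c\<bar> \<le> K"
    using u_c_differentiable by metis
  then show "c_differentiable T u"
    unfolding c_differentiable_def differentiable_on_def real_differentiable_def by blast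
qed

lemma cont_bdd_all: "cont_bdd_on_Q T v" "cont_bdd_on_Q T (Dx v)" "cont_bdd_on_Q T (Dc T v)"
  "cont_bdd_on_Q T u" "cont_bdd_on_Q T (Dx u)"
proof -
  obtain K where K: "K > 0" "\<And>x c. x \<ge> 0 \<Longrightarrow> c \<in> {0..T} \<Longrightarrow> \<bar>u x c\<bar> \<le> K \<and> \<bar>ux x c\<bar> \<le> K \<and> \<bar>p x c\<bar> \<le> K
    \<and> \<bar>v x c\<bar> \<le> K \<and> \<bar>w x c\<bar> \<le> K \<and> \<bar>q x c\<bar> \<le> K"
    using global_bound by blast
  show "cont_bdd_on_Q T v" by (rule cont_bdd[OF v_cont, of _ K]) (use K in auto)
  show "cont_bdd_on_Q T (Dx v)" by (rule cont_bdd[OF p_cont, of _ K]) (use K Dx_v in auto)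
  show "cont_bdd_on_Q T (Dc T v)"
    by (rule cont_bdd[of "\<lambda>x c. - u x c" _ K]) (use K Dc_v in \<open>auto intro!: continuous_intros u_cont\<close>)
  show "cont_bdd_on_Q T u" by (rule cont_bdd[OF u_cont, of _ K]) (use K in auto)
  show "cont_bdd_on_Q T (Dx u)" by (rule cont_bdd[OF ux_cont, of _ K]) (use K Dx_u in auto)
qed

lemma AE_positive: "(\<And>x::real. x > 0 \<Longrightarrow> P x) \<Longrightarrow> AE x in lebesgue_on {0<..}. P x"
  by (intro AE_I2) (simp add: space_restrict_space)

context
  fixes \<sigma> :: real
  assumes \<sigma>: "a * \<sigma>\<^sup>2 = 2"
begin

lemma Lop_scaled: "a * Lop \<mu> \<sigma> r c h d x = d + kap c * Dx h x c - a * r * h x c"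
proof -
  have "a * Lop \<mu> \<sigma> r c h d x = 1 / 2 * (a * \<sigma>\<^sup>2) * d + a * (\<mu> - c) * Dx h x c - a * r * h x c"
    by (simp add: Lop_def algebra_simps)
  then show ?thesis by (simp add: \<sigma> kap_def)
qed

lemma gam_eq: "gam \<mu> \<sigma> r T = lam T"
proof -
  have s: "\<sigma>\<^sup>2 = 2 / a" using \<sigma> a by (simp add: field_simps)
  have "a\<^sup>2 * ((\<mu> - T)\<^sup>2 + 2 * \<sigma>\<^sup>2 * r) = (kap T)\<^sup>2 + 2 * a * (a * \<sigma>\<^sup>2) * r"
    by (simp add: kap_def power2_eq_square algebra_simps)
  then have "th T = sqrt (a\<^sup>2 * ((\<mu> - T)\<^sup>2 + 2 * \<sigma>\<^sup>2 * r))"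
    by (simp add: th_def \<sigma>)
  then have "th T = a * sqrt ((\<mu> - T)\<^sup>2 + 2 * \<sigma>\<^sup>2 * r)"
    using a by (simp add: real_sqrt_mult)
  then show ?thesis unfolding gam_def lam_def kap_def s using a by (simp add: field_simps)
qed

lemma gfun_eq: "gfun \<mu> \<sigma> r T = g"
  by (auto simp: gfun_def gam_eq g_def fun_eq_iff)

lemma HJB_equality:
  assumes c: "c \<in> {0..T}" and y: "0 \<le> y" "y \<le> \<beta> c"
  shows "\<exists>d. ((\<lambda>z. Dx v z c) has_real_derivative d) (at y within {0..}) \<and> - Lop \<mu> \<sigma> r c v d y - c = 0"
proof (intro exI conjI)
  have "((\<lambda>x. p x c) has_real_derivative q y c) (at y within {0..})"
    using DERIV_p[OF c y(1)] px_left[OF c y] by simp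
  then show "((\<lambda>z. Dx v z c) has_real_derivative q y c) (at y within {0..})"
    by (rule has_field_derivative_transform_within[OF _ zero_less_one]) (use y Dx_v[OF c] in auto)
  have "a * (- Lop \<mu> \<sigma> r c v (q y c) y - c) = 0"
    using Lop_scaled[of c v "q y c" y] Dx_v[OF c y(1)] by (simp add: q_def algebra_simps)
  then show "- Lop \<mu> \<sigma> r c v (q y c) y - c = 0" using a by simp
qed

lemma VI_scaled:
  assumes c: "c \<in> {0..T}" and x: "x \<ge> 0"
  shows "a * (- Lop \<mu> \<sigma> r c u d x - deriv (gfun \<mu> \<sigma> r T) x - integral {c..T} (\<lambda>s. Dx u x s) + 1) = w x c - d"
proof -
  have "deriv (gfun \<mu> \<sigma> r T) x = g' x" unfolding gfun_eq by (rule DERIV_imp_deriv[OF DERIV_g])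
  moreover have "integral {c..T} (\<lambda>s. Dx u x s) = integral {c..T} (ux x)"
    by (rule Henstock_Kurzweil_Integration.integral_cong) (use c x Dx_u in auto)
  ultimately show ?thesis
    using Lop_scaled[of c u d x] Dx_u[OF c x] by (simp add: w_def p_def algebra_simps)
qed

text \<open>Unlike the equation for \<open>v\<close>, this one cannot include
  \<open>y = \<beta> c\<close>, where \<open>u_xx\<close> jumps. That suffices, since
  \<open>u > 0\<close> at \<open>x\<close> already implies \<open>x < \<beta> c\<close>.\<close>

lemma VI_equality:
  assumes c: "c \<in> {0..T}" and y: "0 \<le> y" "y < \<beta> c"
  shows "\<exists>d. ((\<lambda>z. Dx u z c) has_real_derivative d) (at y within {0..}) \<and>
    - Lop \<mu> \<sigma> r c u d y - deriv (gfun \<mu> \<sigma> r T) y - integral {c..T} (\<lambda>s. Dx u y s) + 1 = 0"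
proof (intro exI conjI)
  have "((\<lambda>x. ux x c) has_real_derivative w y c) (at y within {0..})"
    using DERIV_ux[OF c good_\<beta>[OF c] y(1)] y by simp
  then show "((\<lambda>z. Dx u z c) has_real_derivative w y c) (at y within {0..})"
    by (rule has_field_derivative_transform_within[OF _ zero_less_one]) (use y Dx_u[OF c] in auto)
  show "- Lop \<mu> \<sigma> r c u (w y c) y - deriv (gfun \<mu> \<sigma> r T) y - integral {c..T} (\<lambda>s. Dx u y s) + 1 = 0"
    using VI_scaled[OF c y(1), of "w y c"] a by simp
qed

lemma HJB: "HJB_solution \<mu> \<sigma> r T v"
  unfolding HJB_solution_def
proof (intro conjI ballI allI impI, goal_cases)
  case (6 z)
  then show ?case using Dc_v u_nonneg by (auto simp: Qdom_def)
next
  case (7 c p')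
  then show ?case using piecewise_v[of c] piecewise_C2.W2p_loc by metis
next
  case (8 c)
  then show ?case by (simp add: v_def g_def)
next
  case (9 x)
  then show ?case by (simp add: v_def gfun_eq)
next
  case (10 c)
  obtain K where "piecewise_C2 (\<lambda>x. v x c) (\<lambda>x. p x c) (\<lambda>x. px x c) {} K" using piecewise_v[OF 10] by blast
  then have "has_weak_deriv 2 {0<..} (\<lambda>x. v x c) (\<lambda>x. px x c)" by (rule piecewise_C2.weak_deriv2) auto
  moreover have "0 \<le> - Lop \<mu> \<sigma> r c v (px x c) x - c" if "x > 0" for x
  proof -
    have "a * (- Lop \<mu> \<sigma> r c v (px x c) x - c) = q x c - px x c"
      using Lop_scaled[of c v "px x c" x] Dx_v[OF 10, of x] that by (simp add: q_def algebra_simps)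
    then have "0 \<le> a * (- Lop \<mu> \<sigma> r c v (px x c) x - c)" using px_le[OF 10, of x] that by simp
    then show ?thesis using a by (simp add: zero_le_mult_iff)
  qed
  then have "AE x in lebesgue_on {0<..}. 0 \<le> - Lop \<mu> \<sigma> r c v (px x c) x - c" by (rule AE_positive)
  ultimately show ?case by blast
next
  case (11 z)
  then obtain x c where z: "z = (x, c)" and x: "x \<ge> 0" and c: "c \<in> {0..T}" by (auto simp: Qdom_def)
  have "\<exists>d. ((\<lambda>z. Dx v z c) has_real_derivative d) (at y within {0..}) \<and> - Lop \<mu> \<sigma> r c v d y - c = 0"
    if "Dc T v x c < 0" "y \<in> {0..x}" for y
  proof (rule HJB_equality[OF c])
    show "y \<le> \<beta> c" using that Dc_v[OF c x] u_pos_imp_left[OF c x] by auto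
  qed (use that in auto)
  then show ?case by (simp add: z)
qed (use differentiability cont_bdd_all in auto)

lemma VI: "VI_solution \<mu> \<sigma> r T u"
  unfolding VI_solution_def
proof (intro conjI ballI allI impI, goal_cases)
  case (1 z)
  then show ?case using u_nonneg by (auto simp: Qdom_def)
next
  case (5 c p')
  then show ?case using piecewise_u[of c] piecewise_C2.W2p_loc by metis
next
  case (6 c)
  then show ?case by simp
next
  case (7 c)
  let ?d = "\<lambda>x. if x < \<beta> c then w x c else 0"
  obtain K where "piecewise_C2 (\<lambda>x. u x c) (\<lambda>x. ux x c) ?d {\<beta> c} K" using piecewise_u[OF 7] by blast
  then have "has_weak_deriv 2 {0<..} (\<lambda>x. u x c) ?d" by (rule piecewise_C2.weak_deriv2) auto
  moreover have "0 \<le> - Lop \<mu> \<sigma> r c u (?d x) x - deriv (gfun \<mu> \<sigma> r T) x - integral {c..T} (\<lambda>s. Dx u x s) + 1"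
    if "x > 0" for x
  proof -
    have "0 \<le> w x c - ?d x"
    proof (cases "x < \<beta> c")
      case False
      have "0 \<le> a * (1 - p x c)" using a p_lt_1[OF 7, of x] False by simp
      then show ?thesis using False vanish[OF 7, of x] by (simp add: w_def algebra_simps)
    qed simp
    then have "0 \<le> a * (- Lop \<mu> \<sigma> r c u (?d x) x - deriv (gfun \<mu> \<sigma> r T) x - integral {c..T} (\<lambda>s. Dx u x s) + 1)"
      using VI_scaled[OF 7, of x "?d x"] that by (simp only:)
    then show ?thesis using a by (simp only: zero_le_mult_iff) simp
  qed
  then have "AE x in lebesgue_on {0<..}. 0 \<le> - Lop \<mu> \<sigma> r c u (?d x) x - deriv (gfun \<mu> \<sigma> r T) x
      - integral {c..T} (\<lambda>s. Dx u x s) + 1"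
    by (rule AE_positive)
  ultimately show ?case by blast
next
  case (8 z)
  then obtain x c where z: "z = (x, c)" and x: "x \<ge> 0" and c: "c \<in> {0..T}" by (auto simp: Qdom_def)
  have "\<exists>d. ((\<lambda>z. Dx u z c) has_real_derivative d) (at y within {0..}) \<and>
    - Lop \<mu> \<sigma> r c u d y - deriv (gfun \<mu> \<sigma> r T) y - integral {c..T} (\<lambda>s. Dx u y s) + 1 = 0"
    if "u x c > 0" "y \<in> {0..x}" for y
  proof (rule VI_equality[OF c])
    show "y < \<beta> c" using that u_pos_imp_left[OF c x] by auto
  qed (use that in auto)
  then show ?case by (simp add: z)
qed (use differentiability cont_bdd_all in auto)

end

text \<open>One constant works for all \<alpha>, because \<open>u_x\<close> is Lipschitz in
  \<open>x\<close>.\<close>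

lemma estimates:
  assumes \<alpha>: "0 < \<alpha>" "\<alpha> < 1"
  shows "\<exists>K>0. \<forall>(x, c)\<in>Qdom T.
       0 \<le> v x c \<and> v x c \<le> T / r \<and>
       0 \<le> Dx v x c \<and> Dx v x c \<le> K \<and>
       0 \<le> - Dc T v x c \<and> - Dc T v x c \<le> K \<and>
       (\<forall>y\<ge>x. Dx v y c \<le> max (Dx v x c) 1) \<and>
       C1_Hoelder_norm \<alpha> {0..} (\<lambda>z. u z c) \<le> ennreal K \<and>
       \<bar>Dc T u x c\<bar> \<le> K"
proof -
  obtain K where K: "K > 0" "\<And>x c. x \<ge> 0 \<Longrightarrow> c \<in> {0..T} \<Longrightarrow> \<bar>u x c\<bar> \<le> K \<and> \<bar>ux x c\<bar> \<le> K \<and> \<bar>p x c\<bar> \<le> K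
    \<and> \<bar>v x c\<bar> \<le> K \<and> \<bar>w x c\<bar> \<le> K \<and> \<bar>q x c\<bar> \<le> K"
    using global_bound by blast
  obtain L u_c where L: "L > 0" "\<And>x c. x \<ge> 0 \<Longrightarrow> c \<in> {0..T} \<Longrightarrow>
      (u x has_real_derivative u_c x c) (at c within {0..T}) \<and> \<bar>u_c x c\<bar> \<le> L"
    using u_c_differentiable by blast
  \<comment> \<open>The first summands are the bound of \<open>C1_Hoelder_norm_le\<close> with
    \<open>A = B = C = K\<close>; \<open>L\<close> covers \<open>u_c\<close>.\<close>
  define M where "M = K + K + (K + 2 * K) + L"
  have "M > 0" using K(1) L(1) by (simp add: M_def)
  moreover have "0 \<le> v x c \<and> v x c \<le> T / r \<and> 0 \<le> Dx v x c \<and> Dx v x c \<le> M \<and>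
       0 \<le> - Dc T v x c \<and> - Dc T v x c \<le> M \<and> (\<forall>y\<ge>x. Dx v y c \<le> max (Dx v x c) 1) \<and>
       C1_Hoelder_norm \<alpha> {0..} (\<lambda>z. u z c) \<le> ennreal M \<and> \<bar>Dc T u x c\<bar> \<le> M"
    if x: "x \<ge> 0" and c: "c \<in> {0..T}" for x c
  proof (intro conjI allI impI)
    show "0 \<le> v x c" "v x c \<le> T / r" using v_bounds[OF c x] by auto
    have "p x c \<le> K" "u x c \<le> K" using K(2)[OF x c] by auto
    then show "0 \<le> Dx v x c" "Dx v x c \<le> M" "0 \<le> - Dc T v x c" "- Dc T v x c \<le> M"
      using Dx_v[OF c x] p_nonneg[OF c x] Dc_v[OF c x] u_nonneg[OF x, of c] K(1) L(1) by (auto simp: M_def)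
    show "Dx v y c \<le> max (Dx v x c) 1" if "x \<le> y" for y
      using p_le_max[OF c x that] Dx_v[OF c, of x] Dx_v[OF c, of y] x that by simp
    have "C1_Hoelder_norm \<alpha> {0..} (\<lambda>z. u z c) \<le> ennreal (K + K + (K + 2 * K))"
    proof (rule C1_Hoelder_norm_le[where f' = "\<lambda>x. ux x c"])
      show "\<bar>ux y c - ux z c\<bar> \<le> K * \<bar>y - z\<bar>" if "y \<in> {0..}" "z \<in> {0..}" for y z
        using that K(2) c by (intro ux_lipschitz[OF c good_\<beta>[OF c]]) auto
    qed (use K c \<alpha> nontrivial_x DERIV_u[OF c good_\<beta>[OF c]] in auto)
    also have "\<dots> \<le> ennreal M" using L(1) by (intro ennreal_leI) (simp add: M_def)
    finally show "C1_Hoelder_norm \<alpha> {0..} (\<lambda>z. u z c) \<le> ennreal M" .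
    have "\<bar>Dc T u x c\<bar> \<le> L" using L(2)[OF x c] Dc_eq[of u x "u_c x c" c] c by simp
    then show "\<bar>Dc T u x c\<bar> \<le> M" using K(1) by (simp add: M_def)
  qed
  ultimately show ?thesis unfolding Qdom_def by (intro exI[of _ M]) auto
qed

end

theorem theorem3p3:
  fixes \<mu> \<sigma> r cbar :: real
  assumes "\<mu> > 0" and "\<sigma> > 0" and "r > 0"
    and "0 \<le> cbar" and "cbar \<le> \<mu>"
    and "2 * \<mu> * cbar > \<sigma>\<^sup>2 * r"
  shows "\<exists>v u :: real \<Rightarrow> real \<Rightarrow> real.
    (\<forall>(x, c)\<in>Qdom cbar. v x c = gfun \<mu> \<sigma> r cbar x + integral {c..cbar} (\<lambda>s. u x s)) \<and>
    HJB_solution \<mu> \<sigma> r cbar v \<and>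
    VI_solution \<mu> \<sigma> r cbar u \<and>
    c_differentiable cbar u \<and>
    (\<forall>\<alpha>. 0 < \<alpha> \<and> \<alpha> < 1 \<longrightarrow> (\<exists>K>0. \<forall>(x, c)\<in>Qdom cbar.
       0 \<le> v x c \<and> v x c \<le> cbar / r \<and>
       0 \<le> Dx v x c \<and> Dx v x c \<le> K \<and>
       0 \<le> - Dc cbar v x c \<and> - Dc cbar v x c \<le> K \<and>
       (\<forall>y\<ge>x. Dx v y c \<le> max (Dx v x c) 1) \<and>
       C1_Hoelder_norm \<alpha> {0..} (\<lambda>z. u z c) \<le> ennreal K \<and>
       \<bar>Dc cbar u x c\<bar> \<le> K))"
proof -
  define a where "a = 2 / \<sigma>\<^sup>2"
  have "a > 0" and \<sigma>: "a * \<sigma>\<^sup>2 = 2" using assms(2) by (simp_all add: a_def)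
  have "0 < \<sigma>\<^sup>2 * r" using assms by simp
  \<comment> \<open>For \<open>cbar = 0\<close> the profitability condition would read
    \<open>0 > \<sigma>^2 r\<close>.\<close>
  then have "cbar \<noteq> 0" using assms(6) by auto
  moreover have "r < a * \<mu> * cbar" using assms(2,6) by (simp add: a_def field_simps)
  ultimately interpret ratcheting a r \<mu> cbar
    using assms \<open>a > 0\<close> by unfold_locales auto
  obtain B where B: "B > 0" "integral {0..B} (\<lambda>y. psi cbar y * (g' y - 1)) < 0" "g' B < 1"
    using exists_right_end by blast
  from exists_solution[OF less_imp_le[OF B(1)]]
  obtain f where f: "jcont {0..B} {0..cbar} f"
    "\<And>x c. x \<in> {0..B} \<Longrightarrow> c \<in> {0..cbar} \<Longrightarrow> f x c = g' x - 1 + integral {c..cbar} (D B f x)"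
    by blast
  interpret ratcheting_solution a r \<mu> cbar B f
    using B f by unfold_locales auto
  have repr: "\<forall>(x, c)\<in>Qdom cbar. v x c = gfun \<mu> \<sigma> r cbar x + integral {c..cbar} (\<lambda>s. u x s)"
    by (simp add: v_def gfun_eq[OF \<sigma>] split_beta)
  show ?thesis
    by (rule exI[of _ v], rule exI[of _ u], rule conjI[OF repr], rule conjI[OF HJB[OF \<sigma>]],
        rule conjI[OF VI[OF \<sigma>]], rule conjI[OF differentiability(4)], rule allI, rule impI,
        erule conjE, rule estimates)
qed

end
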